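(* Let $w$ be a standard Brownian motion, $a>0$, $X_0\in\mathbb{R}$, $\beta,\gamma\in(0,1]$, and let $X$ be the solution of $$\partial_t^{\beta}X(t)=-aX(t)+\partial_t^{\gamma}w(t),\qquad X(0)=X_0.$$ (1) If $\beta-\gamma\le-\frac12$, then, on every interval $(0,T)$, $X$ is a $\mathfrak{q}$-generalized process for every sequence $\mathfrak{q}=\{q_k,\,k\ge1\}$ with $0<q_k<1$ satisfying $\sum_{k\ge1}k^{2(\gamma-\beta-1)}q_k<\infty$. (2) If $\beta-\gamma>-\frac12$, then $X$ is a Gaussian Volterra process $$X(t)=X_0E_{\beta}(-at^{\beta})+\int_0^t(t-s)^{\beta-\gamma}E_{\beta,\beta-\gamma+1}\big(-a(t-s)^{\beta}\big)\,dw(s),$$ and: (a) if $\gamma>1/2$, then, as $t\to+\infty$, $X(t)$ converges in distribution to a Gaussian random variable with mean zero and variance $$\sigma^2_{\infty}(a,\beta,\gamma)=\int_0^{+\infty}s^{2(\beta-\gamma)}E^2_{\beta,\beta-\gamma+1}(-as^{\beta})\,ds;$$ (b) if $\gamma=1/2$, then, as $t\to\infty$, $X(t)$ is a Gaussian random variable with mean of order $t^{-\beta}$ and variance of order $\ln t$; (c) if $\gamma<1/2$, then, as $t\to\infty$, $X(t)$ is a Gaussian random variable with mean of order $t^{-\beta}$ and variance of order $t^{1-2\gamma}$.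
   Context: For $p>0$, $J^{p}f(t)=\frac{1}{\Gamma(p)}\int_0^t(t-s)^{p-1}(f(s)-f(0))\,ds$, $J^0f(t)=f(t)-f(0)$, and $\partial_t^{\beta}f=\frac{d}{dt}J^{1-\beta}f$. When $\beta-\gamma>-1/2$, a solution is a continuous process with $X(0)=X_0$ and, for every $T>0$, $\mathbb{P}\big(J^{1-\beta}X(t)=-a\int_0^tX(s)\,ds+J^{1-\gamma}w(t),\ t\in[0,T]\big)=1$. The Mittag-Leffler functions are $E_{\beta,\rho}(z)=\sum_{k=0}^{\infty}\frac{z^k}{\Gamma(\beta k+\rho)}$, $E_{\beta}=E_{\beta,1}$. A process $V=V(t)$, $t\in[0,T]$, is called a Gaussian Volterra process with kernel $K$ if there is a non-random function $K=K(t,s)$ such that $K(t,s)=0$ for $s>t$, $K\in L_2((0,T)^2)$, and $\mathbb{P}\big(V(t)=\int_0^tK(t,s)\,dw(s),\ t\in[0,T]\big)=1$; in (2) the term is applied to the process given by the displayed formula, which includes the non-random term $X_0E_{\beta}(-at^{\beta})$. Chaos expansion on $(0,T)$: $\mathfrak{m}_1(t)=1/\sqrt{T}$, $\mathfrak{m}_k(t)=\sqrt{2/T}\cos(\pi t(k-1)/T)$ for $k\ge2$; $\xi_k=\int_0^T\mathfrak{m}_k\,dw$; $\mathcal{J}$ is the set of multi-indices $\boldsymbol{\alpha}=(\alpha_k,k\ge1)$ of non-negative integers with $|\boldsymbol{\alpha}|=\sum_k\alpha_k<\infty$; $\xi_{\boldsymbol{\alpha}}=\prod_k\mathrm{H}_{\alpha_k}(\xi_k)/\sqrt{\alpha_k!}$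 with $\mathrm{H}_n(x)=(-1)^ne^{x^2/2}\frac{d^n}{dx^n}e^{-x^2/2}$. When $\beta-\gamma\le-1/2$, the solution $X$ is the formal chaos series obtained by solving the equation coefficient-by-coefficient, using $w(t)=\sum_k\xi_k\int_0^t\mathfrak{m}_k(s)\,ds$; that is, $$X(t)=X_0E_{\beta}(-at^{\beta})+\sum_{k\ge1}\xi_k\int_0^t(t-s)^{\beta-\gamma}E_{\beta,\beta-\gamma+1}\big(-a(t-s)^{\beta}\big)\mathfrak{m}_k(s)\,ds.$$ With $\mathfrak{q}^{\boldsymbol{\alpha}}=\prod_kq_k^{\alpha_k}$, a $\mathfrak{q}$-generalized process is a formal series $\sum_{\boldsymbol{\alpha}\in\mathcal{J}}x_{\boldsymbol{\alpha}}(t)\xi_{\boldsymbol{\alpha}}$ with non-random $x_{\boldsymbol{\alpha}}\in L_2((0,T))$ and $\sum_{\boldsymbol{\alpha}\in\mathcal{J}}\mathfrak{q}^{\boldsymbol{\alpha}}\|x_{\boldsymbol{\alpha}}\|^2_{L_2((0,T))}<\infty$.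
   Formalization: In (b) and (c), the mean is shown to be of exact order t^{-β} only when X_0 ≠ 0 and β < 1; otherwise only the upper bound O(t^{-β}) is stated, since the mean is 0 if X_0 = 0 and X_0 e^{-at} if β = 1. *)

theory Defs
  imports "HOL-Probability.Probability" "HOL-Library.Landau_Symbols"
begin

definition mittag_leffler :: "real \<Rightarrow> real \<Rightarrow> real \<Rightarrow> real" where
  "mittag_leffler \<beta> \<rho> z = (\<Sum>k. z ^ k / Gamma (\<beta> * real k + \<rho>))"

text \<open>Riemann--Liouville integral \<open>J\<^sup>p\<close> of \<open>f - f 0\<close>, so that
  \<open>\<partial>\<^sub>t\<^sup>\<beta> f = d/dt (frac_integral (1 - \<beta>) f)\<close>.\<close>

definition frac_integral :: "real \<Rightarrow> (real \<Rightarrow> real) \<Rightarrow> real \<Rightarrow> real" where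
  "frac_integral p f t =
     (if p = 0 then f t - f 0
      else 1 / Gamma p * (LBINT s:{0..t}. (t - s) powr (p - 1) * (f s - f 0)))"

definition square_integrable_on :: "'b measure \<Rightarrow> 'b set \<Rightarrow> ('b \<Rightarrow> real) \<Rightarrow> bool" where
  "square_integrable_on N A f \<longleftrightarrow>
     set_borel_measurable N A f \<and> set_integrable N A (\<lambda>x. (f x)\<^sup>2)"


subsection \<open>Brownian motion, Wiener integral, Gaussian laws\<close>

text \<open>Time runs over \<open>[0, \<infinity>)\<close>; the values \<open>w t\<close> for \<open>t < 0\<close> are irrelevant.\<close>

definition standard_brownian_motion :: "'a measure \<Rightarrow> (real \<Rightarrow> 'a \<Rightarrow> real) \<Rightarrow> bool" where
  "standard_brownian_motion M w \<longleftrightarrow>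
     prob_space M \<and>
     (\<forall>t\<ge>0. w t \<in> borel_measurable M) \<and>
     (AE \<omega> in M. w 0 \<omega> = 0) \<and>
     (\<forall>s t. 0 \<le> s \<and> s < t \<longrightarrow>
        distributed M lborel (\<lambda>\<omega>. w t \<omega> - w s \<omega>) (normal_density 0 (sqrt (t - s)))) \<and>
     (\<forall>n (\<tau> :: nat \<Rightarrow> real). 0 \<le> \<tau> 0 \<and> mono \<tau> \<longrightarrow>
        prob_space.indep_vars M (\<lambda>_. borel) (\<lambda>i \<omega>. w (\<tau> (Suc i)) \<omega> - w (\<tau> i) \<omega>) {..<n}) \<and>
     (AE \<omega> in M. continuous_on {0..} (\<lambda>t. w t \<omega>))"

definition step_function :: "nat \<Rightarrow> (nat \<Rightarrow> real) \<Rightarrow> (nat \<Rightarrow> real) \<Rightarrow> real \<Rightarrow> real" where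
  "step_function n c p s = (\<Sum>i<n. c i * indicator {p i<..p (Suc i)} s)"

definition step_wiener_integral ::
  "(real \<Rightarrow> 'a \<Rightarrow> real) \<Rightarrow> nat \<Rightarrow> (nat \<Rightarrow> real) \<Rightarrow> (nat \<Rightarrow> real) \<Rightarrow> 'a \<Rightarrow> real" where
  "step_wiener_integral w n c p \<omega> = (\<Sum>i<n. c i * (w (p (Suc i)) \<omega> - w (p i) \<omega>))"

text \<open>\<open>has_wiener_integral M w t f I\<close> says that the random variable \<open>I\<close> is (a version of)
  \<open>\<integral>\<^sub>0\<^sup>t f dw\<close> for a non-random \<open>f\<close>: step functions on \<open>[0, t]\<close> converge to \<open>f\<close> in
  \<open>L\<^sub>2((0, t))\<close> while their integrals converge to \<open>I\<close> in \<open>L\<^sub>2(M)\<close>. By the Ito isometry \<open>I\<close> is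
  determined up to a null set. The \<open>L\<^sub>2\<close> distances are nonnegative (\<open>ennreal\<close>-valued)
  integrals, so that they are meaningful without integrability side conditions.\<close>

definition has_wiener_integral ::
  "'a measure \<Rightarrow> (real \<Rightarrow> 'a \<Rightarrow> real) \<Rightarrow> real \<Rightarrow> (real \<Rightarrow> real) \<Rightarrow> ('a \<Rightarrow> real) \<Rightarrow> bool" where
  "has_wiener_integral M w t f I \<longleftrightarrow>
     I \<in> borel_measurable M \<and> set_borel_measurable lborel {0..t} f \<and>
     (\<exists>(n :: nat \<Rightarrow> nat) (c :: nat \<Rightarrow> nat \<Rightarrow> real) (p :: nat \<Rightarrow> nat \<Rightarrow> real).
        (\<forall>j. 0 \<le> p j 0 \<and> (\<forall>i<n j. p j i \<le> p j (Suc i)) \<and> p j (n j) \<le> t) \<and>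
        (\<lambda>j. \<integral>\<^sup>+s\<in>{0..t}. ennreal ((f s - step_function (n j) (c j) (p j) s)\<^sup>2) \<partial>lborel)
          \<longlonglongrightarrow> 0 \<and>
        (\<lambda>j. \<integral>\<^sup>+\<omega>. ennreal ((I \<omega> - step_wiener_integral w (n j) (c j) (p j) \<omega>)\<^sup>2) \<partial>M)
          \<longlonglongrightarrow> 0)"

text \<open>The Wiener integral is only defined up to a null set for each single \<open>t\<close>; the event
  \<open>{V t = \<integral>\<^sub>0\<^sup>t K t s dw(s) for all t \<in> [0, T]}\<close> is therefore formulated with a process \<open>Y\<close>
  consisting of versions of the integrals.\<close>

definition gaussian_volterra_process ::
  "'a measure \<Rightarrow> (real \<Rightarrow> 'a \<Rightarrow> real) \<Rightarrow> real \<Rightarrow> (real \<Rightarrow> real \<Rightarrow> real) \<Rightarrow> (real \<Rightarrow> 'a \<Rightarrow> real) \<Rightarrow> bool"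
  where
  "gaussian_volterra_process M w T K V \<longleftrightarrow>
     (\<forall>t s. s > t \<longrightarrow> K t s = 0) \<and>
     square_integrable_on (lborel \<Otimes>\<^sub>M lborel) ({0<..<T} \<times> {0<..<T}) (\<lambda>(t, s). K t s) \<and>
     (\<exists>Y. (\<forall>t\<in>{0..T}. has_wiener_integral M w t (K t) (Y t)) \<and>
          (AE \<omega> in M. \<forall>t\<in>{0..T}. V t \<omega> = Y t \<omega>))"

text \<open>The second parameter is the variance; variance \<open>0\<close> gives the point mass.\<close>

definition gaussian_law :: "real \<Rightarrow> real \<Rightarrow> real measure" where
  "gaussian_law \<mu> v =
     (if v = 0 then return borel \<mu> else density lborel (normal_density \<mu> (sqrt v)))"

definition converges_in_distribution_at_top ::
  "'a measure \<Rightarrow> (real \<Rightarrow> 'a \<Rightarrow> real) \<Rightarrow> real measure \<Rightarrow> bool" where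
  "converges_in_distribution_at_top M X N \<longleftrightarrow>
     (\<forall>\<tau> :: nat \<Rightarrow> real. filterlim \<tau> at_top sequentially \<longrightarrow>
        weak_conv_m (\<lambda>n. distr M borel (X (\<tau> n))) N)"


subsection \<open>The equation\<close>

text \<open>Solutions of \<open>\<partial>\<^sub>t\<^sup>\<beta> X = -a X + \<partial>\<^sub>t\<^sup>\<gamma> w\<close>, \<open>X(0) = X0\<close>, in integrated form
  (the notion used for \<open>\<beta> - \<gamma> > -1/2\<close>).\<close>

definition is_solution ::
  "'a measure \<Rightarrow> (real \<Rightarrow> 'a \<Rightarrow> real) \<Rightarrow> real \<Rightarrow> real \<Rightarrow> real \<Rightarrow> real \<Rightarrow> (real \<Rightarrow> 'a \<Rightarrow> real) \<Rightarrow> bool"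
  where
  "is_solution M w a \<beta> \<gamma> X0 X \<longleftrightarrow>
     (\<forall>t\<ge>0. X t \<in> borel_measurable M) \<and>
     (AE \<omega> in M. continuous_on {0..} (\<lambda>t. X t \<omega>)) \<and>
     (AE \<omega> in M. X 0 \<omega> = X0) \<and>
     (\<forall>T>0. AE \<omega> in M. \<forall>t\<in>{0..T}.
        frac_integral (1 - \<beta>) (\<lambda>s. X s \<omega>) t =
          - a * (LBINT s:{0..t}. X s \<omega>) + frac_integral (1 - \<gamma>) (\<lambda>s. w s \<omega>) t)"

definition solution_kernel :: "real \<Rightarrow> real \<Rightarrow> real \<Rightarrow> real \<Rightarrow> real \<Rightarrow> real" where
  "solution_kernel a \<beta> \<gamma> t s =
     (if s < t
      then (t - s) powr (\<beta> - \<gamma>) * mittag_leffler \<beta> (\<beta> - \<gamma> + 1) (- a * (t - s) powr \<beta>)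
      else 0)"


subsection \<open>Chaos expansion\<close>

text \<open>Multi-indices are indexed by \<open>k \<ge> 1\<close>; the unused entry at \<open>0\<close> is required to vanish.\<close>

definition multi_indices :: "(nat \<Rightarrow> nat) set" where
  "multi_indices = {\<alpha>. \<alpha> 0 = 0 \<and> finite {k. \<alpha> k \<noteq> 0}}"

definition unit_index :: "nat \<Rightarrow> nat \<Rightarrow> nat" where
  "unit_index k = (\<lambda>j. if j = k then 1 else 0)"

definition cos_basis :: "real \<Rightarrow> nat \<Rightarrow> real \<Rightarrow> real" where
  "cos_basis T k t =
     (if k = 1 then 1 / sqrt T else sqrt (2 / T) * cos (pi * t * (real k - 1) / T))"

definition hermite :: "nat \<Rightarrow> real \<Rightarrow> real" where
  "hermite n x = (-1) ^ n * exp (x\<^sup>2 / 2) * (deriv ^^ n) (\<lambda>y. exp (- (y\<^sup>2 / 2))) x"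

text \<open>\<open>\<xi>\<^sub>\<alpha>\<close> in terms of \<open>\<xi>\<^sub>k = \<integral>\<^sub>0\<^sup>T cos_basis T k dw\<close>.\<close>

definition chaos_basis :: "(nat \<Rightarrow> 'a \<Rightarrow> real) \<Rightarrow> (nat \<Rightarrow> nat) \<Rightarrow> 'a \<Rightarrow> real" where
  "chaos_basis \<xi> \<alpha> \<omega> = (\<Prod>k | \<alpha> k \<noteq> 0. hermite (\<alpha> k) (\<xi> k \<omega>) / sqrt (fact (\<alpha> k)))"

text \<open>A formal chaos series \<open>\<Sum>\<alpha>. x\<^sub>\<alpha>(t) \<xi>\<^sub>\<alpha>\<close> is represented by its family of
  coefficients \<open>x :: (nat \<Rightarrow> nat) \<Rightarrow> real \<Rightarrow> real\<close>, read on \<open>multi_indices\<close>. The two lemmas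
  below say that \<open>\<xi>\<^sub>0 = 1\<close> and \<open>\<xi>\<^sub>\<alpha> = \<xi>\<^sub>k\<close> for \<open>\<alpha> = unit_index k\<close>; hence a formal series
  \<open>y(t) + \<Sum>k\<ge>1. \<xi>\<^sub>k y\<^sub>k(t)\<close> has coefficients \<open>y\<close> at \<open>\<alpha> = 0\<close>, \<open>y\<^sub>k\<close> at \<open>unit_index k\<close>, and
  \<open>0\<close> elsewhere.\<close>

lemma chaos_basis_zero: "chaos_basis \<xi> (\<lambda>_. 0) \<omega> = 1"
  by (simp add: chaos_basis_def)

lemma chaos_basis_unit: "chaos_basis \<xi> (unit_index k) \<omega> = \<xi> k \<omega>"
proof -
  have "((\<lambda>y::real. exp (- (y\<^sup>2 / 2))) has_real_derivative - x * exp (- (x\<^sup>2 / 2))) (at x)"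
    for x :: real
    by (auto intro!: derivative_eq_intros)
  then have "deriv (\<lambda>y::real. exp (- (y\<^sup>2 / 2))) x = - x * exp (- (x\<^sup>2 / 2))" for x
    by (rule DERIV_imp_deriv)
  then have "hermite 1 x = x" for x
    by (simp add: hermite_def exp_minus)
  moreover have "{j. unit_index k j \<noteq> 0} = {k}"
    by (auto simp: unit_index_def)
  ultimately show ?thesis
    by (simp add: chaos_basis_def unit_index_def)
qed

definition q_generalized_process ::
  "(nat \<Rightarrow> real) \<Rightarrow> real \<Rightarrow> ((nat \<Rightarrow> nat) \<Rightarrow> real \<Rightarrow> real) \<Rightarrow> bool" where
  "q_generalized_process q T x \<longleftrightarrow>
     (\<forall>\<alpha>\<in>multi_indices. square_integrable_on lborel {0<..<T} (x \<alpha>)) \<and>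
     (\<lambda>\<alpha>. (\<Prod>k | \<alpha> k \<noteq> 0. q k ^ \<alpha> k) * (LBINT t:{0<..<T}. (x \<alpha> t)\<^sup>2))
       summable_on multi_indices"

text \<open>The solution for \<open>\<beta> - \<gamma> \<le> -1/2\<close>, as a formal chaos series on \<open>(0, T)\<close>:
  \<open>X(t) = X0 E\<^sub>\<beta>(-a t\<^sup>\<beta>) + \<Sum>k\<ge>1. \<xi>\<^sub>k \<integral>\<^sub>0\<^sup>t solution_kernel a \<beta> \<gamma> t s cos_basis T k s ds\<close>.
  The sum over \<open>k\<close> in the coefficient of \<open>\<xi>\<^sub>\<alpha>\<close> has at most one term.\<close>

definition chaos_solution ::
  "real \<Rightarrow> real \<Rightarrow> real \<Rightarrow> real \<Rightarrow> real \<Rightarrow> (nat \<Rightarrow> nat) \<Rightarrow> real \<Rightarrow> real" where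
  "chaos_solution a \<beta> \<gamma> X0 T \<alpha> t =
     (if \<alpha> = (\<lambda>_. 0) then X0 * mittag_leffler \<beta> 1 (- a * t powr \<beta>) else 0) +
     (\<Sum>k | 1 \<le> k \<and> \<alpha> = unit_index k.
        LBINT s:{0..t}. solution_kernel a \<beta> \<gamma> t s * cos_basis T k s)"

end

theory Submission
  imports Defs
begin

text \<open>
  Everything is governed by the kernels
  \<open>G \<rho> t = t\<^sup>\<rho>\<^sup>-\<^sup>1 E\<^sub>\<beta>\<^sub>,\<^sub>\<rho>(-a t\<^sup>\<beta>)\<close>, alternating sums of Riesz kernels
  \<open>t\<^sup>p\<^sup>-\<^sup>1 / \<Gamma>(p)\<close>. Beta integrals turn convolution with a Riesz kernel into a shift of \<open>\<rho>\<close>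
  (\<open>conv_riesz_ml_kernel\<close>), so \<open>G \<beta>\<close> is the resolvent of the fractional equation. Convolving a path of
  the integrated equation with \<open>G \<beta>\<close> therefore solves it outright: by associativity of convolution alone,
  \<open>\<integral>\<^sub>0\<^sup>t X = X0 G 2 t + \<integral>\<^sub>0\<^sup>t G \<rho> (t - s) w(s) ds\<close> with \<open>\<rho> = \<beta> - \<gamma> + 1\<close> (\<open>pathwise_solution\<close>).

  To see that \<open>X t\<close> itself is a Wiener integral, the last identity is differentiated backwards in time.
  The integral of a deterministic function against the path is the Wiener integral of its tail integral
  (\<open>riemann_integral_of_path\<close>, by Riemann sums), so each difference quotient is the Wiener
  integral of a difference quotient of \<open>G (\<rho> + 1)\<close>. The latter converge in \<open>L\<^sub>2\<close> to \<open>G \<rho> (t - s)\<close> exactly because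
  \<open>\<rho> > 1/2\<close> (\<open>difference_quotient_L2\<close>), while the former converge to \<open>X t\<close> minus its mean along almost every
  path. Wiener integrals are closed under such joint convergence (\<open>has_wiener_integral_limit\<close>, from the isometry on
  step functions and Fatou's lemma), and they are Gaussian because characteristic functions are continuous in
  \<open>L\<^sub>2\<close> (\<open>wiener_integral_law\<close>).

  The long-time behaviour needs two-sided bounds of order \<open>t\<^sup>-\<^sup>\<gamma>\<close> for \<open>G (\<beta> - \<gamma> + 1)\<close>; the mean is the case
  \<open>\<gamma> = \<beta>\<close>, and the lower bound holds for \<open>\<gamma> < 1\<close>. A maximum principle for fractional derivatives
  (\<open>fractional_extremum_principle\<close>), applied to \<open>G 1\<close> and to \<open>t G \<beta> t\<close>, gives \<open>G 1 \<ge> 0\<close>, \<open>G \<beta> \<ge> 0\<close> and \<open>a t G \<beta> t \<le> \<beta>\<close>. Hence \<open>a G \<beta>\<close> is a density of total mass one with a decreasing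
  majorant \<open>\<beta> / t\<close>, and for \<open>\<gamma> < 1\<close> its convolution \<open>G (\<beta> - \<gamma> + 1)\<close> with a multiple of \<open>t\<^sup>-\<^sup>\<gamma>\<close> decays at the rate of that
  power (\<open>G_upper_bound\<close>, \<open>G_lower_bound\<close>). Integrating the squares yields a finite limit, a logarithm or a power,
  according to the sign of \<open>\<gamma> - 1/2\<close>.

  In the singular case \<open>\<beta> - \<gamma> \<le> -1/2\<close> the kernel is no longer square integrable at the origin, but its cosine
  coefficients on \<open>(0, t)\<close> are of order \<open>k\<^sup>-\<^sup>\<rho>\<close> uniformly in \<open>t\<close> (\<open>oscillatory_bound\<close>: integrate directly up to
  one wavelength and by parts beyond it). Only the multi-indices \<open>0\<close> and \<open>unit_index k\<close> carry non-zero
  coefficients, so this bound is the summability claim.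
\<close>

section \<open>Riesz and Mittag-Leffler kernels\<close>

text \<open>Restricting the Gamma integral to \<open>[A, A + 1]\<close> gives exponential growth at every rate, which is all that
  is needed for the Mittag-Leffler series to converge everywhere.\<close>

lemma Gamma_ge_powr:
  fixes A x :: real
  assumes "0 < A" "1 \<le> x"
  shows "A powr (x - 1) * exp (- (A + 1)) \<le> Gamma x"
proof -
  have "ennreal (A powr (x - 1) * exp (- (A + 1))) =
      (\<integral>\<^sup>+t. ennreal (A powr (x - 1) * exp (- (A + 1))) * indicator {A..A+1} t \<partial>lborel)"
    by (subst nn_integral_cmult_indicator) auto
  also have "\<dots> \<le> (\<integral>\<^sup>+t. ennreal (indicator {0..} t * t powr (x - 1) / exp t) \<partial>lborel)"
  proof (rule nn_integral_mono)
    fix t :: real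
    have "A powr (x - 1) * exp (- (A + 1)) \<le> t powr (x - 1) / exp t" if "t \<in> {A..A+1}"
    proof -
      have "A powr (x - 1) * exp (- (A + 1)) \<le> t powr (x - 1) * exp (- t)"
        using that assms by (intro mult_mono powr_mono2) auto
      then show ?thesis by (simp add: exp_minus field_simps)
    qed
    then show "ennreal (A powr (x - 1) * exp (- (A + 1))) * indicator {A..A+1} t
        \<le> ennreal (indicator {0..} t * t powr (x - 1) / exp t)"
      using assms by (auto simp: indicator_def intro!: ennreal_leI)
  qed
  also have "\<dots> = ennreal (Gamma x)"
    using assms by (intro Gamma_conv_nn_integral_real[symmetric]) auto
  finally show ?thesis
    using assms Gamma_real_pos[of x] by (subst (asm) ennreal_le_iff) auto
qed

lemma mittag_leffler_summable:
  fixes \<beta> \<rho> z :: real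
  assumes "0 < \<beta>"
  shows "summable (\<lambda>k. norm (z ^ k / Gamma (\<beta> * real k + \<rho>)))"
proof -
  \<comment> \<open>Chosen so that the growth rate of the denominators beats the numerators by a factor 2.\<close>
  define A where "A = (2 * \<bar>z\<bar> + 1) powr (1 / \<beta>)"
  have A: "A > 0" and Ab: "A powr \<beta> = 2 * \<bar>z\<bar> + 1"
    using assms by (auto simp: A_def powr_powr)
  define C where "C = exp (A + 1) / A powr (\<rho> - 1)"
  have "summable (\<lambda>k. C * (1/2) ^ k :: real)"
    by (intro summable_mult summable_geometric) auto
  moreover have "eventually (\<lambda>k. norm (norm (z ^ k / Gamma (\<beta> * real k + \<rho>))) \<le> C * (1/2) ^ k) sequentially"
  proof (rule eventually_sequentiallyI)
    fix k :: nat assume k: "k \<ge> nat \<lceil>(1 - \<rho>) / \<beta>\<rceil>"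
    then have "real k \<ge> (1 - \<rho>) / \<beta>" by linarith
    then have x: "1 \<le> \<beta> * real k + \<rho>" using assms by (simp add: field_simps)
    have "A powr (\<beta> * real k + \<rho> - 1) = (A powr \<beta>) ^ k * A powr (\<rho> - 1)"
      using A by (simp add: powr_powr powr_add[symmetric] add_diff_eq flip: powr_realpow)
    then have "Gamma (\<beta> * real k + \<rho>) \<ge> (2 * \<bar>z\<bar> + 1) ^ k / C"
      using Gamma_ge_powr[OF A x] Ab by (simp add: C_def exp_minus exp_diff exp_add field_simps)
    moreover have "(2 * \<bar>z\<bar>) ^ k \<le> (2 * \<bar>z\<bar> + 1) ^ k" by (intro power_mono) auto
    moreover have "C > 0" using A by (simp add: C_def)
    ultimately have "(2 * \<bar>z\<bar>) ^ k \<le> C * Gamma (\<beta> * real k + \<rho>)"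
      by (smt (verit) divide_le_eq mult.commute)
    moreover have "Gamma (\<beta> * real k + \<rho>) > 0" using x by (intro Gamma_real_pos) auto
    ultimately show "norm (norm (z ^ k / Gamma (\<beta> * real k + \<rho>))) \<le> C * (1/2) ^ k"
      by (simp add: power_mult_distrib power_abs field_simps)
  qed
  ultimately show ?thesis by (rule summable_comparison_test_ev[rotated])
qed

text \<open>Extending the kernels by zero makes convolutions integrals over the whole line, with no moving
  limits of integration.\<close>

definition riesz :: "real \<Rightarrow> real \<Rightarrow> real" where
  "riesz p t = (if 0 < t then t powr (p - 1) / Gamma p else 0)"

definition ml_kernel :: "real \<Rightarrow> real \<Rightarrow> real \<Rightarrow> real \<Rightarrow> real" where
  "ml_kernel \<beta> a \<rho> t =
     (if 0 < t then t powr (\<rho> - 1) * mittag_leffler \<beta> \<rho> (- a * t powr \<beta>) else 0)"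

definition conv :: "(real \<Rightarrow> real) \<Rightarrow> (real \<Rightarrow> real) \<Rightarrow> real \<Rightarrow> real" where
  "conv k f t = (\<integral>s. k (t - s) * f s \<partial>lborel)"

lemma riesz_measurable [measurable]: "riesz p \<in> borel_measurable borel"
  unfolding riesz_def by measurable

lemma riesz_nonneg: "0 < p \<Longrightarrow> 0 \<le> riesz p t"
  by (auto simp: riesz_def intro!: divide_nonneg_pos Gamma_real_pos)

text \<open>The Beta integral, after rescaling \<open>[0, t]\<close> to \<open>[0, 1]\<close>: the semigroup law of fractional integration.\<close>

lemma has_bochner_integral_riesz_riesz:
  assumes "0 < p" "0 < q"
  shows "has_bochner_integral lborel (\<lambda>s. riesz p (t - s) * riesz q s) (riesz (p + q) t)"
proof (cases "0 < t")
  case False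
  then have "(\<lambda>s. riesz p (t - s) * riesz q s) = (\<lambda>_. 0)" "riesz (p + q) t = 0"
    by (auto simp: riesz_def fun_eq_iff)
  then show ?thesis by (simp add: has_bochner_integral_zero)
next
  case True
  let ?b = "\<lambda>x::real. x powr (q - 1) * (1 - x) powr (p - 1)"
  have int: "set_integrable lborel {0..1} ?b" using assms by (intro integrable_Beta)
  have "(LBINT x:{0..1}. ?b x) = Beta q p"
    using set_borel_integral_eq_integral(2)[OF int] has_integral_Beta_real[OF assms(2,1)]
    by (simp add: integral_unique)
  with int have "has_bochner_integral lborel (\<lambda>x. indicator {0..1} x * ?b x) (Beta q p)"
    by (simp add: set_integrable_def set_lebesgue_integral_def has_bochner_integral_iff)
  then have "has_bochner_integral lborel
      (\<lambda>x. t powr (p + q - 2) / (Gamma p * Gamma q) * (indicator {0..1} x * ?b x))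
      (t powr (p + q - 2) / (Gamma p * Gamma q) * Beta q p)"
    by (rule has_bochner_integral_mult_right)
  also have "t powr (p + q - 2) / (Gamma p * Gamma q) * Beta q p = riesz (p + q) t / t"
  proof -
    have "Gamma p \<noteq> 0" "Gamma q \<noteq> 0" "Gamma (p + q) \<noteq> 0"
      using assms by (simp_all add: less_imp_neq[OF Gamma_real_pos, symmetric])
    then show ?thesis
      using True by (simp add: Beta_def riesz_def add.commute powr_diff field_simps power2_eq_square)
  qed
  finally have B: "has_bochner_integral lborel
      (\<lambda>x. t powr (p + q - 2) / (Gamma p * Gamma q) * (indicator {0..1} x * ?b x)) (riesz (p + q) t / t)" .
  have eq: "t powr (p + q - 2) / (Gamma p * Gamma q) * (indicator {0..1} x * ?b x) =
      riesz p (t - (0 + t * x)) * riesz q (0 + t * x)" for x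
  proof (cases "0 < x \<and> x < 1")
    case xx: True
    then have "t - t * x = t * (1 - x)" "t * (1 - x) > 0" using True by (auto simp: algebra_simps)
    then have "riesz p (t - (0 + t * x)) * riesz q (0 + t * x) =
       (t powr (p - 1) * t powr (q - 1)) * ?b x / (Gamma p * Gamma q)"
      using xx True by (simp add: riesz_def powr_mult)
    also have "t powr (p - 1) * t powr (q - 1) = t powr (p + q - 2)"
      by (simp add: powr_add[symmetric])
    finally show ?thesis using xx by simp
  next
    case False
    then have "x \<le> 0 \<or> x \<ge> 1" by auto
    moreover have "\<not> t - t * x > 0" if "x \<ge> 1" using that True by (simp add: mult_le_cancel_left1)
    moreover have "\<not> t * x > 0" if "x \<le> 0" using that True by (simp add: zero_less_mult_iff)
    ultimately show ?thesis
      using False by (auto simp: riesz_def indicator_def)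
  qed
  have "has_bochner_integral lborel (\<lambda>x. riesz p (t - (0 + t * x)) * riesz q (0 + t * x))
      (riesz (p + q) t / t)"
    using B unfolding eq .
  then show ?thesis
    using lborel_has_bochner_integral_real_affine_iff[of t "\<lambda>s. riesz p (t - s) * riesz q s" "riesz (p+q) t" 0] True
    by (simp add: divide_inverse mult.commute)
qed

text \<open>In terms of Riesz kernels, the Mittag-Leffler kernel is the Neumann series of the fractional equation.\<close>

lemma ml_kernel_sums:
  assumes "0 < \<beta>"
  shows "(\<lambda>k. (- a) ^ k * riesz (\<beta> * real k + \<rho>) t) sums ml_kernel \<beta> a \<rho> t"
    and "summable (\<lambda>k. norm ((- a) ^ k * riesz (\<beta> * real k + \<rho>) t))"
proof -
  have *: "(- a) ^ k * riesz (\<beta> * real k + \<rho>) t =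
      (if 0 < t then t powr (\<rho> - 1) * ((- a * t powr \<beta>) ^ k / Gamma (\<beta> * real k + \<rho>)) else 0)" for k
  proof -
    have "(- a * t powr \<beta>) ^ k = (- a) ^ k * t powr (\<beta> * real k)" if "0 < t"
      unfolding power_mult_distrib using that by (simp add: powr_powr[symmetric] powr_realpow)
    moreover have "t powr (\<beta> * real k + \<rho> - 1) = t powr (\<rho> - 1) * t powr (\<beta> * real k)"
      by (simp add: powr_add[symmetric] algebra_simps)
    ultimately show ?thesis
      by (simp add: riesz_def)
  qed
  note s = mittag_leffler_summable[OF assms, of "- a * t powr \<beta>" \<rho>]
  show "(\<lambda>k. (- a) ^ k * riesz (\<beta> * real k + \<rho>) t) sums ml_kernel \<beta> a \<rho> t"
    unfolding * ml_kernel_def mittag_leffler_def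
    using sums_mult[OF summable_sums[OF summable_norm_cancel[OF s]], of "t powr (\<rho> - 1)"] by simp
  show "summable (\<lambda>k. norm ((- a) ^ k * riesz (\<beta> * real k + \<rho>) t))"
    unfolding * using summable_mult[OF s, of "norm (t powr (\<rho> - 1))"]
    by (cases "0 < t") (simp_all only: norm_mult if_True if_False norm_zero summable_zero)
qed

lemma ml_kernel_measurable [measurable]:
  assumes "0 < \<beta>"
  shows "ml_kernel \<beta> a \<rho> \<in> borel_measurable borel"
proof (rule borel_measurable_LIMSEQ_real)
  show "(\<lambda>n. \<Sum>k<n. (- a) ^ k * riesz (\<beta> * real k + \<rho>) t) \<longlonglongrightarrow> ml_kernel \<beta> a \<rho> t" for t
    using ml_kernel_sums(1)[OF assms] by (simp add: sums_def)
qed measurable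

text \<open>Splitting off the first term of the series; equivalently, \<open>G \<rho>\<close> solves the fractional equation
  with a Riesz kernel as forcing term.\<close>

lemma ml_kernel_recurrence:
  assumes "0 < \<beta>"
  shows "ml_kernel \<beta> a \<rho> t = riesz \<rho> t - a * ml_kernel \<beta> a (\<rho> + \<beta>) t"
proof -
  note s = ml_kernel_sums(1)[OF assms]
  have "(\<lambda>k. - a * ((- a) ^ k * riesz (\<beta> * real k + (\<rho> + \<beta>)) t)) sums (- a * ml_kernel \<beta> a (\<rho> + \<beta>) t)"
    by (intro sums_mult s)
  also have "(\<lambda>k. - a * ((- a) ^ k * riesz (\<beta> * real k + (\<rho> + \<beta>)) t)) =
     (\<lambda>k. (- a) ^ Suc k * riesz (\<beta> * real (Suc k) + \<rho>) t)"
    by (simp add: algebra_simps)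
  finally have "(\<lambda>k. (- a) ^ k * riesz (\<beta> * real k + \<rho>) t) sums
      (- a * ml_kernel \<beta> a (\<rho> + \<beta>) t + riesz \<rho> t)"
    by (subst (asm) sums_Suc_iff) simp
  with s show ?thesis by (auto dest: sums_unique2)
qed

text \<open>Termwise application of the semigroup law. The series of absolute values is the kernel with parameter
  \<open>-\<bar>a\<bar>\<close>, so the interchange of sum and integral is unproblematic.\<close>

lemma has_bochner_integral_riesz_ml_kernel:
  assumes "0 < \<beta>" "0 < p" "0 < \<rho>"
  shows "has_bochner_integral lborel (\<lambda>s. riesz p (t - s) * ml_kernel \<beta> a \<rho> s) (ml_kernel \<beta> a (\<rho> + p) t)"
proof -
  let ?f = "\<lambda>k s. riesz p (t - s) * ((- a) ^ k * riesz (\<beta> * real k + \<rho>) s)"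
  have pos: "0 < \<beta> * real k + \<rho>" for k using assms by (simp add: add_nonneg_pos)
  have hb: "has_bochner_integral lborel (?f k) ((- a) ^ k * riesz (\<beta> * real k + (\<rho> + p)) t)" for k
    using has_bochner_integral_mult_right[OF has_bochner_integral_riesz_riesz[OF assms(2) pos, of t], of "(- a) ^ k"]
    by (simp add: algebra_simps)
  then have I: "integrable lborel (?f k)" for k by (simp add: has_bochner_integral_iff)
  have sn: "summable (\<lambda>k. norm (?f k s))" for s
    using summable_mult[OF ml_kernel_sums(2)[OF assms(1), of a \<rho> s], of "norm (riesz p (t - s))"]
    by (simp only: norm_mult)
  have pos': "0 < \<beta> * real k + (\<rho> + p)" for k using pos[of k] assms by simp
  have hbn: "has_bochner_integral lborel (\<lambda>s. norm (?f k s)) (norm ((- a) ^ k * riesz (\<beta> * real k + (\<rho> + p)) t))" for k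
  proof -
    have "norm (?f k s) = \<bar>a\<bar> ^ k * (riesz p (t - s) * riesz (\<beta> * real k + \<rho>) s)" for s
      using riesz_nonneg[OF pos] riesz_nonneg[OF assms(2)] by (simp add: abs_mult power_abs)
    moreover have "norm ((- a) ^ k * riesz (\<beta> * real k + (\<rho> + p)) t) =
        \<bar>a\<bar> ^ k * riesz (p + (\<beta> * real k + \<rho>)) t"
      using riesz_nonneg[OF pos'] by (simp add: abs_mult power_abs add_ac)
    ultimately show ?thesis
      using has_bochner_integral_mult_right[OF has_bochner_integral_riesz_riesz[OF assms(2) pos, of t k], of "\<bar>a\<bar> ^ k"]
      by simp
  qed
  have si: "summable (\<lambda>k. (\<integral>s. norm (?f k s) \<partial>lborel))"
    using ml_kernel_sums(2)[OF assms(1), of a "\<rho> + p" t] has_bochner_integral_integral_eq[OF hbn] by simp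
  have seq: "(\<Sum>k. ?f k s) = riesz p (t - s) * ml_kernel \<beta> a \<rho> s" for s
    by (rule sums_unique[symmetric]) (intro sums_mult ml_kernel_sums(1) assms)
  have "has_bochner_integral lborel (\<lambda>s. \<Sum>k. ?f k s) (\<Sum>k. integral\<^sup>L lborel (?f k))"
    unfolding has_bochner_integral_iff
    using integrable_suminf[OF I AE_I2[OF sn] si] integral_suminf[OF I AE_I2[OF sn] si] by simp
  moreover have "(\<Sum>k. integral\<^sup>L lborel (?f k)) = ml_kernel \<beta> a (\<rho> + p) t"
    unfolding has_bochner_integral_integral_eq[OF hb]
    by (rule sums_unique[symmetric]) (rule ml_kernel_sums(1)[OF assms(1)])
  ultimately show ?thesis unfolding seq by simp
qed

lemma conv_riesz_ml_kernel:
  assumes "0 < \<beta>" "0 < p" "0 < \<rho>"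
  shows "conv (riesz p) (ml_kernel \<beta> a \<rho>) = ml_kernel \<beta> a (\<rho> + p)"
  using has_bochner_integral_riesz_ml_kernel[OF assms]
  by (simp add: conv_def has_bochner_integral_integral_eq fun_eq_iff)

lemma riesz_1: "riesz 1 = indicator {0<..}"
  by (auto simp: riesz_def indicator_def fun_eq_iff)

section \<open>Regularity of the kernels and causal convolution\<close>

text \<open>The third property is the series of \<open>z E'(z)\<close>, the form in which the derivative enters below.\<close>

lemma mittag_leffler_deriv:
  fixes \<beta> \<rho> :: real
  assumes "0 < \<beta>"
  obtains E' where "\<And>z. (mittag_leffler \<beta> \<rho> has_real_derivative E' z) (at z)"
    and "\<And>z. isCont E' z"
    and "\<And>z. (\<lambda>k. real k * z ^ k / Gamma (\<beta> * real k + \<rho>)) sums (z * E' z)"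
proof
  let ?c = "\<lambda>k. 1 / Gamma (\<beta> * real k + \<rho>)"
  let ?E' = "\<lambda>z. \<Sum>k. diffs ?c k * z ^ k"
  have s: "summable (\<lambda>k. ?c k * z ^ k)" for z
    using summable_norm_cancel[OF mittag_leffler_summable[OF assms, of z \<rho>]] by simp
  have eq: "mittag_leffler \<beta> \<rho> = (\<lambda>z. \<Sum>k. ?c k * z ^ k)"
    by (simp add: mittag_leffler_def fun_eq_iff)
  show "(mittag_leffler \<beta> \<rho> has_real_derivative ?E' z) (at z)" for z
    unfolding eq by (rule termdiffs_strong_converges_everywhere[OF s])
  have s': "summable (\<lambda>k. diffs ?c k * z ^ k)" for z
    by (rule termdiff_converges_all[OF s])
  show "isCont ?E' z" for z
    by (rule isCont_powser_converges_everywhere[OF s'])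
  show "(\<lambda>k. real k * z ^ k / Gamma (\<beta> * real k + \<rho>)) sums (z * ?E' z)" for z
  proof -
    have "(\<lambda>k. z * (diffs ?c k * z ^ k)) sums (z * ?E' z)"
      by (intro sums_mult summable_sums s')
    also have "(\<lambda>k. z * (diffs ?c k * z ^ k)) =
        (\<lambda>k. real (Suc k) * z ^ Suc k / Gamma (\<beta> * real (Suc k) + \<rho>))"
      by (simp add: diffs_def fun_eq_iff)
    finally show ?thesis by (subst (asm) sums_Suc_iff) simp
  qed
qed

lemma continuous_on_mittag_leffler [continuous_intros]:
  assumes "0 < \<beta>" "continuous_on A f"
  shows "continuous_on A (\<lambda>x. mittag_leffler \<beta> \<rho> (f x))"
proof -
  have "continuous_on UNIV (mittag_leffler \<beta> \<rho>)"
    by (rule mittag_leffler_deriv[OF assms(1), of \<rho>])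
       (meson DERIV_isCont continuous_at_imp_continuous_on)
  then show ?thesis by (rule continuous_on_compose2[OF _ assms(2)]) auto
qed

lemma continuous_bounded:
  fixes f :: "real \<Rightarrow> real"
  assumes "continuous_on {0..} f"
  shows "\<exists>B\<ge>0. \<forall>s\<in>{0..T}. \<bar>f s\<bar> \<le> B"
proof -
  have "compact (f ` {0..T})"
    using assms by (intro compact_continuous_image) (auto intro: continuous_on_subset)
  then obtain B where "\<forall>s\<in>{0..T}. \<bar>f s\<bar> \<le> B"
    by (auto simp: compact_eq_bounded_closed bounded_iff)
  then show ?thesis by (intro exI[of _ "\<bar>B\<bar>"]) (auto intro: order.trans[OF _ abs_ge_self])
qed

lemma truncated_continuous:
  fixes f :: "real \<Rightarrow> real"
  assumes "continuous_on {0..} f"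
  shows "(\<lambda>r. indicator {0..t} r * f r) \<in> borel_measurable borel"
    and "\<exists>B\<ge>0. \<forall>s. \<bar>indicator {0..t} s * f s\<bar> \<le> B"
proof -
  have c: "continuous_on {0..t} f" using assms by (rule continuous_on_subset) auto
  show "(\<lambda>r. indicator {0..t} r * f r) \<in> borel_measurable borel"
    using borel_measurable_continuous_on_indicator[OF _ c] by simp
  obtain B where "0 \<le> B" "\<forall>s\<in>{0..t}. \<bar>f s\<bar> \<le> B" using continuous_bounded[OF assms] by blast
  then show "\<exists>B\<ge>0. \<forall>s. \<bar>indicator {0..t} s * f s\<bar> \<le> B"
    by (intro exI[of _ B]) (auto simp: indicator_def)
qed

lemma continuous_on_mittag_leffler_powr:
  assumes "0 < \<beta>"
  shows "continuous_on {0..} (\<lambda>t. mittag_leffler \<beta> \<rho> (- a * t powr \<beta>))"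
  using assms by (intro continuous_intros continuous_on_powr') auto

text \<open>On coefficients, this is \<open>(\<beta> k + \<rho>) / \<Gamma>(\<beta> k + \<rho> + 1) = 1 / \<Gamma>(\<beta> k + \<rho>)\<close>.\<close>

lemma ml_kernel_deriv:
  assumes "0 < \<beta>" "0 < \<rho>" "0 < t"
  shows "(ml_kernel \<beta> a (\<rho> + 1) has_real_derivative ml_kernel \<beta> a \<rho> t) (at t)"
proof -
  obtain E' where E': "\<And>z. (mittag_leffler \<beta> (\<rho> + 1) has_real_derivative E' z) (at z)"
    and "\<And>z. isCont E' z"
    and s: "\<And>z. (\<lambda>k. real k * z ^ k / Gamma (\<beta> * real k + (\<rho> + 1))) sums (z * E' z)"
    by (rule mittag_leffler_deriv[OF assms(1), of "\<rho> + 1"]) (rule that)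
  define z where "z = - a * t powr \<beta>"
  have "(\<lambda>k. \<beta> * (real k * z ^ k / Gamma (\<beta> * real k + (\<rho> + 1))) + \<rho> * (z ^ k / Gamma (\<beta> * real k + (\<rho> + 1))))
      sums (\<beta> * (z * E' z) + \<rho> * mittag_leffler \<beta> (\<rho> + 1) z)"
    unfolding mittag_leffler_def
    using summable_sums[OF summable_norm_cancel[OF mittag_leffler_summable[OF assms(1)]]]
    by (intro sums_add sums_mult s)
  also have "(\<lambda>k. \<beta> * (real k * z ^ k / Gamma (\<beta> * real k + (\<rho> + 1))) + \<rho> * (z ^ k / Gamma (\<beta> * real k + (\<rho> + 1))))
      = (\<lambda>k. z ^ k / Gamma (\<beta> * real k + \<rho>))"
  proof
    fix k
    have x: "\<beta> * real k + \<rho> > 0" using assms by (simp add: add_nonneg_pos)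
    then have "Gamma (\<beta> * real k + (\<rho> + 1)) = (\<beta> * real k + \<rho>) * Gamma (\<beta> * real k + \<rho>)"
      using Gamma_plus1[of "\<beta> * real k + \<rho>"] nonpos_Ints_nonpos[of "\<beta> * real k + \<rho>"]
      by (auto simp: add.assoc)
    moreover have "\<beta> * (real k * z ^ k / Gamma (\<beta> * real k + (\<rho> + 1))) + \<rho> * (z ^ k / Gamma (\<beta> * real k + (\<rho> + 1)))
       = (\<beta> * real k + \<rho>) * z ^ k / Gamma (\<beta> * real k + (\<rho> + 1))"
      by (simp add: add_divide_distrib distrib_right)
    ultimately show "\<beta> * (real k * z ^ k / Gamma (\<beta> * real k + (\<rho> + 1))) + \<rho> * (z ^ k / Gamma (\<beta> * real k + (\<rho> + 1)))
       = z ^ k / Gamma (\<beta> * real k + \<rho>)"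
      using x by simp
  qed
  finally have id: "mittag_leffler \<beta> \<rho> z = \<beta> * (z * E' z) + \<rho> * mittag_leffler \<beta> (\<rho> + 1) z"
    unfolding mittag_leffler_def by (rule sums_unique[symmetric])
  have "((\<lambda>t. t powr \<rho> * mittag_leffler \<beta> (\<rho> + 1) (- a * t powr \<beta>)) has_real_derivative
      \<rho> * t powr (\<rho> - 1) * mittag_leffler \<beta> (\<rho> + 1) z + t powr \<rho> * (E' z * (- a * (\<beta> * t powr (\<beta> - 1))))) (at t)"
    unfolding z_def using assms
    by (auto intro!: derivative_eq_intros DERIV_chain2[OF E'] simp: z_def)
  also have "\<rho> * t powr (\<rho> - 1) * mittag_leffler \<beta> (\<rho> + 1) z + t powr \<rho> * (E' z * (- a * (\<beta> * t powr (\<beta> - 1))))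
     = t powr (\<rho> - 1) * (\<beta> * (z * E' z) + \<rho> * mittag_leffler \<beta> (\<rho> + 1) z)"
    using assms by (simp add: z_def powr_diff field_simps)
  finally have "((\<lambda>t. t powr \<rho> * mittag_leffler \<beta> (\<rho> + 1) (- a * t powr \<beta>)) has_real_derivative
      ml_kernel \<beta> a \<rho> t) (at t)"
    using assms id by (simp add: ml_kernel_def z_def)
  then show ?thesis
    by (rule has_field_derivative_transform_within_open[where S = "{0<..}"])
       (use assms in \<open>auto simp: ml_kernel_def\<close>)
qed

text \<open>On a bounded time interval the kernel and its derivative behave like the leading power, since the
  Mittag-Leffler factor and its derivative are bounded there.\<close>

lemma ml_kernel_bounds:
  assumes "0 < \<beta>" "0 \<le> T"
  obtains C D where "0 \<le> C" "\<And>t. t \<le> T \<Longrightarrow> \<bar>ml_kernel \<beta> a \<rho> t\<bar> \<le> C * t powr (\<rho> - 1)"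
    and "\<And>t. 0 < t \<Longrightarrow> (ml_kernel \<beta> a \<rho> has_real_derivative D t) (at t)"
    and "continuous_on {0<..} D"
    and "\<And>t. 0 < t \<Longrightarrow> t \<le> T \<Longrightarrow> \<bar>D t\<bar> \<le> C * t powr (\<rho> - 2)"
proof -
  obtain E' where E': "\<And>z. (mittag_leffler \<beta> \<rho> has_real_derivative E' z) (at z)"
    and cE': "\<And>z. isCont E' z"
    and "\<And>z. (\<lambda>k. real k * z ^ k / Gamma (\<beta> * real k + \<rho>)) sums (z * E' z)"
    by (rule mittag_leffler_deriv[OF assms(1), of \<rho>]) (rule that)
  let ?m = "\<lambda>t. mittag_leffler \<beta> \<rho> (- a * t powr \<beta>)"
  let ?m' = "\<lambda>t. (\<rho> - 1) * mittag_leffler \<beta> \<rho> (- a * t powr \<beta>) + (E' (- a * t powr \<beta>)) * (- a * \<beta> * t powr \<beta>)"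
  have cE: "continuous_on UNIV E'" using cE' by (simp add: continuous_at_imp_continuous_on)
  have c1: "continuous_on {0..} ?m" by (rule continuous_on_mittag_leffler_powr[OF assms(1)])
  have c2: "continuous_on {0..} ?m'"
  proof -
    have p: "continuous_on {0..} (\<lambda>t::real. t powr \<beta>)"
      using assms by (intro continuous_on_powr') auto
    have "continuous_on {0..} (\<lambda>t. E' (- a * t powr \<beta>))"
      by (rule continuous_on_compose2[OF cE]) (intro continuous_on_mult continuous_on_const p subset_UNIV)+
    then show ?thesis
      by (intro continuous_on_add continuous_on_mult continuous_on_const c1 p)
  qed
  obtain B1 where B1: "\<forall>t\<in>{0..T}. \<bar>?m t\<bar> \<le> B1" using continuous_bounded[OF c1] by blast
  obtain B2 where B2: "\<forall>t\<in>{0..T}. \<bar>?m' t\<bar> \<le> B2" using continuous_bounded[OF c2] by blast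
  note B = B1[rule_format] B2[rule_format]
  define D where "D t = t powr (\<rho> - 2) * ?m' t" for t
  show thesis
  proof
    show "0 \<le> max B1 B2" using B(1)[of 0] assms by auto
    show "\<bar>ml_kernel \<beta> a \<rho> t\<bar> \<le> max B1 B2 * t powr (\<rho> - 1)" if "t \<le> T" for t
      using B(1)[of t] that \<open>0 \<le> max B1 B2\<close>
      by (auto simp: ml_kernel_def abs_mult mult.commute[of "t powr _"] intro!: mult_right_mono)
    show "\<bar>D t\<bar> \<le> max B1 B2 * t powr (\<rho> - 2)" if "0 < t" "t \<le> T" for t
      using B(2)[of t] that unfolding D_def abs_mult
      by (subst mult.commute, intro mult_mono) auto
    show "continuous_on {0<..} D" unfolding D_def
      by (intro continuous_on_mult continuous_on_subset[OF c2]) (auto intro!: continuous_intros)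
    show "(ml_kernel \<beta> a \<rho> has_real_derivative D t) (at t)" if "0 < t" for t
    proof -
      have "((\<lambda>t. t powr (\<rho> - 1) * ?m t) has_real_derivative
         (\<rho> - 1) * t powr (\<rho> - 1 - 1) * ?m t + t powr (\<rho> - 1) * (E' (- a * t powr \<beta>) * (- a * (\<beta> * t powr (\<beta> - 1))))) (at t)"
        using that by (auto intro!: derivative_eq_intros DERIV_chain2[OF E'])
      also have "(\<rho> - 1) * t powr (\<rho> - 1 - 1) * ?m t + t powr (\<rho> - 1) * (E' (- a * t powr \<beta>) * (- a * (\<beta> * t powr (\<beta> - 1)))) = D t"
        using that by (simp add: D_def powr_diff field_simps power2_eq_square)
      finally show ?thesis
        by (rule has_field_derivative_transform_within_open[where S = "{0<..}"])
           (use that in \<open>auto simp: ml_kernel_def\<close>)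
    qed
  qed
qed

lemma riesz_deriv:
  assumes "0 < p" "0 < t"
  shows "(riesz (p + 1) has_real_derivative riesz p t) (at t)"
proof -
  have "Gamma (p + 1) = p * Gamma p"
    using assms Gamma_plus1[of p] nonpos_Ints_nonpos[of p] by auto
  then have "((\<lambda>t. t powr p / Gamma (p + 1)) has_real_derivative riesz p t) (at t)"
    using assms less_imp_neq[OF Gamma_real_pos[OF assms(1)], symmetric]
    by (auto intro!: derivative_eq_intros simp: riesz_def)
  then show ?thesis
    by (rule has_field_derivative_transform_within_open[where S = "{0<..}"])
       (use assms in \<open>auto simp: riesz_def\<close>)
qed

text \<open>Local integrability up to every finite time suffices, since a convolution at time \<open>t\<close> of functions
  supported on \<open>[0, \<infinity>)\<close> only sees \<open>[0, t]\<close>.\<close>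

definition causal :: "(real \<Rightarrow> real) \<Rightarrow> bool" where
  "causal k \<longleftrightarrow> k \<in> borel_measurable borel \<and> (\<forall>t\<le>0. k t = 0) \<and>
     (\<forall>T. integrable lborel (\<lambda>s. indicator {..T} s * k s))"

lemma causal_ml_kernel:
  assumes "0 < \<beta>" "0 < \<rho>" shows "causal (ml_kernel \<beta> a \<rho>)"
  unfolding causal_def
proof (intro conjI allI impI)
  show "integrable lborel (\<lambda>s. indicator {..T} s * ml_kernel \<beta> a \<rho> s)" for T
  proof -
    have "integrable lborel (\<lambda>s. riesz 1 (T - s) * ml_kernel \<beta> a \<rho> s)"
      using has_bochner_integral_riesz_ml_kernel[OF assms(1) zero_less_one assms(2)]
      by (simp add: has_bochner_integral_iff)
    moreover have "AE s in lborel. riesz 1 (T - s) * ml_kernel \<beta> a \<rho> s = indicator {..T} s * ml_kernel \<beta> a \<rho> s"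
      using AE_lborel_singleton[of T] by eventually_elim (auto simp: riesz_1 indicator_def)
    ultimately show ?thesis
      using ml_kernel_measurable[OF assms(1), measurable] by (subst integrable_cong_AE[symmetric]) auto
  qed
qed (use assms in \<open>auto simp: ml_kernel_def\<close>)

lemma causal_riesz:
  assumes "0 < p" shows "causal (riesz p)"
  unfolding causal_def
proof (intro conjI allI impI)
  show "integrable lborel (\<lambda>s. indicator {..T} s * riesz p s)" for T
  proof -
    have "integrable lborel (\<lambda>s. riesz 1 (T - s) * riesz p s)"
      using has_bochner_integral_riesz_riesz[OF zero_less_one assms]
      by (simp add: has_bochner_integral_iff)
    moreover have "AE s in lborel. riesz 1 (T - s) * riesz p s = indicator {..T} s * riesz p s"
      using AE_lborel_singleton[of T] by eventually_elim (auto simp: riesz_1 indicator_def)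
    ultimately show ?thesis
      by (subst integrable_cong_AE[symmetric]) auto
  qed
qed (use assms in \<open>auto simp: riesz_def\<close>)

lemma causal_reflect:
  assumes "causal k"
  shows "integrable lborel (\<lambda>s. indicator {0..} s * k (t - s))"
    and "(\<integral>s. indicator {0..} s * k (t - s) \<partial>lborel) = (\<integral>s. indicator {..t} s * k s \<partial>lborel)"
proof -
  have eq: "(\<lambda>s. indicator {0..} s * k (t - s)) = (\<lambda>x. indicator {..t} (t + - 1 * x) * k (t + - 1 * x))"
    by (auto simp: fun_eq_iff indicator_def)
  show "integrable lborel (\<lambda>s. indicator {0..} s * k (t - s))"
    unfolding eq using assms by (subst lborel_integrable_real_affine_iff) (auto simp: causal_def)
  show "(\<integral>s. indicator {0..} s * k (t - s) \<partial>lborel) = (\<integral>s. indicator {..t} s * k s \<partial>lborel)"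
    unfolding eq by (subst (2) lborel_integral_real_affine[of "-1" _ t]) auto
qed

lemma causal_abs: "causal k \<Longrightarrow> causal (\<lambda>t. \<bar>k t\<bar>)"
  using integrable_abs[of lborel "\<lambda>s. indicator {..T} s * k s" for T]
  by (auto simp: causal_def abs_mult)

lemma causal_integrable_bounded:
  assumes "causal k" "f \<in> borel_measurable borel" "\<And>s. s < 0 \<Longrightarrow> f s = 0"
    and "\<And>s. 0 \<le> s \<Longrightarrow> s \<le> t \<Longrightarrow> \<bar>f s\<bar> \<le> B"
  shows "integrable lborel (\<lambda>s. k (t - s) * f s)"
proof (rule Bochner_Integration.integrable_bound)
  show "integrable lborel (\<lambda>s. B * (indicator {0..} s * k (t - s)))"
    by (intro integrable_mult_right causal_reflect assms(1))
  show "(\<lambda>s. k (t - s) * f s) \<in> borel_measurable lborel"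
  proof -
    have [measurable]: "k \<in> borel_measurable borel" "f \<in> borel_measurable borel"
      using assms(1,2) by (auto simp: causal_def)
    show ?thesis by measurable
  qed
  have "norm (k (t - s) * f s) \<le> norm (B * (indicator {0..} s * k (t - s)))" for s
  proof (cases "0 \<le> s \<and> s < t")
    case True
    then have "\<bar>f s\<bar> \<le> \<bar>B\<bar>" using assms(4)[of s] by auto
    then show ?thesis
      using True by (simp add: abs_mult mult.commute mult_right_mono)
  next
    case False
    then show ?thesis using assms(1) assms(3)[of s] by (auto simp: causal_def)
  qed
  then show "AE s in lborel. norm (k (t - s) * f s) \<le> norm (B * (indicator {0..} s * k (t - s)))" by simp
qed

lemma conv_zero_below:
  assumes "causal k" "\<And>s. s < 0 \<Longrightarrow> f s = 0" "t < 0"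
  shows "conv k f t = 0"
proof -
  have "(\<lambda>s. k (t - s) * f s) = (\<lambda>_. 0)"
  proof
    fix s show "k (t - s) * f s = 0"
      using assms by (cases "s < 0") (auto simp: causal_def)
  qed
  then show ?thesis by (simp only: conv_def Bochner_Integration.integral_zero)
qed

text \<open>Fubini's theorem; the boundedness of \<open>f\<close> on \<open>[0, t]\<close> makes the double integrand absolutely integrable, with
  \<open>N\<close> bounding the mass of the inner kernel.\<close>

lemma conv_assoc:
  assumes k1: "causal k1" and k2: "causal k2"
    and f: "f \<in> borel_measurable borel" "\<And>s. s < 0 \<Longrightarrow> f s = 0"
    and B: "\<And>s. 0 \<le> s \<Longrightarrow> s \<le> t \<Longrightarrow> \<bar>f s\<bar> \<le> B"
  shows "conv k1 (conv k2 f) t = conv (conv k1 k2) f t"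
proof (cases "0 \<le> t")
  case False
  then have t: "t < 0" by simp
  have "conv k2 f s = 0" if "s < 0" for s by (rule conv_zero_below[OF k2 f(2) that])
  moreover have "conv k1 k2 s = 0" if "s < 0" for s
    using conv_zero_below[OF k1 _ that] k2 by (simp add: causal_def)
  then have "conv (conv k1 k2) f t = 0"
  proof -
    assume z: "\<And>s. s < 0 \<Longrightarrow> conv k1 k2 s = 0"
    have "conv k1 k2 (t - s) * f s = 0" for s using z[of "t - s"] f(2)[of s] t by (cases "s < 0") auto
    then show ?thesis by (simp only: conv_def[of "conv k1 k2"] Bochner_Integration.integral_zero)
  qed
  ultimately show ?thesis using conv_zero_below[OF k1 _ t] by simp
next
  case t: True
  have [measurable]: "k1 \<in> borel_measurable borel" "k2 \<in> borel_measurable borel" "f \<in> borel_measurable borel"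
    using assms by (auto simp: causal_def)
  define N where "N = (\<integral>s. indicator {..t} s * \<bar>k2 s\<bar> \<partial>lborel)"
  have B0: "0 \<le> B" using B[of 0] t by auto
  have N0: "0 \<le> N" unfolding N_def by (intro integral_nonneg_AE) auto
  let ?H = "\<lambda>(s, r). k1 (t - s) * (k2 (s - r) * f r)"
  have z: "k1 (t - s) * (k2 (s - r) * f r) = 0" if "s < 0 \<or> t \<le> s" for s r
    using that k1 k2 f(2)[of r] by (cases "r < 0") (auto simp: causal_def)
  have int_in: "integrable lborel (\<lambda>r. k1 (t - s) * (k2 (s - r) * f r))" for s
  proof (cases "s < 0 \<or> t \<le> s")
    case True
    then have "(\<lambda>r. k1 (t - s) * (k2 (s - r) * f r)) = (\<lambda>_. 0)" using z by blast
    then show ?thesis by (simp only: integrable_zero)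
  next
    case False
    then show ?thesis
      by (intro integrable_mult_right causal_integrable_bounded[OF k2 f, of s B] B) auto
  qed
  have bd: "(\<integral>r. norm (k1 (t - s) * (k2 (s - r) * f r)) \<partial>lborel) \<le> B * N * (indicator {0..} s * \<bar>k1 (t - s)\<bar>)" for s
  proof (cases "s < 0 \<or> t \<le> s")
    case True
    have "(\<lambda>r. norm (k1 (t - s) * (k2 (s - r) * f r))) = (\<lambda>_. 0)"
      by (simp only: z[OF True] norm_zero)
    then show ?thesis using B0 N0 by (simp only: Bochner_Integration.integral_zero) simp
  next
    case False
    have "(\<integral>r. norm (k1 (t - s) * (k2 (s - r) * f r)) \<partial>lborel) \<le>
        (\<integral>r. \<bar>k1 (t - s)\<bar> * (B * (indicator {0..} r * \<bar>k2 (s - r)\<bar>)) \<partial>lborel)"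
    proof (rule integral_mono)
      show "integrable lborel (\<lambda>r. norm (k1 (t - s) * (k2 (s - r) * f r)))"
        using int_in by (rule integrable_norm)
      show "integrable lborel (\<lambda>r. \<bar>k1 (t - s)\<bar> * (B * (indicator {0..} r * \<bar>k2 (s - r)\<bar>)))"
        by (intro integrable_mult_right causal_reflect causal_abs k2)
      fix r
      show "norm (k1 (t - s) * (k2 (s - r) * f r)) \<le> \<bar>k1 (t - s)\<bar> * (B * (indicator {0..} r * \<bar>k2 (s - r)\<bar>))"
      proof (cases "0 \<le> r \<and> r < s")
        case True
        then have "\<bar>f r\<bar> \<le> B" using B[of r] False by auto
        then show ?thesis using True by (simp add: abs_mult mult_left_mono mult.commute[of B])
      next
        case False then show ?thesis using k2 f(2)[of r] B0 by (auto simp: causal_def)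
      qed
    qed
    also have "\<dots> = \<bar>k1 (t - s)\<bar> * (B * (\<integral>r. indicator {..s} r * \<bar>k2 r\<bar> \<partial>lborel))"
      using causal_reflect(2)[OF causal_abs[OF k2], of s] by simp
    also have "\<dots> \<le> \<bar>k1 (t - s)\<bar> * (B * N)"
    proof (intro mult_left_mono)
      show "(\<integral>r. indicator {..s} r * \<bar>k2 r\<bar> \<partial>lborel) \<le> N"
        unfolding N_def using causal_abs[OF k2] False
        by (intro integral_mono) (auto simp: causal_def indicator_def)
    qed (use B0 in auto)
    finally show ?thesis using False by (simp add: mult_ac)
  qed
  have int: "integrable (lborel \<Otimes>\<^sub>M lborel) ?H"
  proof (rule lborel_pair.Fubini_integrable)
    show "integrable lborel (\<lambda>s. \<integral>r. norm (?H (s, r)) \<partial>lborel)"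
    proof (rule Bochner_Integration.integrable_bound)
      show "integrable lborel (\<lambda>s. B * N * (indicator {0..} s * \<bar>k1 (t - s)\<bar>))"
        by (intro integrable_mult_right causal_reflect causal_abs k1)
      show "AE s in lborel. norm (\<integral>r. norm (?H (s, r)) \<partial>lborel) \<le> norm (B * N * (indicator {0..} s * \<bar>k1 (t - s)\<bar>))"
        using bd by (intro AE_I2) (simp add: order.trans[OF _ abs_ge_self] del: norm_mult)
    qed measurable
  qed (use int_in in auto)
  have "conv k1 (conv k2 f) t = (\<integral>s. \<integral>r. k1 (t - s) * (k2 (s - r) * f r) \<partial>lborel \<partial>lborel)"
    by (simp add: conv_def)
  also have "\<dots> = (\<integral>r. \<integral>s. k1 (t - s) * (k2 (s - r) * f r) \<partial>lborel \<partial>lborel)"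
    using lborel_pair.Fubini_integral[of "\<lambda>s r. ?H (s, r)"] int by simp
  also have "\<dots> = (\<integral>r. conv k1 k2 (t - r) * f r \<partial>lborel)"
  proof (rule Bochner_Integration.integral_cong)
    fix r
    have "(\<integral>s. k1 (t - s) * (k2 (s - r) * f r) \<partial>lborel) = (\<integral>s. k1 (t - s) * k2 (s - r) \<partial>lborel) * f r"
      by (subst integral_mult_left_zero[symmetric]) (simp add: mult.assoc)
    also have "(\<integral>s. k1 (t - s) * k2 (s - r) \<partial>lborel) = (\<integral>s. k1 (t - (r + 1 * s)) * k2 (r + 1 * s - r) \<partial>lborel)"
      by (subst lborel_integral_real_affine[of 1 _ r]) auto
    also have "\<dots> = conv k1 k2 (t - r)" by (simp add: conv_def diff_diff_eq)
    finally show "(\<integral>s. k1 (t - s) * (k2 (s - r) * f r) \<partial>lborel) = conv k1 k2 (t - r) * f r" .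
  qed simp
  finally show ?thesis by (simp add: conv_def[of "conv k1 k2"])
qed

section \<open>A fractional maximum principle and two-sided kernel bounds\<close>

lemma has_bochner_integral_le:
  fixes f g :: "'b \<Rightarrow> real"
  assumes "has_bochner_integral M f x" "has_bochner_integral M g y" "\<And>s. f s \<le> g s"
  shows "x \<le> y"
  using assms integral_mono[of M f g] by (auto simp: has_bochner_integral_iff)

lemma has_bochner_integral_riesz:
  assumes "0 < p"
  shows "has_bochner_integral lborel (\<lambda>s. riesz p (t - s) * indicator {c<..} s) (riesz (p + 1) (t - c))"
proof -
  have "has_bochner_integral lborel (\<lambda>s. riesz p (t - c - s) * riesz 1 s) (riesz (p + 1) (t - c))"
    using assms by (intro has_bochner_integral_riesz_riesz) auto
  then have "has_bochner_integral lborel (\<lambda>s. riesz p (t - c - (- c + 1 * s)) * riesz 1 (- c + 1 * s)) (riesz (p + 1) (t - c))"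
    by (subst (asm) lborel_has_bochner_integral_real_affine_iff[of 1 _ _ "- c"]) auto
  also have "(\<lambda>s. riesz p (t - c - (- c + 1 * s)) * riesz 1 (- c + 1 * s)) = (\<lambda>s. riesz p (t - s) * indicator {c<..} s)"
    by (auto simp: riesz_1 indicator_def fun_eq_iff)
  finally show ?thesis .
qed

text \<open>At a maximum over the past, a fractional derivative of order \<open>1 - p\<close> is nonnegative. Replace \<open>f\<close> by its maximal
  value: the convolution of the constant increases with time, and the correction \<open>f t0 - f s\<close> is nonnegative and is
  weighted by a kernel that decreases as time passes. Only the last stretch \<open>[t0 - h, t0]\<close> works against
  monotonicity, and there differentiability of \<open>f\<close> makes the loss \<open>O(h\<^sup>p\<^sup>+\<^sup>1)\<close>, which disappears after division by
  \<open>h\<close>.\<close>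

lemma fractional_extremum_principle:
  fixes f :: "real \<Rightarrow> real"
  assumes p: "0 < p" "p < 1" and t0: "0 < t0"
    and meas: "f \<in> borel_measurable borel" and null: "\<And>s. s \<le> 0 \<Longrightarrow> f s = 0"
    and bdd: "\<And>s. 0 \<le> s \<Longrightarrow> s \<le> t0 \<Longrightarrow> \<bar>f s\<bar> \<le> B"
    and max: "\<And>s. 0 < s \<Longrightarrow> s \<le> t0 \<Longrightarrow> f s \<le> f t0" and pos: "0 \<le> f t0"
    and df: "(f has_real_derivative f') (at t0)"
    and dc: "(conv (riesz p) f has_real_derivative D) (at t0)"
  shows "0 \<le> D"
proof -
  let ?k = "riesz p" and ?K = "riesz (p + 1)"
  define L where "L = \<bar>f'\<bar> + 1"
  have "((\<lambda>y. (f y - f t0) / (y - t0)) \<longlongrightarrow> f') (at t0)"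
    using df by (simp add: has_field_derivative_iff)
  then have "\<forall>\<^sub>F y in at t0. (f y - f t0) / (y - t0) < L"
    by (rule order_tendstoD) (simp add: L_def)
  then have "\<forall>\<^sub>F y in at_left t0. (f y - f t0) / (y - t0) < L"
    by (simp add: eventually_at_split)
  then obtain b where b: "b < t0" "\<And>y. b < y \<Longrightarrow> y < t0 \<Longrightarrow> (f y - f t0) / (y - t0) < L"
    using eventually_at_left[of 0 t0] t0 by auto
  have lip: "f t0 - f y \<le> L * (t0 - y)" if "b < y" "y \<le> t0" for y
  proof (cases "y = t0")
    case False
    then have "(f y - f t0) / (y - t0) < L" using that b(2) by auto
    then have "(f t0 - f y) / (t0 - y) < L" by (metis minus_diff_eq minus_divide_divide)
    then show ?thesis using False that by (simp add: field_simps)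
  qed simp
  have mono: "?k (t0 - s) \<le> ?k (t0 - h - s)" if "s < t0 - h" "0 < h" for s h
    using that p Gamma_real_pos[of p] by (auto simp: riesz_def intro!: divide_right_mono powr_mono2')
  have Kmono: "?K x \<le> ?K y" if "x \<le> y" for x y
    using that p Gamma_real_pos[of "p + 1"] by (auto simp: riesz_def intro!: divide_right_mono powr_mono2)
  let ?psi = "conv ?k f"
  have key: "- (L * h * ?K h) \<le> ?psi t0 - ?psi (t0 - h)" if h: "0 < h" "h < t0" "b < t0 - h" for h
  proof -
    have I1: "integrable lborel (\<lambda>s. ?k (t0 - s) * f s)"
      by (rule causal_integrable_bounded[OF causal_riesz[OF p(1)] meas, where B = B]) (use null bdd in auto)
    have I2: "integrable lborel (\<lambda>s. ?k (t0 - h - s) * f s)"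
      by (rule causal_integrable_bounded[OF causal_riesz[OF p(1)] meas, where B = B]) (use null bdd h in auto)
    note J1 = has_bochner_integral_riesz[OF p(1), of t0 0]
    note J2 = has_bochner_integral_riesz[OF p(1), of "t0 - h" 0]
    note J3 = has_bochner_integral_riesz[OF p(1), of t0 "t0 - h"]
    have J: "has_bochner_integral lborel (\<lambda>s. f t0 * (?k (t0 - s) * indicator {0<..} s - ?k (t0 - h - s) * indicator {0<..} s)
          - L * h * (?k (t0 - s) * indicator {t0 - h<..} s)) (f t0 * (?K (t0 - 0) - ?K (t0 - h - 0)) - L * h * ?K (t0 - (t0 - h)))"
      by (intro has_bochner_integral_diff has_bochner_integral_mult_right J1 J2 J3)
    have "f t0 * (?K (t0 - 0) - ?K (t0 - h - 0)) - L * h * ?K (t0 - (t0 - h)) \<le>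
        (\<integral>s. ?k (t0 - s) * f s - ?k (t0 - h - s) * f s \<partial>lborel)"
    proof (subst has_bochner_integral_integral_eq[OF J, symmetric], rule integral_mono_AE)
      show "AE s in lborel. f t0 * (?k (t0 - s) * indicator {0<..} s - ?k (t0 - h - s) * indicator {0<..} s)
          - L * h * (?k (t0 - s) * indicator {t0 - h<..} s) \<le> ?k (t0 - s) * f s - ?k (t0 - h - s) * f s"
        using AE_lborel_singleton[of "t0 - h"]
      proof eventually_elim
        fix s assume "s \<noteq> t0 - h"
        then consider "s \<le> 0" | "t0 \<le> s" | "0 < s" "s < t0 - h" | "t0 - h < s" "s < t0" by linarith
        then show "f t0 * (?k (t0 - s) * indicator {0<..} s - ?k (t0 - h - s) * indicator {0<..} s)
          - L * h * (?k (t0 - s) * indicator {t0 - h<..} s) \<le> ?k (t0 - s) * f s - ?k (t0 - h - s) * f s"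
        proof cases
          case 1 then show ?thesis using null h by simp
        next
          case 2 then have "?k (t0 - s) = 0" "?k (t0 - h - s) = 0" using h by (auto simp: riesz_def)
          then show ?thesis by simp
        next
          case 3
          then have "(?k (t0 - h - s) - ?k (t0 - s)) * f s \<le> (?k (t0 - h - s) - ?k (t0 - s)) * f t0"
            using mono[of s h] max[of s] h by (intro mult_left_mono) auto
          then show ?thesis using 3 by (simp add: algebra_simps)
        next
          case 4
          have "?k (t0 - h - s) = 0" using 4 by (simp add: riesz_def)
          have "f t0 - f s \<le> L * (t0 - s)" using lip[of s] 4 h by auto
          also have "\<dots> \<le> L * h" using 4 by (intro mult_left_mono) (auto simp: L_def)
          finally have "?k (t0 - s) * (f t0 - L * h) \<le> ?k (t0 - s) * f s"
            using p by (intro mult_left_mono riesz_nonneg) auto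
          then show ?thesis using 4 h \<open>?k (t0 - h - s) = 0\<close> by (simp add: algebra_simps)
        qed
      qed
    qed (use J I1 I2 in \<open>auto simp: has_bochner_integral_iff\<close>)
    also have "\<dots> = ?psi t0 - ?psi (t0 - h)"
      using I1 I2 by (simp add: conv_def)
    finally have "f t0 * (?K t0 - ?K (t0 - h)) - L * h * ?K h \<le> ?psi t0 - ?psi (t0 - h)" by simp
    moreover have "0 \<le> f t0 * (?K t0 - ?K (t0 - h))"
      using pos Kmono[of "t0 - h" t0] h by auto
    ultimately show ?thesis by linarith
  qed
  have lim: "((\<lambda>y. (?psi y - ?psi t0) / (y - t0)) \<longlongrightarrow> D) (at_left t0)"
    using dc filterlim_mono[OF _ order_refl at_le[OF subset_UNIV]] by (auto simp: has_field_derivative_iff)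
  have lim0: "((\<lambda>y. - (L * ?K (t0 - y))) \<longlongrightarrow> - (L * 0)) (at_left t0)"
  proof (intro tendsto_intros)
    have "Gamma (p + 1) \<noteq> 0" using p less_imp_neq[OF Gamma_real_pos, of "p + 1"] by auto
    then have "((\<lambda>y. (t0 - y) powr p / Gamma (p + 1)) \<longlongrightarrow> (t0 - t0) powr p / Gamma (p + 1)) (at_left t0)"
      using p by (intro tendsto_intros tendsto_powr') (auto simp: eventually_at_filter)
    then have "((\<lambda>y. (t0 - y) powr p / Gamma (p + 1)) \<longlongrightarrow> 0) (at_left t0)" using p by simp
    then show "((\<lambda>y. ?K (t0 - y)) \<longlongrightarrow> 0) (at_left t0)"
      by (rule Lim_transform_eventually) (auto simp: eventually_at_filter riesz_def)
  qed
  have ev: "\<forall>\<^sub>F y in at_left t0. - (L * ?K (t0 - y)) \<le> (?psi y - ?psi t0) / (y - t0)"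
  proof (rule eventually_at_leftI)
    show "max b 0 < t0" using b t0 by auto
    fix y assume y: "y \<in> {max b 0<..<t0}"
    then have "- (L * (t0 - y) * ?K (t0 - y)) \<le> ?psi t0 - ?psi y" using key[of "t0 - y"] by simp
    then have "- (L * ?K (t0 - y)) \<le> (?psi t0 - ?psi y) / (t0 - y)"
      using y by (simp add: field_simps)
    then show "- (L * ?K (t0 - y)) \<le> (?psi y - ?psi t0) / (y - t0)"
      by (metis minus_diff_eq minus_divide_divide)
  qed
  have "- (L * 0) \<le> D"
    by (rule tendsto_le[OF _ lim lim0 ev]) simp
  then show ?thesis by simp
qed


text \<open>The deterministic relaxation equation \<open>\<partial>\<^sub>t\<^sup>\<beta> x = -a x\<close>. Here \<open>G 1\<close> is its solution with initial value \<open>1\<close>, and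
  \<open>a G \<beta> = - (G 1)'\<close>.\<close>

locale relaxation =
  fixes a \<beta> :: real
  assumes a_pos: "0 < a" and \<beta>_pos: "0 < \<beta>" and \<beta>_le_1: "\<beta> \<le> 1"
begin

abbreviation G :: "real \<Rightarrow> real \<Rightarrow> real" where "G \<equiv> ml_kernel \<beta> a"

lemma G_meas [measurable]: "G \<rho> \<in> borel_measurable borel"
  using \<beta>_pos by measurable

lemma G_causal: "0 < \<rho> \<Longrightarrow> causal (G \<rho>)"
  using \<beta>_pos by (rule causal_ml_kernel)

lemma G_nonpos_arg: "t \<le> 0 \<Longrightarrow> G \<rho> t = 0"
  by (simp add: ml_kernel_def)

lemma G_1_eq: "0 < t \<Longrightarrow> G 1 t = 1 - a * G (\<beta> + 1) t"
  using ml_kernel_recurrence[OF \<beta>_pos, of a 1 t] by (simp add: riesz_1 add.commute)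

lemma G_1_deriv: "0 < t \<Longrightarrow> (G 1 has_real_derivative - a * G \<beta> t) (at t)"
proof -
  assume t: "0 < t"
  have "((\<lambda>t. 1 - a * G (\<beta> + 1) t) has_real_derivative 0 - a * G \<beta> t) (at t)"
    using t \<beta>_pos by (auto intro!: derivative_eq_intros ml_kernel_deriv)
  then have "((\<lambda>t. 1 - a * G (\<beta> + 1) t) has_real_derivative - a * G \<beta> t) (at t)" by simp
  then show ?thesis
    by (rule has_field_derivative_transform_within_open[where S = "{0<..}"]) (use t G_1_eq in auto)
qed

lemma G_exponential:
  assumes "\<beta> = 1" "0 < t" shows "G 1 t = exp (- a * t)"
  using assms by (simp add: ml_kernel_def mittag_leffler_def exp_def Gamma_fact add.commute divide_inverse mult.commute)

text \<open>A bound \<open>f \<le> m\<close> follows if the fractional derivative \<open>D\<close> is negative wherever \<open>f\<close> exceeds \<open>m\<close>: otherwise \<open>f\<close> would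
  have a maximum above \<open>m\<close>. The function \<open>g\<close> is the continuous version of \<open>f\<close> up to time \<open>0\<close>, where the kernels
  themselves are set to zero; it provides the maximum.\<close>

lemma no_positive_maximum:
  fixes f g D :: "real \<Rightarrow> real"
  assumes p: "\<beta> < 1"
    and g: "continuous_on {0..} g" "\<And>s. 0 < s \<Longrightarrow> f s = g s" and null: "\<And>s. s \<le> 0 \<Longrightarrow> f s = 0"
    and meas: "f \<in> borel_measurable borel"
    and df: "\<And>t. 0 < t \<Longrightarrow> \<exists>f'. (f has_real_derivative f') (at t)"
    and dc: "\<And>t. 0 < t \<Longrightarrow> (conv (riesz (1 - \<beta>)) f has_real_derivative D t) (at t)"
    and neg: "\<And>t. 0 < t \<Longrightarrow> m < f t \<Longrightarrow> D t < 0"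
    and m: "0 \<le> m" "g 0 \<le> m"
    and t: "0 < t"
  shows "f t \<le> m"
proof (rule ccontr)
  assume "\<not> f t \<le> m"
  then have ft: "m < g t" using g(2)[OF t] by simp
  have "continuous_on {0..t} g" using g(1) by (rule continuous_on_subset) auto
  then obtain t0 where t0: "t0 \<in> {0..t}" "\<And>s. s \<in> {0..t} \<Longrightarrow> g s \<le> g t0"
    using continuous_attains_sup[of "{0..t}" g] t by auto
  have "m < g t0" using t0(2)[of t] ft t by auto
  then have t0p: "0 < t0" using m t0(1) by (cases "t0 = 0") auto
  obtain f' where f': "(f has_real_derivative f') (at t0)" using df[OF t0p] by auto
  obtain B where "0 \<le> B" "\<forall>s\<in>{0..t0}. \<bar>g s\<bar> \<le> B" using continuous_bounded[OF g(1)] by blast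
  then have B: "\<bar>f s\<bar> \<le> B" if "0 \<le> s" "s \<le> t0" for s
    using that g(2)[of s] null[of s] by (cases "s = 0") auto
  have "0 \<le> D t0"
  proof (rule fractional_extremum_principle[where p = "1 - \<beta>" and f = f and B = B])
    show "f s \<le> f t0" if "0 < s" "s \<le> t0" for s
      using that g(2)[of s] g(2)[OF t0p] t0 by auto
    show "0 \<le> f t0" using g(2)[OF t0p] \<open>m < g t0\<close> m by auto
  qed (use p \<beta>_pos t0p meas null B f' dc in auto)
  moreover have "D t0 < 0" using neg[OF t0p] g(2)[OF t0p] \<open>m < g t0\<close> by auto
  ultimately show False by simp
qed

lemma G_1_continuous: "continuous_on {0..} (\<lambda>t. mittag_leffler \<beta> 1 (- a * t powr \<beta>))"
  by (rule continuous_on_mittag_leffler_powr[OF \<beta>_pos])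

lemma mittag_leffler_1_0: "mittag_leffler \<beta> 1 0 = 1"
  unfolding mittag_leffler_def
  by (subst suminf_finite[of "{0}"]) auto

text \<open>The fractional derivative of \<open>-G 1\<close> is \<open>a G 1\<close> minus a Riesz kernel, hence negative wherever \<open>G 1 < 0\<close>. For
  \<open>\<beta> = 1\<close> the kernel of the fractional derivative degenerates, but there \<open>G 1\<close> is the exponential.\<close>

lemma G_1_nonneg:
  assumes "0 < t" shows "0 \<le> G 1 t"
proof (cases "\<beta> = 1")
  case True then show ?thesis using G_exponential[OF True assms] by simp
next
  case False
  then have b: "\<beta> < 1" using \<beta>_le_1 by simp
  have "- G 1 t \<le> 0"
  proof (rule no_positive_maximum[OF b, where f = "\<lambda>t. - G 1 t" and m = 0 and t = t and g = "\<lambda>t. - mittag_leffler \<beta> 1 (- a * t powr \<beta>)"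
        and D = "\<lambda>t. - (riesz (1 - \<beta>) t - a * G 1 t)"])
    show "continuous_on {0..} (\<lambda>t. - mittag_leffler \<beta> 1 (- a * t powr \<beta>))"
      using G_1_continuous by (rule continuous_on_minus)
    show "\<exists>f'. ((\<lambda>t. - G 1 t) has_real_derivative f') (at t)" if "0 < t" for t
      using G_1_deriv[OF that] by (auto intro: DERIV_minus)
    show "(conv (riesz (1 - \<beta>)) (\<lambda>t. - G 1 t) has_real_derivative - (riesz (1 - \<beta>) t - a * G 1 t)) (at t)" if "0 < t" for t
    proof -
      have "conv (riesz (1 - \<beta>)) (\<lambda>t. - G 1 t) = (\<lambda>t. - conv (riesz (1 - \<beta>)) (G 1) t)"
        by (simp add: conv_def fun_eq_iff)
      also have "\<dots> = (\<lambda>t. - (riesz (1 - \<beta> + 1) t - a * G (1 + 1) t))"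
        using ml_kernel_recurrence[OF \<beta>_pos, of a "1 + (1 - \<beta>)"] b \<beta>_pos
        by (simp add: conv_riesz_ml_kernel fun_eq_iff add_ac)
      moreover have "((\<lambda>t. - (riesz (1 - \<beta> + 1) t - a * G (1 + 1) t)) has_real_derivative - (riesz (1 - \<beta>) t - a * G 1 t)) (at t)"
        using that b \<beta>_pos by (intro DERIV_minus DERIV_diff DERIV_cmult riesz_deriv ml_kernel_deriv) auto
      ultimately show ?thesis by (simp only:)
    qed
    show "- (riesz (1 - \<beta>) t - a * G 1 t) < 0" if "0 < - G 1 t" for t
    proof -
      have "a * G 1 t < 0" using that a_pos by (simp add: mult_pos_neg)
      then show ?thesis using riesz_nonneg[of "1 - \<beta>" t] b by simp
    qed
    show "- mittag_leffler \<beta> 1 (- a * 0 powr \<beta>) \<le> 0" by (simp add: mittag_leffler_1_0)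
    show "- G 1 s = - mittag_leffler \<beta> 1 (- a * s powr \<beta>)" if "0 < s" for s
      using that by (simp add: ml_kernel_def)
  qed (use assms G_nonpos_arg in auto)
  then show ?thesis by simp
qed

text \<open>Multiplication by time turns the resolvent, which is singular at \<open>0\<close>, into a continuous function without losing the
  equation: writing \<open>s = t - (t - s)\<close> under the convolution reduces the weighted integral to \<open>G 1\<close> and
  \<open>G 2\<close>.\<close>

lemma time_weighted_resolvent:
  assumes b: "\<beta> < 1" and t: "0 < t"
  shows "(conv (riesz (1 - \<beta>)) (\<lambda>s. s * G \<beta> s) has_real_derivative \<beta> * G 1 t - a * (t * G \<beta> t)) (at t)"
proof -
  have "conv (riesz (1 - \<beta>)) (\<lambda>s. s * G \<beta> s) = (\<lambda>t. t * G 1 t - (1 - \<beta>) * G (1 + 1) t)"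
  proof
    fix t
    have H1: "has_bochner_integral lborel (\<lambda>s. riesz (1 - \<beta>) (t - s) * G \<beta> s) (G (\<beta> + (1 - \<beta>)) t)"
      by (rule has_bochner_integral_riesz_ml_kernel) (use b \<beta>_pos in auto)
    have H2: "has_bochner_integral lborel (\<lambda>s. riesz (1 - \<beta> + 1) (t - s) * G \<beta> s) (G (\<beta> + (1 - \<beta> + 1)) t)"
      by (rule has_bochner_integral_riesz_ml_kernel) (use b \<beta>_pos in auto)
    have H: "has_bochner_integral lborel (\<lambda>s. t * (riesz (1 - \<beta>) (t - s) * G \<beta> s) -
       (1 - \<beta>) * (riesz (1 - \<beta> + 1) (t - s) * G \<beta> s)) (t * G (\<beta> + (1 - \<beta>)) t - (1 - \<beta>) * G (\<beta> + (1 - \<beta> + 1)) t)"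
      by (intro has_bochner_integral_diff has_bochner_integral_mult_right H1 H2)
    have id: "x * riesz (1 - \<beta>) x = (1 - \<beta>) * riesz (1 - \<beta> + 1) x" for x
    proof (cases "0 < x")
      case True
      have "Gamma (1 - \<beta> + 1) = (1 - \<beta>) * Gamma (1 - \<beta>)"
        using b Gamma_plus1[of "1 - \<beta>"] nonpos_Ints_nonpos[of "1 - \<beta>"] by auto
      moreover have "x * x powr (- \<beta>) = x powr (1 - \<beta>)"
        using True by (simp add: powr_diff powr_minus divide_inverse)
      ultimately show ?thesis using True b by (simp add: riesz_def)
    qed (simp add: riesz_def)
    have "t * (riesz (1 - \<beta>) (t - s) * G \<beta> s) - (1 - \<beta>) * (riesz (1 - \<beta> + 1) (t - s) * G \<beta> s)
       = riesz (1 - \<beta>) (t - s) * (s * G \<beta> s)" for s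
      using arg_cong[OF id[of "t - s"], of "\<lambda>x. x * G \<beta> s"] by (simp add: algebra_simps)
    then show "conv (riesz (1 - \<beta>)) (\<lambda>s. s * G \<beta> s) t = t * G 1 t - (1 - \<beta>) * G (1 + 1) t"
      using has_bochner_integral_integral_eq[OF H] by (simp add: conv_def)
  qed
  moreover have "((\<lambda>t. t * G 1 t - (1 - \<beta>) * G (1 + 1) t) has_real_derivative
      (1 * G 1 t + (- a * G \<beta> t) * t) - (1 - \<beta>) * G 1 t) (at t)"
    using t by (intro DERIV_diff DERIV_mult DERIV_ident DERIV_cmult ml_kernel_deriv G_1_deriv \<beta>_pos) auto
  moreover have "(1 * G 1 t + (- a * G \<beta> t) * t) - (1 - \<beta>) * G 1 t = \<beta> * G 1 t - a * (t * G \<beta> t)"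
    by (simp add: algebra_simps)
  ultimately show ?thesis by (simp only:)
qed

lemma resolvent_properties:
  assumes b: "\<beta> < 1"
  shows "continuous_on {0..} (\<lambda>t. t powr \<beta> * mittag_leffler \<beta> \<beta> (- a * t powr \<beta>))"
    and "0 < s \<Longrightarrow> s * G \<beta> s = s powr \<beta> * mittag_leffler \<beta> \<beta> (- a * s powr \<beta>)"
    and "0 < s \<Longrightarrow> \<exists>f'. ((\<lambda>s. s * G \<beta> s) has_real_derivative f') (at s)"
proof -
  show "continuous_on {0..} (\<lambda>t. t powr \<beta> * mittag_leffler \<beta> \<beta> (- a * t powr \<beta>))"
    using \<beta>_pos by (intro continuous_on_mult continuous_on_mittag_leffler_powr continuous_on_powr') auto
  show "0 < s \<Longrightarrow> s * G \<beta> s = s powr \<beta> * mittag_leffler \<beta> \<beta> (- a * s powr \<beta>)"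
    by (simp add: ml_kernel_def powr_diff)
  assume s: "0 < s"
  obtain C D where "\<And>t. 0 < t \<Longrightarrow> (G \<beta> has_real_derivative D t) (at t)"
    by (rule ml_kernel_bounds[OF \<beta>_pos, of 0 a \<beta>]) auto
  from DERIV_mult[OF DERIV_ident this[OF s]] show "\<exists>f'. ((\<lambda>s. s * G \<beta> s) has_real_derivative f') (at s)"
    by blast
qed

text \<open>By \<open>time_weighted_resolvent\<close> the function \<open>u = t G \<beta> t\<close> has fractional derivative \<open>\<beta> G 1 - a u\<close> and vanishes at
  \<open>0\<close>. As \<open>G 1 \<ge> 0\<close>, it cannot have a negative minimum; and once \<open>u \<ge> 0\<close> is known, \<open>G 1\<close> is at most \<open>1\<close>, so
  \<open>u\<close> cannot have a maximum above \<open>\<beta> / a\<close>.\<close>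

lemma resolvent_bounds:
  assumes "0 < t"
  shows "0 \<le> G \<beta> t" and "a * (t * G \<beta> t) \<le> \<beta>"
proof -
  have "0 \<le> G \<beta> t \<and> a * (t * G \<beta> t) \<le> \<beta>"
  proof (cases "\<beta> = 1")
    case True
    have "a * t \<le> exp (a * t)" using exp_ge_add_one_self[of "a * t"] by linarith
    then have "a * t * exp (- (a * t)) \<le> exp (a * t) * exp (- (a * t))" by (rule mult_right_mono) simp
    then have "a * t * exp (- (a * t)) \<le> 1" by (simp flip: exp_add)
    moreover have "G \<beta> t = exp (- (a * t))" using G_exponential[OF True assms] True by simp
    ultimately show ?thesis using True by (simp add: mult.assoc)
  next
    case False
    then have b: "\<beta> < 1" using \<beta>_le_1 by simp
    note props = resolvent_properties[OF b]
    have nonneg: "0 \<le> G \<beta> t" if t: "0 < t" for t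
    proof -
      have "- (t * G \<beta> t) \<le> 0"
      proof (rule no_positive_maximum[OF b, where f = "\<lambda>t. - (t * G \<beta> t)" and m = 0 and t = t and g = "\<lambda>t. - (t powr \<beta> * mittag_leffler \<beta> \<beta> (- a * t powr \<beta>))"
          and D = "\<lambda>t. - (\<beta> * G 1 t - a * (t * G \<beta> t))"])
        show "continuous_on {0..} (\<lambda>t. - (t powr \<beta> * mittag_leffler \<beta> \<beta> (- a * t powr \<beta>)))"
          using props(1) by (rule continuous_on_minus)
        show "\<exists>f'. ((\<lambda>t. - (t * G \<beta> t)) has_real_derivative f') (at t)" if "0 < t" for t
          using props(3)[OF that] by (auto intro: DERIV_minus)
        show "(conv (riesz (1 - \<beta>)) (\<lambda>t. - (t * G \<beta> t)) has_real_derivative - (\<beta> * G 1 t - a * (t * G \<beta> t))) (at t)" if "0 < t" for t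
        proof -
          have "conv (riesz (1 - \<beta>)) (\<lambda>t. - (t * G \<beta> t)) = (\<lambda>t. - conv (riesz (1 - \<beta>)) (\<lambda>t. t * G \<beta> t) t)"
            by (simp add: conv_def fun_eq_iff)
          then show ?thesis using DERIV_minus[OF time_weighted_resolvent[OF b that]] by simp
        qed
        show "- (\<beta> * G 1 t - a * (t * G \<beta> t)) < 0" if "0 < t" "0 < - (t * G \<beta> t)" for t
        proof -
          have "a * (t * G \<beta> t) < 0" using that a_pos by (simp add: mult_pos_neg)
          moreover have "0 \<le> \<beta> * G 1 t" using G_1_nonneg[OF that(1)] \<beta>_pos by simp
          ultimately show ?thesis by simp
        qed
        show "- (s * G \<beta> s) = - (s powr \<beta> * mittag_leffler \<beta> \<beta> (- a * s powr \<beta>))" if "0 < s" for s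
          using props(2)[OF that] by simp
      qed (use t G_nonpos_arg in auto)
      then show ?thesis using t by (simp add: zero_le_mult_iff)
    qed
    have e_le: "G 1 t \<le> 1" if "0 < t" for t
    proof -
      have "G (\<beta> + 1) t = conv (riesz 1) (G \<beta>) t"
        using conv_riesz_ml_kernel[OF \<beta>_pos zero_less_one \<beta>_pos] by simp
      also have "\<dots> \<ge> 0" unfolding conv_def
        by (intro integral_nonneg_AE AE_I2 mult_nonneg_nonneg)
           (auto simp: riesz_1, metis nonneg G_nonpos_arg order.refl not_le)
      finally show ?thesis using G_1_eq[OF that] a_pos by simp
    qed
    have "t * G \<beta> t \<le> \<beta> / a"
    proof (rule no_positive_maximum[OF b, where f = "\<lambda>t. t * G \<beta> t" and m = "\<beta> / a" and t = t and g = "\<lambda>t. t powr \<beta> * mittag_leffler \<beta> \<beta> (- a * t powr \<beta>)"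
          and D = "\<lambda>t. \<beta> * G 1 t - a * (t * G \<beta> t)"])
      show "\<beta> * G 1 t - a * (t * G \<beta> t) < 0" if "0 < t" "\<beta> / a < t * G \<beta> t" for t
      proof -
        have "\<beta> < a * (t * G \<beta> t)" using that(2) a_pos by (simp add: field_simps)
        moreover have "\<beta> * G 1 t \<le> \<beta> * 1" using e_le[OF that(1)] \<beta>_pos by (intro mult_left_mono) auto
        ultimately show ?thesis by simp
      qed
    qed (use assms props time_weighted_resolvent[OF b] G_nonpos_arg \<beta>_pos a_pos in auto)
    then show ?thesis using nonneg[OF assms] a_pos by (simp add: field_simps)
  qed
  then show "0 \<le> G \<beta> t" "a * (t * G \<beta> t) \<le> \<beta>" by auto
qed

lemma G_\<beta>_nonneg: "0 \<le> G \<beta> t"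
  using resolvent_bounds(1)[of t] G_nonpos_arg[of t \<beta>] by (cases "0 < t") auto

text \<open>The mass of \<open>a G \<beta>\<close> on \<open>[0, t]\<close> is \<open>1 - G 1 t\<close>.\<close>

lemma resolvent_mass:
  "integrable lborel (\<lambda>s. indicator {..<t} s * G \<beta> s)"
  "(\<integral>s. indicator {..<t} s * G \<beta> s \<partial>lborel) = G (\<beta> + 1) t"
  "0 < t \<Longrightarrow> a * G (\<beta> + 1) t \<le> 1"
proof -
  have eq: "(\<lambda>s. indicator {..<t} s * G \<beta> s) = (\<lambda>s. riesz 1 (t - s) * G \<beta> s)"
    by (auto simp: riesz_1 indicator_def fun_eq_iff)
  show "integrable lborel (\<lambda>s. indicator {..<t} s * G \<beta> s)"
    "(\<integral>s. indicator {..<t} s * G \<beta> s \<partial>lborel) = G (\<beta> + 1) t"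
    unfolding eq using has_bochner_integral_riesz_ml_kernel[OF \<beta>_pos zero_less_one \<beta>_pos, of t a]
    by (auto simp: has_bochner_integral_iff)
  show "a * G (\<beta> + 1) t \<le> 1" if "0 < t" using G_1_eq[OF that] G_1_nonneg[OF that] by simp
qed

lemma kernel_exponent: "\<beta> - \<gamma> + 1 = \<beta> + (1 - \<gamma>)" by simp

lemma G_nonneg:
  assumes "0 \<le> \<gamma>" "\<gamma> \<le> 1" shows "0 \<le> G (\<beta> - \<gamma> + 1) t"
proof (cases "\<gamma> = 1")
  case True then show ?thesis using G_\<beta>_nonneg by simp
next
  case False
  then have "G (\<beta> - \<gamma> + 1) t = conv (riesz (1 - \<gamma>)) (G \<beta>) t"
    using assms \<beta>_pos conv_riesz_ml_kernel[of \<beta> "1 - \<gamma>" \<beta> a] by (simp only: kernel_exponent)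
  also have "\<dots> \<ge> 0" unfolding conv_def
    using False assms by (intro integral_nonneg_AE AE_I2 mult_nonneg_nonneg riesz_nonneg G_\<beta>_nonneg) auto
  finally show ?thesis .
qed

text \<open>In the convolution of \<open>t\<^sup>-\<^sup>\<gamma>\<close> with the resolvent, the first half of \<open>[0, t]\<close> contributes at most the
  value of the power at \<open>t / 2\<close> times the total mass, and on the second half the resolvent is at most
  \<open>2\<beta> / (a t)\<close>.\<close>

lemma G_upper_bound:
  assumes \<gamma>: "0 < \<gamma>" "\<gamma> \<le> 1"
  shows "\<exists>C\<ge>0. \<forall>t>0. G (\<beta> - \<gamma> + 1) t \<le> C * t powr (- \<gamma>)"
proof (cases "\<gamma> = 1")
  case True
  have "G \<beta> t \<le> \<beta> / a * t powr (- 1)" if "0 < t" for t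
    using resolvent_bounds(2)[OF that] that a_pos by (simp add: powr_minus field_simps)
  then show ?thesis using True a_pos \<beta>_pos by (intro exI[of _ "\<beta> / a"]) simp
next
  case False
  then have g1: "\<gamma> < 1" using \<gamma> by simp
  let ?k = "riesz (1 - \<gamma>)"
  define C where "C = (1/2) powr (- \<gamma>) / Gamma (1 - \<gamma>) / a + 2 * \<beta> / (a * Gamma (1 - \<gamma> + 1))"
  have Gp: "0 < Gamma (1 - \<gamma>)" "0 < Gamma (1 - \<gamma> + 1)" using g1 by (intro Gamma_real_pos; simp)+
  have "G (\<beta> - \<gamma> + 1) t \<le> C * t powr (- \<gamma>)" if t: "0 < t" for t
  proof -
    have H: "has_bochner_integral lborel (\<lambda>s. ?k (t - s) * G \<beta> s) (G (\<beta> + (1 - \<gamma>)) t)"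
      by (rule has_bochner_integral_riesz_ml_kernel) (use g1 \<beta>_pos in auto)
    have H1: "has_bochner_integral lborel (\<lambda>s. ?k (t / 2) * (indicator {..<t} s * G \<beta> s)) (?k (t / 2) * G (\<beta> + 1) t)"
      using resolvent_mass[of t] by (intro has_bochner_integral_mult_right) (simp add: has_bochner_integral_iff)
    have H2: "has_bochner_integral lborel (\<lambda>s. 2 * \<beta> / (a * t) * (?k (t - s) * indicator {0<..} s)) (2 * \<beta> / (a * t) * riesz (1 - \<gamma> + 1) (t - 0))"
      using g1 by (intro has_bochner_integral_mult_right has_bochner_integral_riesz) auto
    have "G (\<beta> + (1 - \<gamma>)) t \<le> ?k (t / 2) * G (\<beta> + 1) t + 2 * \<beta> / (a * t) * riesz (1 - \<gamma> + 1) (t - 0)"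
    proof (rule has_bochner_integral_le[OF H has_bochner_integral_add[OF H1 H2]])
      fix s
      have k0: "0 \<le> ?k x" for x using g1 by (intro riesz_nonneg) auto
      consider "s \<le> 0 \<or> t \<le> s" | "0 < s" "s \<le> t / 2" | "t / 2 < s" "s < t" using t by linarith
      then show "?k (t - s) * G \<beta> s \<le> ?k (t / 2) * (indicator {..<t} s * G \<beta> s) + 2 * \<beta> / (a * t) * (?k (t - s) * indicator {0<..} s)"
      proof cases
        case 1
        then have "?k (t - s) * G \<beta> s = 0" using G_nonpos_arg by (auto simp: riesz_def)
        moreover have "0 \<le> ?k (t / 2) * (indicator {..<t} s * G \<beta> s) + 2 * \<beta> / (a * t) * (?k (t - s) * indicator {0<..} s)"
          using \<beta>_pos a_pos t by (intro add_nonneg_nonneg mult_nonneg_nonneg k0 G_\<beta>_nonneg divide_nonneg_nonneg) auto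
        ultimately show ?thesis by (simp only:)
      next
        case 2
        then have "?k (t - s) \<le> ?k (t / 2)"
          using \<gamma> Gp t by (auto simp: riesz_def intro!: divide_right_mono powr_mono2')
        then have "?k (t - s) * G \<beta> s \<le> ?k (t / 2) * G \<beta> s" by (rule mult_right_mono[OF _ G_\<beta>_nonneg])
        then show ?thesis using 2 k0[of "t - s"] \<beta>_pos a_pos t by (simp add: add_increasing2)
      next
        case 3
        have "G \<beta> s \<le> \<beta> / (a * s)"
          using resolvent_bounds(2)[of s] 3 t a_pos by (simp add: field_simps)
        also have "\<dots> \<le> 2 * \<beta> / (a * t)"
          using 3 t a_pos \<beta>_pos by (simp add: field_simps)
        finally have "?k (t - s) * G \<beta> s \<le> ?k (t - s) * (2 * \<beta> / (a * t))" by (rule mult_left_mono[OF _ k0])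
        then show ?thesis using 3 t k0[of "t / 2"] G_\<beta>_nonneg[of s] by (simp add: add_increasing mult.commute)
      qed
    qed
    also have "?k (t / 2) * G (\<beta> + 1) t \<le> ?k (t / 2) * (1 / a)"
      using resolvent_mass(3)[OF t] a_pos g1 by (intro mult_left_mono riesz_nonneg) (auto simp: field_simps)
    also have "?k (t / 2) * (1 / a) + 2 * \<beta> / (a * t) * riesz (1 - \<gamma> + 1) (t - 0) = C * t powr (- \<gamma>)"
    proof -
      have "(t / 2) powr (- \<gamma>) = t powr (- \<gamma>) * (1/2) powr (- \<gamma>)"
        using powr_mult[of t "1/2" "- \<gamma>"] t by simp
      moreover have "t powr (1 - \<gamma>) = t * t powr (- \<gamma>)"
        using t by (simp add: powr_diff powr_minus divide_inverse)
      ultimately show ?thesis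
        using t by (simp add: riesz_def C_def ring_distribs mult_ac)
    qed
    finally show ?thesis by (simp only: kernel_exponent)
  qed
  moreover have "0 \<le> C" using Gp a_pos \<beta>_pos by (simp add: C_def)
  ultimately show ?thesis by blast
qed

text \<open>The power is decreasing, so the convolution is at least its value at \<open>t\<close> times the mass of the resolvent
  on \<open>[0, t]\<close>; the latter exceeds half of the total mass once \<open>G 1 t \<le> 1/2\<close>, which the upper bound with \<open>\<gamma> = \<beta>\<close>
  provides for \<open>t \<ge> t0\<close>.\<close>

lemma G_lower_bound:
  assumes \<gamma>: "0 < \<gamma>" "\<gamma> < 1"
  shows "\<exists>c>0. \<exists>t0>0. \<forall>t\<ge>t0. c * t powr (- \<gamma>) \<le> G (\<beta> - \<gamma> + 1) t"
proof -
  let ?k = "riesz (1 - \<gamma>)"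
  have Gp: "0 < Gamma (1 - \<gamma>)" using \<gamma> by (intro Gamma_real_pos; simp)
  obtain C where C: "0 \<le> C" "\<And>t. 0 < t \<Longrightarrow> G 1 t \<le> C * t powr (- \<beta>)"
    using G_upper_bound[OF \<beta>_pos \<beta>_le_1] by auto
  define t0 where "t0 = (2 * C + 1) powr (1 / \<beta>)"
  have t0: "0 < t0" "t0 powr \<beta> = 2 * C + 1" using C \<beta>_pos by (auto simp: t0_def powr_powr)
  have "1 / (2 * a * Gamma (1 - \<gamma>)) * t powr (- \<gamma>) \<le> G (\<beta> - \<gamma> + 1) t" if "t0 \<le> t" for t
  proof -
    have t: "0 < t" using that t0 by simp
    have "2 * C + 1 \<le> t powr \<beta>"
      using that t0 \<beta>_pos by (metis less_imp_le powr_mono2)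
    then have "C * t powr (- \<beta>) \<le> 1 / 2"
      using t C by (simp add: powr_minus field_simps)
    then have "1 / 2 \<le> a * G (\<beta> + 1) t" using C(2)[OF t] G_1_eq[OF t] by simp
    then have mass: "1 / (2 * a) \<le> G (\<beta> + 1) t" using a_pos by (simp add: field_simps)
    have H: "has_bochner_integral lborel (\<lambda>s. ?k (t - s) * G \<beta> s) (G (\<beta> + (1 - \<gamma>)) t)"
      by (rule has_bochner_integral_riesz_ml_kernel) (use \<gamma> \<beta>_pos in auto)
    have H1: "has_bochner_integral lborel (\<lambda>s. ?k t * (indicator {..<t} s * G \<beta> s)) (?k t * G (\<beta> + 1) t)"
      using resolvent_mass[of t] by (intro has_bochner_integral_mult_right) (simp add: has_bochner_integral_iff)
    have "?k t * (1 / (2 * a)) \<le> ?k t * G (\<beta> + 1) t"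
      using mass \<gamma> by (intro mult_left_mono riesz_nonneg) auto
    also have "\<dots> \<le> G (\<beta> + (1 - \<gamma>)) t"
    proof (rule has_bochner_integral_le[OF H1 H])
      fix s
      show "?k t * (indicator {..<t} s * G \<beta> s) \<le> ?k (t - s) * G \<beta> s"
      proof (cases "0 < s \<and> s < t")
        case True
        then have "?k t \<le> ?k (t - s)"
          using \<gamma> Gp by (auto simp: riesz_def intro!: divide_right_mono powr_mono2')
        then show ?thesis using True by (simp add: mult_right_mono G_\<beta>_nonneg)
      next
        case False then show ?thesis using G_nonpos_arg[of s] by (auto simp: riesz_def)
      qed
    qed
    finally show ?thesis using t by (simp add: riesz_def kernel_exponent mult_ac)
  qed
  moreover have "0 < 1 / (2 * a * Gamma (1 - \<gamma>))" using a_pos Gp by simp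
  ultimately show ?thesis using t0 by blast
qed

end

section \<open>Pathwise solution of the equation\<close>

lemma conv_measurable [measurable]:
  assumes [measurable]: "k \<in> borel_measurable borel" "f \<in> borel_measurable borel"
  shows "conv k f \<in> borel_measurable borel"
  unfolding conv_def by measurable

lemma conv_cong_upto:
  assumes "causal k" "\<And>s. s < t \<Longrightarrow> f s = g s"
  shows "conv k f t = conv k g t"
proof -
  have "(\<lambda>s. k (t - s) * f s) = (\<lambda>s. k (t - s) * g s)"
  proof
    fix s show "k (t - s) * f s = k (t - s) * g s"
      using assms by (cases "s < t") (auto simp: causal_def)
  qed
  then show ?thesis by (simp only: conv_def)
qed

lemma conv_bounded:
  assumes k: "causal k" and f: "f \<in> borel_measurable borel" "\<And>s. s < 0 \<Longrightarrow> f s = 0"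
    and B: "\<And>s. 0 \<le> s \<Longrightarrow> s \<le> t \<Longrightarrow> \<bar>f s\<bar> \<le> B" and s: "0 \<le> s" "s \<le> t"
  shows "\<bar>conv k f s\<bar> \<le> B * (\<integral>r. indicator {..t} r * \<bar>k r\<bar> \<partial>lborel)"
proof -
  have B0: "0 \<le> B" using B[of 0] s by auto
  have "\<bar>conv k f s\<bar> \<le> (\<integral>r. norm (k (s - r) * f r) \<partial>lborel)"
    unfolding conv_def real_norm_def[symmetric] by (rule integral_norm_bound)
  also have "\<dots> \<le> (\<integral>r. B * (indicator {0..} r * \<bar>k (s - r)\<bar>) \<partial>lborel)"
  proof (rule integral_mono)
    show "integrable lborel (\<lambda>r. norm (k (s - r) * f r))"
      by (intro integrable_norm causal_integrable_bounded[OF k f, of s B] B) (use s in auto)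
    show "integrable lborel (\<lambda>r. B * (indicator {0..} r * \<bar>k (s - r)\<bar>))"
      by (intro integrable_mult_right causal_reflect causal_abs k)
    fix r
    show "norm (k (s - r) * f r) \<le> B * (indicator {0..} r * \<bar>k (s - r)\<bar>)"
    proof (cases "0 \<le> r \<and> r < s")
      case True
      then show ?thesis using B[of r] s by (simp add: abs_mult mult.commute mult_right_mono)
    next
      case False then show ?thesis using k f(2)[of r] B0 by (auto simp: causal_def)
    qed
  qed
  also have "\<dots> = B * (\<integral>r. indicator {..s} r * \<bar>k r\<bar> \<partial>lborel)"
    using causal_reflect(2)[OF causal_abs[OF k], of s] by simp
  also have "\<dots> \<le> B * (\<integral>r. indicator {..t} r * \<bar>k r\<bar> \<partial>lborel)"
    using causal_abs[OF k] s B0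
    by (intro mult_left_mono integral_mono) (auto simp: causal_def indicator_def)
  finally show ?thesis .
qed

lemma conv_commute: "conv k f t = conv f k t"
  unfolding conv_def
  by (subst lborel_integral_real_affine[of "-1" _ t]) (auto simp: mult.commute)

lemma frac_integral_eq_conv:
  assumes s: "0 \<le> s" "s \<le> t" and p: "p \<noteq> 0"
  shows "frac_integral p f s = conv (riesz p) (\<lambda>r. indicator {0..t} r * (f r - f 0)) s"
proof -
  have "riesz p (s - r) * (indicator {0..t} r * (f r - f 0)) =
      1 / Gamma p * (indicator {0..s} r *\<^sub>R ((s - r) powr (p - 1) * (f r - f 0)))" for r
    using s by (auto simp: riesz_def indicator_def)
  then have "conv (riesz p) (\<lambda>r. indicator {0..t} r * (f r - f 0)) s =
     (\<integral>r. 1 / Gamma p * (indicator {0..s} r *\<^sub>R ((s - r) powr (p - 1) * (f r - f 0))) \<partial>lborel)"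
    by (simp only: conv_def)
  also have "\<dots> = frac_integral p f s"
    using p by (simp add: frac_integral_def set_lebesgue_integral_def)
  finally show ?thesis by simp
qed

lemma integral_eq_frac_integral:
  fixes f :: "real \<Rightarrow> real"
  assumes f: "continuous_on {0..} f" and s: "0 \<le> s"
  shows "(LBINT r:{0..s}. f r) = frac_integral 1 f s + f 0 * s"
proof -
  have c: "continuous_on {0..s} f" using f by (rule continuous_on_subset) auto
  have i: "set_integrable lborel {0..s} f" "set_integrable lborel {0..s} (\<lambda>_. f 0)"
    using c by (auto intro!: borel_integrable_atLeastAtMost')
  have m: "(\<lambda>r. indicator {0..s} r * (f r - f 0)) \<in> borel_measurable borel"
    by (rule truncated_continuous(1)) (auto intro!: continuous_intros f)
  have "frac_integral 1 f s = (LBINT r:{0..s}. (s - r) powr 0 * (f r - f 0))"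
    by (simp add: frac_integral_def)
  also have "\<dots> = (\<integral>r. indicator {0..s} r * (f r - f 0) \<partial>lborel)"
    unfolding set_lebesgue_integral_def
  proof (rule integral_cong_AE)
    show "AE r in lborel. indicator {0..s} r *\<^sub>R ((s - r) powr 0 * (f r - f 0)) = indicator {0..s} r * (f r - f 0)"
      using AE_lborel_singleton[of s] by eventually_elim auto
    have "(\<lambda>r. (s - r) powr 0 * (indicator {0..s} r * (f r - f 0))) \<in> borel_measurable borel"
      using m by measurable
    then show "(\<lambda>r. indicator {0..s} r *\<^sub>R ((s - r) powr 0 * (f r - f 0))) \<in> borel_measurable lborel"
      by (simp add: mult.left_commute)
  qed (use m in simp)
  also have "\<dots> = (LBINT r:{0..s}. f r - f 0)" by (simp add: set_lebesgue_integral_def)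
  also have "\<dots> = (LBINT r:{0..s}. f r) - (LBINT r:{0..s}. f 0)"
    by (rule set_integral_diff(2)[OF i])
  also have "(LBINT r:{0..s}. f 0) = f 0 * s"
    using s by (simp add: set_lebesgue_integral_def mult.commute)
  finally show ?thesis by simp
qed

context relaxation
begin

lemma conv_G_riesz:
  assumes "0 < p" "0 < \<rho>" shows "conv (G \<rho>) (riesz p) = G (\<rho> + p)"
proof
  fix t show "conv (G \<rho>) (riesz p) t = G (\<rho> + p) t"
    using conv_riesz_ml_kernel[OF \<beta>_pos assms] by (subst conv_commute) simp
qed

lemma G_integrable_bounded:
  assumes "0 < \<rho>" "f \<in> borel_measurable borel" "\<And>s. s < 0 \<Longrightarrow> f s = 0"
    "\<And>s. 0 \<le> s \<Longrightarrow> s \<le> t \<Longrightarrow> \<bar>f s\<bar> \<le> B"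
  shows "integrable lborel (\<lambda>s. G \<rho> (t - s) * f s)"
  using causal_integrable_bounded[OF G_causal[OF assms(1)] assms(2,3), of t B] assms(4) by simp

text \<open>The witness is the truncated \<open>f - f 0\<close> for \<open>p = 0\<close> and its convolution with the Riesz kernel for \<open>p > 0\<close>. In both
  cases the resolvent absorbs the fractional integral into its index.\<close>

lemma resolvent_of_frac_integral:
  fixes f :: "real \<Rightarrow> real" and t :: real
  assumes f: "continuous_on {0..} f" and p: "0 \<le> p"
  defines "y \<equiv> \<lambda>r. indicator {0..t} r * (f r - f 0)"
  shows "\<exists>F. integrable lborel (\<lambda>s. G \<beta> (t - s) * F s) \<and> (\<forall>s<0. F s = 0) \<and>
      (\<forall>s. 0 \<le> s \<longrightarrow> s \<le> t \<longrightarrow> F s = frac_integral p f s) \<and> conv (G \<beta>) F t = conv (G (\<beta> + p)) y t"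
proof -
  have fc: "continuous_on {0..} (\<lambda>r. f r - f 0)" by (intro continuous_intros f)
  have ym: "y \<in> borel_measurable borel" unfolding y_def by (rule truncated_continuous(1)[OF fc])
  obtain B where B: "\<And>s. \<bar>y s\<bar> \<le> B" using truncated_continuous(2)[OF fc, of t] by (auto simp: y_def[abs_def])
  have y0: "s < 0 \<Longrightarrow> y s = 0" for s by (simp add: y_def)
  show ?thesis
  proof (cases "p = 0")
    case True
    show ?thesis
      by (rule exI[of _ y]) (use True y0 ym B in \<open>auto intro!: G_integrable_bounded \<beta>_pos simp: frac_integral_def y_def\<close>)
  next
    case False
    then have p: "0 < p" using p by simp
    note c = causal_riesz[OF p]
    let ?F = "conv (riesz p) y"
    have "integrable lborel (\<lambda>s. G \<beta> (t - s) * ?F s)"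
      using conv_bounded[OF c ym y0 B, where t = t] conv_zero_below[OF c y0] ym
      by (intro G_integrable_bounded[OF \<beta>_pos]) auto
    moreover have "conv (G \<beta>) ?F t = conv (G (\<beta> + p)) y t"
      using conv_assoc[OF G_causal[OF \<beta>_pos] c ym y0 B] conv_G_riesz[OF p \<beta>_pos] by simp
    ultimately show ?thesis
      using conv_zero_below[OF c y0] frac_integral_eq_conv[of _ t p f] False
      by (intro exI[of _ ?F]) (auto simp: y_def)
  qed
qed

text \<open>Convolved with the resolvent, the three terms of the equation become convolutions with \<open>G 1\<close>, \<open>G (\<beta> + 1)\<close> and
  \<open>G \<rho>\<close>. Since \<open>G 1 + a G (\<beta> + 1)\<close> is the Heaviside function, the terms with \<open>x\<close> combine to its plain integral.\<close>

theorem pathwise_solution: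
  fixes x v :: "real \<Rightarrow> real"
  assumes x: "continuous_on {0..} x" and v: "continuous_on {0..} v" "v 0 = 0"
    and \<gamma>: "0 < \<gamma>" "\<gamma> \<le> 1" and t: "0 \<le> t"
    and eq: "\<And>s. 0 \<le> s \<Longrightarrow> s \<le> t \<Longrightarrow>
        frac_integral (1 - \<beta>) x s = - a * (LBINT r:{0..s}. x r) + frac_integral (1 - \<gamma>) v s"
  shows "(LBINT r:{0..t}. x r) = x 0 * G 2 t + conv (G (\<beta> - \<gamma> + 1)) (\<lambda>r. indicator {0..t} r * v r) t"
proof -
  define y where "y r = indicator {0..t} r * (x r - x 0)" for r
  define u where "u r = indicator {0..t} r * (v r - v 0)" for r
  have G1: "G \<beta> (t - s) = 0" if "t \<le> s" for s using that by (simp add: ml_kernel_def)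
  from resolvent_of_frac_integral[OF x, of "1 - \<beta>" t] \<beta>_le_1 obtain F1 where
    F1: "integrable lborel (\<lambda>s. G \<beta> (t - s) * F1 s)" "\<And>s. s < 0 \<Longrightarrow> F1 s = 0"
      "\<And>s. 0 \<le> s \<Longrightarrow> s \<le> t \<Longrightarrow> F1 s = frac_integral (1 - \<beta>) x s" "conv (G \<beta>) F1 t = conv (G 1) y t"
    by (auto simp: y_def[abs_def])
  from resolvent_of_frac_integral[OF x, of 1 t] obtain F2 where
    F2: "integrable lborel (\<lambda>s. G \<beta> (t - s) * F2 s)" "\<And>s. s < 0 \<Longrightarrow> F2 s = 0"
      "\<And>s. 0 \<le> s \<Longrightarrow> s \<le> t \<Longrightarrow> F2 s = frac_integral 1 x s" "conv (G \<beta>) F2 t = conv (G (\<beta> + 1)) y t"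
    by (auto simp: y_def[abs_def])
  from resolvent_of_frac_integral[OF v(1), of "1 - \<gamma>" t] \<gamma> obtain F3 where
    F3: "integrable lborel (\<lambda>s. G \<beta> (t - s) * F3 s)" "\<And>s. s < 0 \<Longrightarrow> F3 s = 0"
      "\<And>s. 0 \<le> s \<Longrightarrow> s \<le> t \<Longrightarrow> F3 s = frac_integral (1 - \<gamma>) v s" "conv (G \<beta>) F3 t = conv (G (\<beta> + (1 - \<gamma>))) u t"
    by (auto simp: u_def[abs_def])
  have Gr: "has_bochner_integral lborel (\<lambda>s. riesz 2 (t - s) * G \<beta> s) (G (\<beta> + 2) t)"
    by (rule has_bochner_integral_riesz_ml_kernel) (use \<beta>_pos in auto)
  have F4: "integrable lborel (\<lambda>s. G \<beta> (t - s) * riesz 2 s)"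
    by (rule G_integrable_bounded[where B = "\<bar>t\<bar>"]) (use \<beta>_pos in \<open>auto simp: riesz_def Gamma_numeral\<close>)
  have pt: "G \<beta> (t - s) * F1 s = - a * (G \<beta> (t - s) * F2 s) - a * x 0 * (G \<beta> (t - s) * riesz 2 s) + G \<beta> (t - s) * F3 s" for s
  proof -
    consider "s < 0" | "t \<le> s" | "0 \<le> s" "s < t" by linarith
    then show ?thesis
    proof cases
      case 3
      have "riesz 2 s = s" using 3 by (auto simp: riesz_def Gamma_numeral)
      then have "F1 s = - a * F2 s - a * x 0 * riesz 2 s + F3 s"
        using 3 F1(3)[of s] F2(3)[of s] F3(3)[of s] eq[of s] integral_eq_frac_integral[OF x, of s]
        by (simp add: algebra_simps)
      from arg_cong[OF this, of "\<lambda>x. G \<beta> (t - s) * x"] show ?thesis by (simp add: algebra_simps)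
    qed (use F1(2) F2(2) F3(2) G1 in \<open>auto simp: riesz_def\<close>)
  qed
  have "conv (G \<beta>) F1 t = - a * conv (G \<beta>) F2 t - a * x 0 * conv (G \<beta>) (riesz 2) t + conv (G \<beta>) F3 t"
    unfolding conv_def pt using F2(1) F3(1) F4
    by (subst Bochner_Integration.integral_add Bochner_Integration.integral_diff; simp)+
  then have A: "conv (G 1) y t = - a * conv (G (\<beta> + 1)) y t - a * x 0 * G (\<beta> + 2) t + conv (G (\<beta> + (1 - \<gamma>))) u t"
    using F1(4) F2(4) F3(4) conv_G_riesz[of 2 \<beta>] \<beta>_pos by simp
  have xc: "continuous_on {0..} (\<lambda>r. x r - x 0)" by (intro continuous_intros x)
  have ym: "y \<in> borel_measurable borel" unfolding y_def by (rule truncated_continuous(1)[OF xc])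
  obtain B where B: "\<And>s. \<bar>y s\<bar> \<le> B" using truncated_continuous(2)[OF xc, of t] by (auto simp: y_def[abs_def])
  have y0: "y s = 0" if "s < 0" for s using that by (simp add: y_def)
  have Iy: "integrable lborel (\<lambda>s. G \<rho> (t - s) * y s)" if "0 < \<rho>" for \<rho>
    using that ym B y0 by (intro G_integrable_bounded[where B = B]) auto
  have "riesz 1 (t - s) * y s = G 1 (t - s) * y s + a * (G (\<beta> + 1) (t - s) * y s)" for s
  proof -
    have "riesz 1 (t - s) = G 1 (t - s) + a * G (\<beta> + 1) (t - s)"
      using ml_kernel_recurrence[OF \<beta>_pos, of a 1 "t - s"] by (simp add: add.commute)
    then show ?thesis by (simp only: distrib_right mult.assoc)
  qed
  then have "conv (riesz 1) y t = conv (G 1) y t + a * conv (G (\<beta> + 1)) y t"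
    unfolding conv_def using Iy[of 1] Iy[of "\<beta> + 1"] \<beta>_pos by simp
  also have "\<dots> = - a * x 0 * G (\<beta> + 2) t + conv (G (\<beta> + (1 - \<gamma>))) u t"
    using A by simp
  also have "- a * x 0 * G (\<beta> + 2) t = x 0 * G 2 t - x 0 * riesz 2 t"
    using arg_cong[OF ml_kernel_recurrence[OF \<beta>_pos, of a 2 t], of "\<lambda>z. x 0 * z"]
    by (simp add: algebra_simps)
  also have "riesz 2 t = t" using t by (auto simp: riesz_def Gamma_numeral)
  finally have "conv (riesz 1) y t + x 0 * t = x 0 * G 2 t + conv (G (\<beta> + (1 - \<gamma>))) u t" by simp
  moreover have "frac_integral 1 x t = conv (riesz 1) y t"
    using frac_integral_eq_conv[of t t 1 x] t by (simp add: y_def[abs_def])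
  moreover have "u = (\<lambda>r. indicator {0..t} r * v r)" using v(2) by (simp add: u_def fun_eq_iff)
  ultimately show ?thesis using integral_eq_frac_integral[OF x t] by (simp add: kernel_exponent)
qed

end

section \<open>Square-mean convergence of difference quotients of the kernel\<close>

text \<open>Only quotients from the left are used, because the path of the solution is evaluated on \<open>[0, t]\<close>.\<close>

lemma backward_quotients_tendsto:
  fixes f :: "real \<Rightarrow> real"
  assumes "(f has_real_derivative D) (at t)" and h: "\<And>j :: nat. 0 < h j" "h \<longlonglongrightarrow> 0"
  shows "(\<lambda>j. (f t - f (t - h j)) / h j) \<longlonglongrightarrow> D"
proof -
  have "((\<lambda>y. (f (t + y) - f t) / y) \<longlongrightarrow> D) (at 0)"
    using assms(1) by (simp add: DERIV_def)
  moreover have "filterlim (\<lambda>j. - h j) (at 0) sequentially"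
    using tendsto_minus[OF h(2)] h(1) by (simp add: filterlim_at less_imp_neq[symmetric])
  ultimately have "(\<lambda>j. (f (t + - h j) - f t) / (- h j)) \<longlonglongrightarrow> D"
    by (rule filterlim_compose)
  also have "(\<lambda>j. (f (t + - h j) - f t) / (- h j)) = (\<lambda>j. (f t - f (t - h j)) / h j)"
    by (simp add: fun_eq_iff) (metis minus_diff_eq minus_divide_left)
  finally show ?thesis .
qed

lemma square_integrable_powr:
  fixes \<rho> :: real
  assumes \<rho>: "1 / 2 < \<rho>"
  shows "integrable lborel (\<lambda>u. indicator {0<..t} u * (C * u powr (\<rho> - 1))\<^sup>2)"
proof -
  have "integrable lborel (\<lambda>u. C\<^sup>2 * Gamma (2 * \<rho> - 1) * (indicator {..t} u * riesz (2 * \<rho> - 1) u))"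
    using causal_riesz[of "2 * \<rho> - 1"] \<rho> by (intro integrable_mult_right) (auto simp: causal_def)
  also have "(\<lambda>u. C\<^sup>2 * Gamma (2 * \<rho> - 1) * (indicator {..t} u * riesz (2 * \<rho> - 1) u)) =
      (\<lambda>u. indicator {0<..t} u * (C * u powr (\<rho> - 1))\<^sup>2)"
  proof
    fix u
    have "(u powr (\<rho> - 1))\<^sup>2 = u powr (2 * \<rho> - 1 - 1)"
      by (simp add: power2_eq_square powr_add[symmetric])
    moreover have "Gamma (2 * \<rho> - 1) \<noteq> 0" using less_imp_neq[OF Gamma_real_pos, of "2 * \<rho> - 1"] \<rho> by auto
    ultimately show "C\<^sup>2 * Gamma (2 * \<rho> - 1) * (indicator {..t} u * riesz (2 * \<rho> - 1) u) =
      indicator {0<..t} u * (C * u powr (\<rho> - 1))\<^sup>2"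
      by (auto simp: riesz_def indicator_def power_mult_distrib)
  qed
  finally show ?thesis .
qed

lemma left_difference_quotients_tendsto:
  assumes x: "continuous_on {0..} x" and t: "0 < t"
    and h: "\<And>j. 0 < h j" "\<And>j. h j < t" "h \<longlonglongrightarrow> 0"
  shows "(\<lambda>j. ((LBINT r:{0..t}. x r) - (LBINT r:{0..t - h j}. x r)) / h j) \<longlonglongrightarrow> (x t :: real)"
proof -
  have c: "continuous_on {0..s} x" for s using x by (rule continuous_on_subset) auto
  have eq: "(LBINT r:{0..s}. x r) = integral {0..s} x" for s
    by (rule set_borel_integral_eq_integral(2)) (rule borel_integrable_atLeastAtMost'[OF c])
  have "((\<lambda>s. integral {0..s} x) has_real_derivative x t) (at t within {0..t})"
    using t by (intro integral_has_real_derivative c) auto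
  then have "((\<lambda>y. (integral {0..y} x - integral {0..t} x) / (y - t)) \<longlongrightarrow> x t) (at t within {0..t})"
    by (simp add: has_field_derivative_iff)
  moreover have "filterlim (\<lambda>j. t - h j) (at t within {0..t}) sequentially"
    using tendsto_diff[OF tendsto_const h(3), of t] h(1,2)
    by (auto simp: filterlim_at less_imp_neq[symmetric] less_imp_le intro!: always_eventually)
  ultimately have "(\<lambda>j. (integral {0..t - h j} x - integral {0..t} x) / (t - h j - t)) \<longlonglongrightarrow> x t"
    by (rule filterlim_compose)
  also have "(\<lambda>j. (integral {0..t - h j} x - integral {0..t} x) / (t - h j - t)) =
    (\<lambda>j. ((LBINT r:{0..t}. x r) - (LBINT r:{0..t - h j}. x r)) / h j)"
    by (simp add: eq fun_eq_iff) (metis minus_diff_eq minus_divide_left)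
  finally show ?thesis .
qed

context relaxation
begin

text \<open>A majorant for the quotients that does not depend on the step \<open>h\<close>: for \<open>h < u / 2\<close> the mean value theorem
  evaluates \<open>G \<rho>\<close> at a point comparable to \<open>u\<close>, and for larger \<open>h\<close> the two values of \<open>G (\<rho> + 1)\<close> are themselves
  \<open>O(u\<^sup>\<rho>) = O(h u\<^sup>\<rho>\<^sup>-\<^sup>1)\<close>.\<close>

lemma difference_quotient_bound:
  assumes \<rho>: "0 < \<rho>" and T: "0 \<le> T"
  shows "\<exists>C\<ge>0. \<forall>u h. 0 < u \<longrightarrow> u \<le> T \<longrightarrow> 0 < h \<longrightarrow>
      \<bar>(G (\<rho> + 1) u - G (\<rho> + 1) (u - h)) / h\<bar> \<le> C * u powr (\<rho> - 1)"
proof -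
  obtain C0 where C0: "0 \<le> C0" "\<And>t. t \<le> T \<Longrightarrow> \<bar>G \<rho> t\<bar> \<le> C0 * t powr (\<rho> - 1)"
    by (rule ml_kernel_bounds[OF \<beta>_pos T, of a \<rho>]) (rule that)
  obtain C1 where C1: "0 \<le> C1" "\<And>t. t \<le> T \<Longrightarrow> \<bar>G (\<rho> + 1) t\<bar> \<le> C1 * t powr (\<rho> + 1 - 1)"
    by (rule ml_kernel_bounds[OF \<beta>_pos T, of a "\<rho> + 1"]) (rule that)
  have "\<bar>(G (\<rho> + 1) u - G (\<rho> + 1) (u - h)) / h\<bar> \<le> max (2 * C0) (4 * C1) * u powr (\<rho> - 1)"
    if u: "0 < u" "u \<le> T" and h: "0 < h" for u h
  proof (cases "h < u / 2")
    case True
    have "\<exists>z. u - h < z \<and> z < u \<and> G (\<rho> + 1) u - G (\<rho> + 1) (u - h) = (u - (u - h)) * G \<rho> z"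
      using True h u \<beta>_pos \<rho> by (intro MVT2 ml_kernel_deriv) auto
    then obtain z where z': "u - h < z" "z < u" "G (\<rho> + 1) u - G (\<rho> + 1) (u - h) = (u - (u - h)) * G \<rho> z"
      by blast
    then have z: "u / 2 < z" "z < u" "(G (\<rho> + 1) u - G (\<rho> + 1) (u - h)) / h = G \<rho> z"
      using True h by auto
    have "z powr (\<rho> - 1) \<le> 2 * u powr (\<rho> - 1)"
    proof (cases "1 \<le> \<rho>")
      case True
      then have "z powr (\<rho> - 1) \<le> u powr (\<rho> - 1)" using z u by (intro powr_mono2) auto
      then show ?thesis by (simp add: order.trans)
    next
      case False
      have "z powr (\<rho> - 1) \<le> (1/2 * u) powr (\<rho> - 1)" using z u False by (intro powr_mono2') auto
      also have "\<dots> = (1/2) powr (\<rho> - 1) * u powr (\<rho> - 1)" by (rule powr_mult)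
      also have "(1/2) powr (\<rho> - 1) = (2::real) powr (1 - \<rho>)"
        by (simp add: powr_divide powr_minus_divide[symmetric])
      also have "(2::real) powr (1 - \<rho>) \<le> 2 powr 1" using \<rho> by (intro powr_mono) auto
      finally show ?thesis using u by (simp add: mult_right_mono)
    qed
    then have "C0 * z powr (\<rho> - 1) \<le> 2 * C0 * u powr (\<rho> - 1)"
      using C0(1) mult_left_mono[of _ _ C0] by fastforce
    also have "\<dots> \<le> max (2 * C0) (4 * C1) * u powr (\<rho> - 1)" by (intro mult_right_mono) auto
    finally show ?thesis using C0(2)[of z] z u by simp
  next
    case False
    have p: "(u - h) powr \<rho> \<le> u powr \<rho>" if "0 < u - h" using that h \<rho> by (intro powr_mono2) auto
    have "\<bar>G (\<rho> + 1) (u - h)\<bar> \<le> C1 * u powr \<rho>"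
    proof (cases "0 < u - h")
      case True
      have "\<bar>G (\<rho> + 1) (u - h)\<bar> \<le> C1 * (u - h) powr \<rho>" using C1(2)[of "u - h"] u h by simp
      also have "\<dots> \<le> C1 * u powr \<rho>" using p[OF True] C1(1) by (intro mult_left_mono)
      finally show ?thesis .
    qed (use C1(1) in \<open>simp add: G_nonpos_arg\<close>)
    moreover have "\<bar>G (\<rho> + 1) u\<bar> \<le> C1 * u powr \<rho>" using C1(2)[of u] u by simp
    ultimately have "\<bar>G (\<rho> + 1) u - G (\<rho> + 1) (u - h)\<bar> \<le> 2 * C1 * (u powr (\<rho> - 1) * u)"
      using u by (simp add: powr_diff)
    also have "\<dots> \<le> 2 * C1 * (u powr (\<rho> - 1) * (2 * h))"
      using False C1(1) by (intro mult_left_mono) auto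
    finally have "\<bar>(G (\<rho> + 1) u - G (\<rho> + 1) (u - h)) / h\<bar> \<le> 4 * C1 * u powr (\<rho> - 1)"
      using h by (simp add: abs_divide divide_le_eq mult_ac)
    also have "\<dots> \<le> max (2 * C0) (4 * C1) * u powr (\<rho> - 1)" by (intro mult_right_mono) auto
    finally show ?thesis .
  qed
  then show ?thesis using C0(1) by (intro exI[of _ "max (2 * C0) (4 * C1)"]) auto
qed

lemma G_square_integrable:
  assumes \<rho>: "1 / 2 < \<rho>"
  shows "integrable lborel (\<lambda>u. indicator {0<..t} u * (G \<rho> u)\<^sup>2)"
proof (cases "0 \<le> t")
  case True
  obtain C where C: "0 \<le> C" "\<And>u. u \<le> t \<Longrightarrow> \<bar>G \<rho> u\<bar> \<le> C * u powr (\<rho> - 1)"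
    by (rule ml_kernel_bounds[OF \<beta>_pos True, of a \<rho>]) (rule that)
  show ?thesis
  proof (rule Bochner_Integration.integrable_bound[OF square_integrable_powr[OF \<rho>, of t C]])
    have "norm (indicator {0<..t} u * (G \<rho> u)\<^sup>2) \<le> norm (indicator {0<..t} u * (C * u powr (\<rho> - 1))\<^sup>2)" for u
      using C(2)[of u] by (auto simp: indicator_def intro: power2_le_iff_abs_le[THEN iffD2] order.trans)
    then show "AE u in lborel. norm (indicator {0<..t} u * (G \<rho> u)\<^sup>2) \<le> norm (indicator {0<..t} u * (C * u powr (\<rho> - 1))\<^sup>2)"
      by simp
  qed measurable
qed simp

text \<open>Dominated convergence; the majorant \<open>u\<^sup>\<rho>\<^sup>-\<^sup>1\<close> is square integrable at \<open>0\<close> precisely for \<open>\<rho> > 1/2\<close>.\<close>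

lemma difference_quotient_L2:
  assumes \<rho>: "1 / 2 < \<rho>" and t: "0 < t" and h: "\<And>j. 0 < h j" "h \<longlonglongrightarrow> 0"
  shows "(\<lambda>j. \<integral>\<^sup>+s\<in>{0..t}. ennreal ((G \<rho> (t - s) -
      (G (\<rho> + 1) (t - s) - G (\<rho> + 1) (t - h j - s)) / h j)\<^sup>2) \<partial>lborel) \<longlonglongrightarrow> 0"
proof -
  have \<rho>0: "0 < \<rho>" using \<rho> by simp
  obtain C0 where C0: "0 \<le> C0" "\<And>u. u \<le> t \<Longrightarrow> \<bar>G \<rho> u\<bar> \<le> C0 * u powr (\<rho> - 1)"
    by (rule ml_kernel_bounds[OF \<beta>_pos less_imp_le[OF t], of a \<rho>]) (rule that)
  obtain C1 where C1: "0 \<le> C1" "\<And>u h. 0 < u \<Longrightarrow> u \<le> t \<Longrightarrow> 0 < h \<Longrightarrow>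
      \<bar>(G (\<rho> + 1) u - G (\<rho> + 1) (u - h)) / h\<bar> \<le> C1 * u powr (\<rho> - 1)"
    using difference_quotient_bound[OF \<rho>0 less_imp_le[OF t]] by blast
  define q where "q j u = (G (\<rho> + 1) u - G (\<rho> + 1) (u - h j)) / h j" for j u
  have qm [measurable]: "q j \<in> borel_measurable borel" for j unfolding q_def by measurable
  let ?f = "\<lambda>j s. ennreal ((G \<rho> (t - s) - q j (t - s))\<^sup>2) * indicator {0..t} s"
  let ?w = "\<lambda>s. ennreal (indicator {0<..t} (t - s) * ((C0 + C1) * (t - s) powr (\<rho> - 1))\<^sup>2)"
  have bd: "?f j s \<le> ?w s" if "s \<noteq> t" for j s
  proof (cases "0 \<le> s \<and> s < t")
    case True
    then have "\<bar>G \<rho> (t - s)\<bar> \<le> C0 * (t - s) powr (\<rho> - 1)" "\<bar>q j (t - s)\<bar> \<le> C1 * (t - s) powr (\<rho> - 1)"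
      using C0(2)[of "t - s"] C1(2)[of "t - s" "h j"] h(1) by (auto simp: q_def)
    then have "\<bar>G \<rho> (t - s) - q j (t - s)\<bar> \<le> (C0 + C1) * (t - s) powr (\<rho> - 1)"
      by (simp add: distrib_right)
    then have "(G \<rho> (t - s) - q j (t - s))\<^sup>2 \<le> ((C0 + C1) * (t - s) powr (\<rho> - 1))\<^sup>2"
      by (metis abs_ge_zero power2_abs power_mono)
    then show ?thesis using True by (simp add: ennreal_leI)
  next
    case False then show ?thesis using that by (auto simp: indicator_def)
  qed
  have lim: "(\<lambda>j. ?f j s) \<longlonglongrightarrow> 0" if "s \<noteq> t" for s
  proof (cases "0 \<le> s \<and> s < t")
    case True
    have "(\<lambda>j. q j (t - s)) \<longlonglongrightarrow> G \<rho> (t - s)"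
      unfolding q_def by (rule backward_quotients_tendsto[OF ml_kernel_deriv[OF \<beta>_pos \<rho>0] h]) (use True in simp)
    then have "(\<lambda>j. (G \<rho> (t - s) - q j (t - s))\<^sup>2) \<longlonglongrightarrow> (G \<rho> (t - s) - G \<rho> (t - s))\<^sup>2"
      by (intro tendsto_intros)
    then have "(\<lambda>j. ennreal ((G \<rho> (t - s) - q j (t - s))\<^sup>2)) \<longlonglongrightarrow> ennreal 0"
      by (intro tendsto_ennrealI) simp
    then show ?thesis using True by simp
  next
    case False then show ?thesis using that by (auto simp: indicator_def)
  qed
  have "integrable lborel (\<lambda>s. indicator {0<..t} (t + - 1 * s) * ((C0 + C1) * (t + - 1 * s) powr (\<rho> - 1))\<^sup>2)"
    by (subst lborel_integrable_real_affine_iff) (auto intro: square_integrable_powr[OF \<rho>])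
  then have wfin: "(\<integral>\<^sup>+s. ?w s \<partial>lborel) < \<infinity>"
    by (subst nn_integral_eq_integral) auto
  have "(\<lambda>j. \<integral>\<^sup>+s. ?f j s \<partial>lborel) \<longlonglongrightarrow> (\<integral>\<^sup>+s. 0 \<partial>(lborel :: real measure))"
  proof (rule nn_integral_dominated_convergence[where w = ?w and u = ?f and u' = "\<lambda>_. 0" and M = lborel])
    show "AE s in lborel. ?f j s \<le> ?w s" for j
      using AE_lborel_singleton[of t] by eventually_elim (rule bd)
    show "AE s in lborel. (\<lambda>j. ?f j s) \<longlonglongrightarrow> 0"
      using AE_lborel_singleton[of t] by eventually_elim (rule lim)
  qed (use wfin in measurable)
  moreover have "t - h j - s = t - s - h j" for j s by simp
  ultimately show ?thesis by (simp only: q_def nn_integral_const mult_zero_left)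
qed

end

section \<open>The Wiener integral of step functions\<close>

text \<open>Squared \<open>L\<^sub>2\<close> distances are kept in \<open>ennreal\<close>, where they always exist; the triangle inequality is used in the
  weak form with constant \<open>2\<close>.\<close>

abbreviation sqdist :: "'b measure \<Rightarrow> ('b \<Rightarrow> real) \<Rightarrow> ('b \<Rightarrow> real) \<Rightarrow> ennreal" where
  "sqdist N f g \<equiv> \<integral>\<^sup>+x. ennreal ((f x - g x)\<^sup>2) \<partial>N"

lemma square_diff_triangle:
  fixes f g h :: "'b \<Rightarrow> real"
  assumes [measurable]: "f \<in> borel_measurable N" "g \<in> borel_measurable N" "h \<in> borel_measurable N"
  shows "sqdist N f h \<le>
      2 * (sqdist N f g) + 2 * (sqdist N g h)"
proof -
  have "ennreal ((f x - h x)\<^sup>2) \<le> 2 * ennreal ((f x - g x)\<^sup>2) + 2 * ennreal ((g x - h x)\<^sup>2)" for x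
  proof -
    have "(f x - h x)\<^sup>2 \<le> 2 * (f x - g x)\<^sup>2 + 2 * (g x - h x)\<^sup>2"
      using zero_le_power2[of "(f x - g x) - (g x - h x)"] by (simp add: power2_eq_square algebra_simps)
    then have "ennreal ((f x - h x)\<^sup>2) \<le> ennreal (2 * (f x - g x)\<^sup>2 + 2 * (g x - h x)\<^sup>2)"
      by (rule ennreal_leI)
    then show ?thesis by (simp add: ennreal_plus ennreal_mult')
  qed
  then have "sqdist N f h \<le>
      (\<integral>\<^sup>+x. 2 * ennreal ((f x - g x)\<^sup>2) + 2 * ennreal ((g x - h x)\<^sup>2) \<partial>N)"
    by (intro nn_integral_mono)
  also have "\<dots> = 2 * (sqdist N f g) + 2 * (sqdist N g h)"
    by (simp add: nn_integral_add nn_integral_cmult)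
  finally show ?thesis .
qed

lemma set_square_diff:
  fixes f g :: "'b \<Rightarrow> real"
  shows "(\<integral>\<^sup>+x\<in>A. ennreal ((f x - g x)\<^sup>2) \<partial>N) =
    sqdist N (\<lambda>x. indicator A x * f x) (\<lambda>x. indicator A x * g x)"
  by (intro nn_integral_cong) (auto simp: indicator_def)

lemma square_integrals_tendsto_0:
  fixes u :: "nat \<Rightarrow> 'b \<Rightarrow> real"
  assumes [measurable]: "\<And>j. u j \<in> borel_measurable N"
    and lim: "(\<lambda>j. \<integral>\<^sup>+x. ennreal ((u j x)\<^sup>2) \<partial>N) \<longlonglongrightarrow> 0"
  shows "\<forall>\<^sub>F j in sequentially. integrable N (\<lambda>x. (u j x)\<^sup>2)"
    and "(\<lambda>j. \<integral>x. (u j x)\<^sup>2 \<partial>N) \<longlonglongrightarrow> 0"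
proof -
  have "\<forall>\<^sub>F j in sequentially. (\<integral>\<^sup>+x. ennreal ((u j x)\<^sup>2) \<partial>N) < 1"
    using lim by (rule order_tendstoD) simp
  then show "\<forall>\<^sub>F j in sequentially. integrable N (\<lambda>x. (u j x)\<^sup>2)"
  proof eventually_elim
    case (elim j)
    then show ?case
      by (intro integrableI_bounded) (auto intro: less_trans[OF _ ennreal_one_less_top])
  qed
  have "(\<lambda>j. enn2real (\<integral>\<^sup>+x. ennreal ((u j x)\<^sup>2) \<partial>N)) \<longlonglongrightarrow> 0"
    by (rule tendsto_enn2real) (use lim in simp_all)
  then show "(\<lambda>j. \<integral>x. (u j x)\<^sup>2 \<partial>N) \<longlonglongrightarrow> 0"
    by (subst integral_eq_nn_integral) auto
qed

text \<open>Weights for Young's inequality: they vanish, but more slowly than \<open>d\<close>. The summand \<open>1 / (j + 1)\<close> keeps them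
  positive where \<open>d\<close> is zero.\<close>

lemma balancing_sequence:
  fixes d :: "nat \<Rightarrow> real"
  assumes d0: "\<And>j. 0 \<le> d j" and dl: "d \<longlonglongrightarrow> 0"
  obtains e where "\<And>j. 0 < e j" "e \<longlonglongrightarrow> 0" "\<And>j. d j / e j \<le> sqrt (d j)"
proof
  let ?e = "\<lambda>j. sqrt (d j) + 1 / real (Suc j)"
  show e0: "0 < ?e j" for j using d0[of j] by (simp add: add_nonneg_pos)
  show "?e \<longlonglongrightarrow> 0"
    using tendsto_add[OF tendsto_real_sqrt[OF dl] LIMSEQ_Suc[OF lim_1_over_n]] by simp
  show "d j / ?e j \<le> sqrt (d j)" for j
  proof -
    have "d j = sqrt (d j) * sqrt (d j)" using d0 by simp
    also have "\<dots> \<le> sqrt (d j) * ?e j" using d0[of j] by (intro mult_left_mono) auto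
    finally show ?thesis using e0 by (simp add: divide_le_eq)
  qed
qed

text \<open>Convergence in \<open>L\<^sub>2\<close> implies convergence of norms. Young's inequality with the weights of
  \<open>balancing_sequence\<close> bounds either square integral by the other one.\<close>

lemma square_integral_continuous:
  fixes u :: "nat \<Rightarrow> 'b \<Rightarrow> real"
  assumes [measurable]: "\<And>j. u j \<in> borel_measurable N" "f \<in> borel_measurable N"
    and f: "integrable N (\<lambda>x. (f x)\<^sup>2)"
    and lim: "(\<lambda>j. sqdist N f (u j)) \<longlonglongrightarrow> 0"
  shows "(\<lambda>j. \<integral>x. (u j x)\<^sup>2 \<partial>N) \<longlonglongrightarrow> (\<integral>x. (f x)\<^sup>2 \<partial>N)"
proof -
  define d where "d j = (\<integral>x. (f x - u j x)\<^sup>2 \<partial>N)" for j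
  define v where "v = (\<integral>x. (f x)\<^sup>2 \<partial>N)"
  note sq = square_integrals_tendsto_0[OF _ lim]
  have d0: "0 \<le> d j" for j by (simp add: d_def)
  have dl: "d \<longlonglongrightarrow> 0" using sq(2) by (simp add: d_def[abs_def])
  obtain e where e0: "\<And>j. 0 < e j" and el: "e \<longlonglongrightarrow> 0" and de: "\<And>j. d j / e j \<le> sqrt (d j)"
    by (rule balancing_sequence[OF d0 dl]) (rule that)
  have young: "b\<^sup>2 \<le> (1 + \<epsilon>) * a\<^sup>2 + (1 + 1 / \<epsilon>) * (a - b)\<^sup>2" if "0 < \<epsilon>" for a b \<epsilon> :: real
  proof -
    have "0 \<le> (sqrt \<epsilon> * a + (a - b) / sqrt \<epsilon>)\<^sup>2" by simp
    also have "\<dots> = \<epsilon> * a\<^sup>2 + 2 * a * (a - b) + (a - b)\<^sup>2 / \<epsilon>"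
      using that by (simp add: power2_sum power_mult_distrib power_divide)
    finally have "0 \<le> \<epsilon> * a\<^sup>2 + 2 * a * (a - b) + (a - b)\<^sup>2 / \<epsilon>" .
    moreover have "(1 + 1 / \<epsilon>) * (a - b)\<^sup>2 = (a - b)\<^sup>2 + (a - b)\<^sup>2 / \<epsilon>" by (simp add: distrib_right)
    moreover have "(1 + \<epsilon>) * a\<^sup>2 = a\<^sup>2 + \<epsilon> * a\<^sup>2" by (simp add: distrib_right)
    moreover have "b\<^sup>2 = a\<^sup>2 + (a - b)\<^sup>2 - 2 * a * (a - b)" by (simp add: power2_eq_square algebra_simps)
    ultimately show ?thesis by linarith
  qed
  have ev: "\<forall>\<^sub>F j in sequentially. integrable N (\<lambda>x. (f x - u j x)\<^sup>2)" by (rule sq(1)) simp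
  have bounds: "\<forall>\<^sub>F j in sequentially. (\<integral>x. (u j x)\<^sup>2 \<partial>N) \<le> (1 + e j) * v + (d j + sqrt (d j)) \<and>
      (v - (d j + sqrt (d j))) / (1 + e j) \<le> (\<integral>x. (u j x)\<^sup>2 \<partial>N)"
    using ev
  proof eventually_elim
    case (elim j)
    have ui: "integrable N (\<lambda>x. (u j x)\<^sup>2)"
    proof (rule Bochner_Integration.integrable_bound)
      show "integrable N (\<lambda>x. 2 * (f x)\<^sup>2 + 2 * (f x - u j x)\<^sup>2)"
        using f elim by simp
      have "norm ((u j x)\<^sup>2) \<le> norm (2 * (f x)\<^sup>2 + 2 * (f x - u j x)\<^sup>2)" for x
        using young[where \<epsilon> = 1 and a = "f x" and b = "u j x"] by simp
      then show "AE x in N. norm ((u j x)\<^sup>2) \<le> norm (2 * (f x)\<^sup>2 + 2 * (f x - u j x)\<^sup>2)"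
        by simp
    qed simp
    have "(\<integral>x. (u j x)\<^sup>2 \<partial>N) \<le> (\<integral>x. (1 + e j) * (f x)\<^sup>2 + (1 + 1 / e j) * (f x - u j x)\<^sup>2 \<partial>N)"
      by (rule integral_mono[OF ui _ young[OF e0]]) (use f elim in simp)
    also have "\<dots> = (1 + e j) * v + (d j + d j / e j)"
      using f elim by (simp add: v_def d_def algebra_simps)
    finally have 1: "(\<integral>x. (u j x)\<^sup>2 \<partial>N) \<le> (1 + e j) * v + (d j + sqrt (d j))" using de[of j] by simp
    have y2: "(f x)\<^sup>2 \<le> (1 + e j) * (u j x)\<^sup>2 + (1 + 1 / e j) * (f x - u j x)\<^sup>2" for x
      using young[OF e0[of j], where a = "u j x" and b = "f x"] by (simp only: power2_commute[of "u j x"])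
    have "v \<le> (\<integral>x. (1 + e j) * (u j x)\<^sup>2 + (1 + 1 / e j) * (f x - u j x)\<^sup>2 \<partial>N)"
      unfolding v_def by (rule integral_mono[OF f _ y2]) (use ui elim in simp)
    also have "\<dots> = (1 + e j) * (\<integral>x. (u j x)\<^sup>2 \<partial>N) + (d j + d j / e j)"
      using ui elim by (simp add: d_def algebra_simps)
    finally have "v - (d j + sqrt (d j)) \<le> (1 + e j) * (\<integral>x. (u j x)\<^sup>2 \<partial>N)" using de[of j] by simp
    then have 2: "(v - (d j + sqrt (d j))) / (1 + e j) \<le> (\<integral>x. (u j x)\<^sup>2 \<partial>N)"
      using e0[of j] by (simp add: divide_le_eq mult.commute)
    from 1 2 show ?case by simp
  qed
  have "(\<lambda>j. (1 + e j) * v + (d j + sqrt (d j))) \<longlonglongrightarrow> (1 + 0) * v + (0 + sqrt 0)"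
    by (intro tendsto_intros el dl)
  then have u: "(\<lambda>j. (1 + e j) * v + (d j + sqrt (d j))) \<longlonglongrightarrow> v" by simp
  have "(\<lambda>j. (v - (d j + sqrt (d j))) / (1 + e j)) \<longlonglongrightarrow> (v - (0 + sqrt 0)) / (1 + 0)"
    by (intro tendsto_intros el dl) simp
  then have l: "(\<lambda>j. (v - (d j + sqrt (d j))) / (1 + e j)) \<longlonglongrightarrow> v" by simp
  show ?thesis unfolding v_def[symmetric]
    by (rule tendsto_sandwich[OF eventually_mono[OF bounds] eventually_mono[OF bounds] l u]) simp_all
qed

definition partition_upto :: "real \<Rightarrow> nat \<Rightarrow> (nat \<Rightarrow> real) \<Rightarrow> bool" where
  "partition_upto t n p \<longleftrightarrow> 0 \<le> p 0 \<and> (\<forall>i<n. p i \<le> p (Suc i)) \<and> p n \<le> t"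

lemma partition_uptoD:
  assumes "partition_upto t n p"
  shows "i \<le> j \<Longrightarrow> j \<le> n \<Longrightarrow> p i \<le> p j" and "i \<le> n \<Longrightarrow> 0 \<le> p i" "i \<le> n \<Longrightarrow> p i \<le> t"
proof -
  show mono: "i \<le> j \<Longrightarrow> j \<le> n \<Longrightarrow> p i \<le> p j" for i j
  proof (induction j rule: dec_induct)
    case (step k)
    then have "p k \<le> p (Suc k)" using assms by (simp add: partition_upto_def)
    then show ?case using step by simp
  qed simp
  show "i \<le> n \<Longrightarrow> 0 \<le> p i" "i \<le> n \<Longrightarrow> p i \<le> t"
    using mono[of 0 i] mono[of i n] assms by (auto simp: partition_upto_def)
qed

lemma step_function_measurable [measurable]: "step_function n c p \<in> borel_measurable borel"
  unfolding step_function_def by measurable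

lemma step_function_truncate:
  assumes "partition_upto t n p"
  shows "indicator {0..t} s * step_function n c p s = step_function n c p s"
proof -
  have "indicator {0..t} s * (c i * indicator {p i<..p (Suc i)} s) = c i * indicator {p i<..p (Suc i)} s" if "i < n" for i
    using partition_uptoD(2)[OF assms, of i] partition_uptoD(3)[OF assms, of "Suc i"] that
    by (auto simp: indicator_def)
  then show ?thesis
    unfolding step_function_def sum_distrib_left by (intro sum.cong) auto
qed

locale brownian_motion = prob_space M for M :: "'a measure" +
  fixes w :: "real \<Rightarrow> 'a \<Rightarrow> real"
  assumes bm: "standard_brownian_motion M w"
begin

lemmas bm_unfolded = bm[unfolded standard_brownian_motion_def, THEN conjunct2]

lemmas w_measurable [measurable] = bm_unfolded[THEN conjunct1, rule_format]

lemmas w_0 = bm_unfolded[THEN conjunct2, THEN conjunct1]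

lemma increment_distributed:
  "0 \<le> s \<Longrightarrow> s < t \<Longrightarrow> distributed M lborel (\<lambda>\<omega>. w t \<omega> - w s \<omega>) (normal_density 0 (sqrt (t - s)))"
  by (rule bm_unfolded[THEN conjunct2, THEN conjunct2, THEN conjunct1, rule_format]) simp

lemma increments_indep:
  fixes \<tau> :: "nat \<Rightarrow> real"
  assumes "0 \<le> \<tau> 0" "mono \<tau>"
  shows "indep_vars (\<lambda>_. borel) (\<lambda>i \<omega>. w (\<tau> (Suc i)) \<omega> - w (\<tau> i) \<omega>) {..<n}"
  by (rule bm_unfolded[THEN conjunct2, THEN conjunct2, THEN conjunct2, THEN conjunct1,
        THEN spec[of _ n], THEN spec[of _ \<tau>], THEN mp]) (use assms in simp)

lemmas w_continuous = bm_unfolded[THEN conjunct2, THEN conjunct2, THEN conjunct2, THEN conjunct2]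

lemma increment_moments:
  assumes "0 \<le> s" "s \<le> t"
  shows "integrable M (\<lambda>\<omega>. w t \<omega> - w s \<omega>)" "expectation (\<lambda>\<omega>. w t \<omega> - w s \<omega>) = 0"
    and "integrable M (\<lambda>\<omega>. (w t \<omega> - w s \<omega>)\<^sup>2)" "expectation (\<lambda>\<omega>. (w t \<omega> - w s \<omega>)\<^sup>2) = t - s"
proof -
  have "integrable M (\<lambda>\<omega>. w t \<omega> - w s \<omega>) \<and> expectation (\<lambda>\<omega>. w t \<omega> - w s \<omega>) = 0 \<and>
    integrable M (\<lambda>\<omega>. (w t \<omega> - w s \<omega>)\<^sup>2) \<and> expectation (\<lambda>\<omega>. (w t \<omega> - w s \<omega>)\<^sup>2) = t - s"
  proof (cases "s = t")
    case False
    then have st: "s < t" using assms by simp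
    note D = increment_distributed[OF assms(1) st]
    have pos: "0 < sqrt (t - s)" using st by simp
    have E: "expectation (\<lambda>\<omega>. w t \<omega> - w s \<omega>) = 0"
      by (rule normal_distributed_expectation[OF pos D])
    have V: "variance (\<lambda>\<omega>. w t \<omega> - w s \<omega>) = (sqrt (t - s))\<^sup>2"
      by (rule normal_distributed_variance[OF pos D])
    have "integrable M (\<lambda>\<omega>. (w t \<omega> - w s \<omega>) ^ 1)" "integrable M (\<lambda>\<omega>. (w t \<omega> - w s \<omega>)\<^sup>2)"
      using integrable_normal_moment[OF pos, of 0 1] integrable_normal_moment[OF pos, of 0 2]
      by (subst distributed_integrable[OF D, symmetric]; simp)+
    then show ?thesis using E V st by simp
  qed simp
  then show "integrable M (\<lambda>\<omega>. w t \<omega> - w s \<omega>)" "expectation (\<lambda>\<omega>. w t \<omega> - w s \<omega>) = 0"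
    and "integrable M (\<lambda>\<omega>. (w t \<omega> - w s \<omega>)\<^sup>2)" "expectation (\<lambda>\<omega>. (w t \<omega> - w s \<omega>)\<^sup>2) = t - s"
    by auto
qed

text \<open>Split \<open>w t\<close> at time \<open>s\<close> and use independence of the two increments.\<close>

lemma covariance_ordered:
  assumes st: "0 \<le> s" "s \<le> t"
  shows "has_bochner_integral M (\<lambda>\<omega>. w s \<omega> * w t \<omega>) s"
proof -
  \<comment> \<open>Increments of index 2 and higher are zero, so that the times form a monotone sequence.\<close>
  define \<tau> where "\<tau> i = (if i = 0 then 0 else if i = 1 then s else t)" for i :: nat
  have "indep_vars (\<lambda>_. borel) (\<lambda>i \<omega>. w (\<tau> (Suc i)) \<omega> - w (\<tau> i) \<omega>) {..<2}"
    by (rule increments_indep) (use st in \<open>auto simp: \<tau>_def mono_def\<close>)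
  moreover have "integrable M (\<lambda>\<omega>. w (\<tau> (Suc i)) \<omega> - w (\<tau> i) \<omega>)" for i
    by (rule increment_moments) (use st in \<open>auto simp: \<tau>_def\<close>)
  ultimately have "integrable M (\<lambda>\<omega>. \<Prod>i<2. w (\<tau> (Suc i)) \<omega> - w (\<tau> i) \<omega>)"
    "expectation (\<lambda>\<omega>. \<Prod>i<2. w (\<tau> (Suc i)) \<omega> - w (\<tau> i) \<omega>) = (\<Prod>i<2. expectation (\<lambda>\<omega>. w (\<tau> (Suc i)) \<omega> - w (\<tau> i) \<omega>))"
    by (auto intro!: indep_vars_integrable indep_vars_lebesgue_integral)
  then have 1: "has_bochner_integral M (\<lambda>\<omega>. (w s \<omega> - w 0 \<omega>) * (w t \<omega> - w s \<omega>)) 0"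
    using increment_moments(2)[OF st]
    by (simp add: \<tau>_def numeral_2_eq_2 has_bochner_integral_iff)
  have 2: "has_bochner_integral M (\<lambda>\<omega>. (w s \<omega> - w 0 \<omega>)\<^sup>2) s"
    using increment_moments(3,4)[of 0 s] st by (simp add: has_bochner_integral_iff)
  have "has_bochner_integral M (\<lambda>\<omega>. (w s \<omega> - w 0 \<omega>) * (w t \<omega> - w s \<omega>) + (w s \<omega> - w 0 \<omega>)\<^sup>2) (0 + s)"
    by (intro has_bochner_integral_add 1 2)
  moreover have "AE \<omega> in M. (w s \<omega> - w 0 \<omega>) * (w t \<omega> - w s \<omega>) + (w s \<omega> - w 0 \<omega>)\<^sup>2 = w s \<omega> * w t \<omega>"
    using w_0 by eventually_elim (simp add: power2_eq_square algebra_simps)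
  ultimately show ?thesis
    using st by (subst has_bochner_integral_cong_AE[symmetric]) (auto intro: w_measurable)
qed

lemma covariance:
  assumes "0 \<le> s" "0 \<le> t"
  shows "has_bochner_integral M (\<lambda>\<omega>. w s \<omega> * w t \<omega>) (min s t)"
  using covariance_ordered[of s t] covariance_ordered[of t s] assms
  by (cases "s \<le> t") (auto simp: mult.commute)

text \<open>The covariance \<open>min s t\<close> is bilinear in the increments; the four terms combine to the length of the overlap.\<close>

lemma covariance_increments:
  assumes "0 \<le> p" "p \<le> q" "0 \<le> p'" "p' \<le> q'"
  shows "has_bochner_integral M (\<lambda>\<omega>. (w q \<omega> - w p \<omega>) * (w q' \<omega> - w p' \<omega>)) (measure lborel ({p<..q} \<inter> {p'<..q'}))"
proof -
  have "has_bochner_integral M (\<lambda>\<omega>. w q \<omega> * w q' \<omega> - w q \<omega> * w p' \<omega> - (w p \<omega> * w q' \<omega> - w p \<omega> * w p' \<omega>))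
     (min q q' - min q p' - (min p q' - min p p'))"
    using assms by (intro has_bochner_integral_diff covariance) auto
  moreover have "w q \<omega> * w q' \<omega> - w q \<omega> * w p' \<omega> - (w p \<omega> * w q' \<omega> - w p \<omega> * w p' \<omega>) =
      (w q \<omega> - w p \<omega>) * (w q' \<omega> - w p' \<omega>)" for \<omega> by (simp add: algebra_simps)
  moreover have "min q q' - min q p' - (min p q' - min p p') = measure lborel ({p<..q} \<inter> {p'<..q'})"
  proof -
    have "{p<..q} \<inter> {p'<..q'} = {max p p'<..min q q'}" by auto
    then have "measure lborel ({p<..q} \<inter> {p'<..q'}) = max 0 (min q q' - max p p')"
      by (cases "max p p' \<le> min q q'") auto
    then show ?thesis using assms by (auto simp: min_def max_def)
  qed
  ultimately show ?thesis by simp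
qed

text \<open>Allowing arbitrary, overlapping intervals makes the isometry applicable to differences of step functions on unrelated
  partitions.\<close>

lemma wiener_isometry_finite:
  fixes c p q :: "'i \<Rightarrow> real"
  assumes fin: "finite S" and pq: "\<And>i. i \<in> S \<Longrightarrow> 0 \<le> p i \<and> p i \<le> q i"
  shows "(\<integral>\<^sup>+\<omega>. ennreal ((\<Sum>i\<in>S. c i * (w (q i) \<omega> - w (p i) \<omega>))\<^sup>2) \<partial>M) =
    (\<integral>\<^sup>+s. ennreal ((\<Sum>i\<in>S. c i * indicator {p i<..q i} s)\<^sup>2) \<partial>lborel)"
proof -
  define V where "V = (\<Sum>i\<in>S. \<Sum>j\<in>S. c i * c j * measure lborel ({p i<..q i} \<inter> {p j<..q j}))"
  have "has_bochner_integral M (\<lambda>\<omega>. \<Sum>i\<in>S. \<Sum>j\<in>S. c i * c j * ((w (q i) \<omega> - w (p i) \<omega>) * (w (q j) \<omega> - w (p j) \<omega>))) V"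
    unfolding V_def using pq
    by (intro has_bochner_integral_sum has_bochner_integral_mult_right covariance_increments) auto
  also have "(\<lambda>\<omega>. \<Sum>i\<in>S. \<Sum>j\<in>S. c i * c j * ((w (q i) \<omega> - w (p i) \<omega>) * (w (q j) \<omega> - w (p j) \<omega>))) =
      (\<lambda>\<omega>. (\<Sum>i\<in>S. c i * (w (q i) \<omega> - w (p i) \<omega>))\<^sup>2)"
    by (simp add: power2_eq_square sum_product mult_ac)
  finally have 1: "has_bochner_integral M (\<lambda>\<omega>. (\<Sum>i\<in>S. c i * (w (q i) \<omega> - w (p i) \<omega>))\<^sup>2) V" .
  have "has_bochner_integral lborel (\<lambda>s. \<Sum>i\<in>S. \<Sum>j\<in>S. c i * c j * indicator ({p i<..q i} \<inter> {p j<..q j}) s) V"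
    unfolding V_def
  proof (intro has_bochner_integral_sum has_bochner_integral_mult_right has_bochner_integral_real_indicator)
    fix i j
    have "emeasure lborel ({p i<..q i} \<inter> {p j<..q j}) \<le> emeasure lborel {p i..q i}"
      by (intro emeasure_mono) auto
    then show "emeasure lborel ({p i<..q i} \<inter> {p j<..q j}) < \<infinity>"
      by (rule le_less_trans) (simp add: emeasure_lborel_Icc_eq)
  qed auto
  also have "(\<lambda>s. \<Sum>i\<in>S. \<Sum>j\<in>S. c i * c j * indicator ({p i<..q i} \<inter> {p j<..q j}) s) =
      (\<lambda>s. (\<Sum>i\<in>S. c i * indicator {p i<..q i} s)\<^sup>2)"
    by (simp only: power2_eq_square sum_product indicator_inter_arith mult_ac)
  finally have 2: "has_bochner_integral lborel (\<lambda>s. (\<Sum>i\<in>S. c i * indicator {p i<..q i} s)\<^sup>2) V" .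
  have "(\<integral>\<^sup>+\<omega>. ennreal ((\<Sum>i\<in>S. c i * (w (q i) \<omega> - w (p i) \<omega>))\<^sup>2) \<partial>M) = ennreal V"
    using 1 by (subst nn_integral_eq_integral) (auto simp: has_bochner_integral_iff)
  moreover have "(\<integral>\<^sup>+s. ennreal ((\<Sum>i\<in>S. c i * indicator {p i<..q i} s)\<^sup>2) \<partial>lborel) = ennreal V"
    using 2 by (subst nn_integral_eq_integral) (auto simp: has_bochner_integral_iff)
  ultimately show ?thesis by simp
qed

lemma step_wiener_measurable [measurable]:
  assumes "partition_upto t n p" shows "step_wiener_integral w n c p \<in> borel_measurable M"
  unfolding step_wiener_integral_def using partition_uptoD(2)[OF assms]
  by (intro borel_measurable_sum borel_measurable_times borel_measurable_const borel_measurable_diff w_measurable) auto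

text \<open>The difference of the two step functions is one sum over the disjoint union of the index sets.\<close>

lemma step_isometry:
  assumes p: "partition_upto t n p" and q: "partition_upto t m q"
  shows "sqdist M (step_wiener_integral w n c p) (step_wiener_integral w m d q) =
    sqdist lborel (step_function n c p) (step_function m d q)"
proof -
  define C where "C = case_sum c (\<lambda>i. - d i)"
  define P where "P = case_sum p q"
  define Q where "Q = case_sum (\<lambda>i. p (Suc i)) (\<lambda>i. q (Suc i))"
  let ?S = "{..<n} <+> {..<m}"
  have "(\<integral>\<^sup>+\<omega>. ennreal ((\<Sum>i\<in>?S. C i * (w (Q i) \<omega> - w (P i) \<omega>))\<^sup>2) \<partial>M) =
    (\<integral>\<^sup>+s. ennreal ((\<Sum>i\<in>?S. C i * indicator {P i<..Q i} s)\<^sup>2) \<partial>lborel)"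
  proof (rule wiener_isometry_finite)
    fix i assume "i \<in> ?S"
    then show "0 \<le> P i \<and> P i \<le> Q i"
      using partition_uptoD[OF p] partition_uptoD[OF q] p q
      by (auto simp: P_def Q_def partition_upto_def)
  qed simp
  then show ?thesis
    by (simp only: sum.Plus finite_lessThan C_def P_def Q_def comp_def sum.case
        step_wiener_integral_def step_function_def mult_minus_left sum_negf add_uminus_conv_diff)
qed

end

section \<open>Closure of the Wiener integral and integrals along Brownian paths\<close>

context brownian_motion
begin

lemma has_wiener_integral_iff:
  "has_wiener_integral M w t f I \<longleftrightarrow>
     I \<in> borel_measurable M \<and> set_borel_measurable lborel {0..t} f \<and>
     (\<exists>n c p. (\<forall>j. partition_upto t (n j) (p j)) \<and>
        (\<lambda>j. sqdist lborel (\<lambda>s. indicator {0..t} s * f s) (step_function (n j) (c j) (p j))) \<longlonglongrightarrow> 0 \<and>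
        (\<lambda>j. sqdist M I (step_wiener_integral w (n j) (c j) (p j))) \<longlonglongrightarrow> 0)"
proof -
  have "(\<integral>\<^sup>+s\<in>{0..t}. ennreal ((f s - step_function n c p s)\<^sup>2) \<partial>lborel) =
      sqdist lborel (\<lambda>s. indicator {0..t} s * f s) (step_function n c p)"
    if "partition_upto t n p" for n c p
    unfolding set_square_diff step_function_truncate[OF that] ..
  then show ?thesis
    unfolding has_wiener_integral_def partition_upto_def[symmetric]
    by (intro conj_cong refl ex_cong1) simp
qed

lemma has_wiener_integral_step:
  assumes p: "partition_upto t n p"
  shows "has_wiener_integral M w t (step_function n c p) (step_wiener_integral w n c p)"
  unfolding has_wiener_integral_iff
proof (intro conjI)
  show "\<exists>n' c' p'. (\<forall>j. partition_upto t (n' j) (p' j)) \<and>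
      (\<lambda>j. sqdist lborel (\<lambda>s. indicator {0..t} s * step_function n c p s) (step_function (n' j) (c' j) (p' j))) \<longlonglongrightarrow> 0 \<and>
      (\<lambda>j. sqdist M (step_wiener_integral w n c p) (step_wiener_integral w (n' j) (c' j) (p' j))) \<longlonglongrightarrow> 0"
    by (rule exI[of _ "\<lambda>_. n"], rule exI[of _ "\<lambda>_. c"], rule exI[of _ "\<lambda>_. p"])
       (simp add: p step_function_truncate[OF p])
qed (use p in \<open>auto simp: step_function_truncate set_borel_measurable_def\<close>)

text \<open>A diagonal choice of step functions: \<open>?s j\<close> is within \<open>\<eta> j\<close> of \<open>f j\<close> while its integral \<open>?S j\<close> is within \<open>\<eta> j\<close> of
  \<open>I j\<close>. The isometry makes \<open>?S\<close> a Cauchy sequence. Its limit is identified as \<open>J\<close> by Fatou's lemma, so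
  almost sure convergence of \<open>I\<close> is enough.\<close>

lemma has_wiener_integral_limit:
  assumes W: "\<And>j :: nat. has_wiener_integral M w t (f j) (I j)"
    and J: "J \<in> borel_measurable M" "AE \<omega> in M. (\<lambda>j. I j \<omega>) \<longlonglongrightarrow> J \<omega>"
    and g: "set_borel_measurable lborel {0..t} g"
    and lim: "(\<lambda>j. \<integral>\<^sup>+s\<in>{0..t}. ennreal ((g s - f j s)\<^sup>2) \<partial>lborel) \<longlonglongrightarrow> 0"
  shows "has_wiener_integral M w t g J"
proof -
  let ?r = "\<lambda>f s. indicator {0..t} s * (f s :: real)"
  have gm [measurable]: "?r g \<in> borel_measurable lborel"
    using g by (simp add: set_borel_measurable_def)
  have fm [measurable]: "?r (f j) \<in> borel_measurable lborel" for j
    using W[of j] by (simp add: has_wiener_integral_iff set_borel_measurable_def)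
  have Im [measurable]: "I j \<in> borel_measurable M" for j
    using W[of j] by (simp add: has_wiener_integral_iff)
  note Jm [measurable] = J(1)
  define \<eta> where "\<eta> j = ennreal (1 / real (Suc j))" for j
  have \<eta>_lim: "\<eta> \<longlonglongrightarrow> 0"
    using tendsto_ennrealI[OF LIMSEQ_Suc[OF lim_1_over_n]] by (simp add: \<eta>_def[abs_def])
  define Q where "Q j x \<longleftrightarrow> (case x of (n, c, p) \<Rightarrow> partition_upto t n p \<and>
      sqdist lborel (?r (f j)) (step_function n c p) < \<eta> j \<and>
      sqdist M (I j) (step_wiener_integral w n c p) < \<eta> j)" for j x
  have "\<exists>x. Q j x" for j
  proof -
    obtain n c p where *: "\<And>k. partition_upto t (n k) (p k)"
      "(\<lambda>k. sqdist lborel (?r (f j)) (step_function (n k) (c k) (p k))) \<longlonglongrightarrow> 0"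
      "(\<lambda>k. sqdist M (I j) (step_wiener_integral w (n k) (c k) (p k))) \<longlonglongrightarrow> 0"
      using W[of j] unfolding has_wiener_integral_iff by blast
    have pos: "0 < \<eta> j" by (simp add: \<eta>_def)
    from order_tendstoD(2)[OF *(2) pos] order_tendstoD(2)[OF *(3) pos]
    have "\<forall>\<^sub>F k in sequentially. (sqdist lborel (?r (f j)) (step_function (n k) (c k) (p k))) < \<eta> j \<and>
        sqdist M (I j) (step_wiener_integral w (n k) (c k) (p k)) < \<eta> j"
      by eventually_elim simp
    then obtain k where "sqdist lborel (?r (f j)) (step_function (n k) (c k) (p k)) < \<eta> j \<and>
        sqdist M (I j) (step_wiener_integral w (n k) (c k) (p k)) < \<eta> j"
      using eventually_happens'[OF sequentially_bot] by blast
    with *(1)[of k] show ?thesis unfolding Q_def by (intro exI[of _ "(n k, c k, p k)"]) simp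
  qed
  then obtain X where X: "\<And>j. Q j (X j)" using choice[of Q] by blast
  define n where "n j = fst (X j)" for j
  define c where "c j = fst (snd (X j))" for j
  define p where "p j = snd (snd (X j))" for j
  let ?s = "\<lambda>j. step_function (n j) (c j) (p j)"
  let ?S = "\<lambda>j. step_wiener_integral w (n j) (c j) (p j)"
  have P: "partition_upto t (n j) (p j)"
    and fs: "sqdist lborel (?r (f j)) (?s j) \<le> \<eta> j"
    and IS: "sqdist M (I j) (?S j) \<le> \<eta> j" for j
    using X[of j] by (auto simp: Q_def n_def c_def p_def split_beta less_imp_le)
  have Sm [measurable]: "?S j \<in> borel_measurable M" for j by (rule step_wiener_measurable[OF P])
  define e where "e j = 2 * (sqdist lborel (?r g) (?r (f j))) + 2 * \<eta> j" for j
  have e_lim: "e \<longlonglongrightarrow> 0"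
  proof -
    have "e \<longlonglongrightarrow> 2 * 0 + 2 * 0"
      unfolding e_def[abs_def] using lim \<eta>_lim unfolding set_square_diff
      by (intro tendsto_add ennreal_tendsto_cmult) auto
    then show ?thesis by simp
  qed
  have gs: "sqdist lborel (?r g) (?s j) \<le> e j" for j
  proof -
    have "sqdist lborel (?r g) (?s j) \<le> 2 * (sqdist lborel (?r g) (?r (f j)))
        + 2 * (sqdist lborel (?r (f j)) (?s j))"
      by (rule square_diff_triangle) auto
    also have "\<dots> \<le> e j" unfolding e_def by (intro add_left_mono mult_left_mono fs) auto
    finally show ?thesis .
  qed
  have SS: "sqdist M (?S k) (?S j) \<le> 2 * e k + 2 * e j" for j k
  proof -
    have "sqdist M (?S k) (?S j) = sqdist lborel (?s k) (?s j)"
      by (rule step_isometry[OF P P])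
    also have "\<dots> \<le> 2 * (sqdist lborel (?s k) (?r g)) + 2 * (sqdist lborel (?r g) (?s j))"
      by (rule square_diff_triangle) auto
    also have "\<dots> \<le> 2 * e k + 2 * e j"
      using gs[of k] gs[of j] unfolding power2_commute[of "?s k _"] by (intro add_mono mult_left_mono) auto
    finally show ?thesis .
  qed
  have IkS: "sqdist M (I k) (?S j) \<le> 2 * \<eta> k + 2 * (2 * e k + 2 * e j)" for j k
  proof -
    have "sqdist M (I k) (?S j) \<le> 2 * (sqdist M (I k) (?S k))
        + 2 * (sqdist M (?S k) (?S j))"
      by (rule square_diff_triangle) auto
    also have "\<dots> \<le> 2 * \<eta> k + 2 * (2 * e k + 2 * e j)"
      by (intro add_mono mult_left_mono IS SS) auto
    finally show ?thesis .
  qed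
  have JS: "sqdist M J (?S j) \<le> 4 * e j" for j
  proof -
    have "sqdist M J (?S j) = (\<integral>\<^sup>+\<omega>. liminf (\<lambda>k. ennreal ((I k \<omega> - ?S j \<omega>)\<^sup>2)) \<partial>M)"
    proof (rule nn_integral_cong_AE)
      show "AE \<omega> in M. ennreal ((J \<omega> - ?S j \<omega>)\<^sup>2) = liminf (\<lambda>k. ennreal ((I k \<omega> - ?S j \<omega>)\<^sup>2))"
        using J(2)
      proof eventually_elim
        case (elim \<omega>)
        then have "(\<lambda>k. ennreal ((I k \<omega> - ?S j \<omega>)\<^sup>2)) \<longlonglongrightarrow> ennreal ((J \<omega> - ?S j \<omega>)\<^sup>2)"
          by (intro tendsto_intros)
        then show ?case by (intro lim_imp_Liminf[symmetric]) auto
      qed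
    qed
    also have "\<dots> \<le> liminf (\<lambda>k. sqdist M (I k) (?S j))"
      by (rule nn_integral_liminf) auto
    also have "\<dots> \<le> liminf (\<lambda>k. 2 * \<eta> k + 2 * (2 * e k + 2 * e j))"
      by (intro Liminf_mono always_eventually allI IkS)
    also have "\<dots> = 2 * 0 + 2 * (2 * 0 + 2 * e j)"
      by (intro lim_imp_Liminf tendsto_add ennreal_tendsto_cmult \<eta>_lim e_lim tendsto_const) auto
    also have "\<dots> = 4 * e j" by (simp add: mult.assoc[symmetric])
    finally show ?thesis .
  qed
  have "(\<lambda>j. 4 * e j) \<longlonglongrightarrow> 4 * 0" by (intro ennreal_tendsto_cmult e_lim) auto
  then have l4: "(\<lambda>j. 4 * e j) \<longlonglongrightarrow> 0" by simp
  have A: "(\<lambda>j. sqdist M J (?S j)) \<longlonglongrightarrow> 0"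
    by (rule tendsto_sandwich[OF _ _ tendsto_const l4]) (auto intro!: always_eventually JS)
  have B: "(\<lambda>j. sqdist lborel (?r g) (?s j)) \<longlonglongrightarrow> 0"
    by (rule tendsto_sandwich[OF _ _ tendsto_const e_lim]) (auto intro!: always_eventually gs)
  show ?thesis
    unfolding has_wiener_integral_iff using P A B J(1) g by blast
qed

text \<open>With \<open>Gc\<close> the tail integral of \<open>g\<close>, the sums \<open>\<Sum> Gc(P i) (w(P (i + 1)) - w(P i))\<close> are integrals of \<open>g\<close> against the path
  sampled at the grid point following \<open>r\<close>: exchanging sum and integral leaves a telescoping sum of increments.
  They converge along every continuous path, while their step functions converge to \<open>Gc\<close> uniformly. The
  limit is taken as a measurable version \<open>I\<close>, since the pathwise integral may fail to be measurable on the null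
  set of discontinuous paths.\<close>

lemma riemann_integral_of_path:
  assumes t: "0 < t" and g: "set_integrable lborel {0..t} g"
  shows "\<exists>I. has_wiener_integral M w t (\<lambda>s. LBINT r:{s..t}. g r) I \<and>
     (AE \<omega> in M. I \<omega> = (LBINT r:{0..t}. g r * w r \<omega>))"
proof -
  define Gc where "Gc s = (LBINT r:{s..t}. g r)" for s
  define P where "P n i = t * real i / real (Suc n)" for n i
  have PP: "partition_upto t (Suc n) (P n)" for n
    unfolding partition_upto_def using t by (auto simp: P_def divide_right_mono)
  let ?s = "\<lambda>n. step_function (Suc n) (\<lambda>i. Gc (P n i)) (P n)"
  let ?S = "\<lambda>n. step_wiener_integral w (Suc n) (\<lambda>i. Gc (P n i)) (P n)"
  have gi: "integrable lborel (\<lambda>r. indicator {0..t} r * g r)"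
    using g by (simp add: set_integrable_def)
  have gsub: "set_integrable lborel {s..t} g" if "0 \<le> s" for s
    using that by (intro set_integrable_subset[OF g]) auto
  have Gc_cont: "continuous_on {0..t} Gc"
  proof -
    have "g integrable_on {0..t}" by (rule set_borel_integral_eq_integral(1)[OF g])
    then have "continuous_on {0..t} (\<lambda>s. integral {s..t} g)" by (rule indefinite_integral_continuous_1')
    then show ?thesis
      by (rule continuous_on_eq) (simp add: Gc_def set_borel_integral_eq_integral(2)[OF gsub])
  qed
  \<comment> \<open>The cells partition \<open>(0, t]\<close>; the point \<open>0\<close> is left out and is negligible.\<close>
  have one: "(\<Sum>i<Suc n. indicator {P n i<..P n (Suc i)} s) = (1::real)" if "0 < s" "s \<le> t" for n s
  proof -
    have "(\<Sum>i<Suc n. indicator {P n i<..P n (Suc i)} s :: real) =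
        (\<Sum>i<Suc n. indicator {..P n (Suc i)} s - indicator {..P n i} s)"
    proof (rule sum.cong)
      fix i
      have "P n i \<le> P n (Suc i)" using t by (simp add: P_def divide_right_mono)
      then show "indicator {P n i<..P n (Suc i)} s = (indicator {..P n (Suc i)} s - indicator {..P n i} s :: real)"
        by (auto simp: indicator_def)
    qed simp
    also have "\<dots> = indicator {..P n (Suc n)} s - indicator {..P n 0} s"
      by (rule sum_lessThan_telescope)
    also have "\<dots> = 1" using that by (simp add: P_def)
    finally show ?thesis .
  qed
  have L2: "(\<lambda>n. \<integral>\<^sup>+s\<in>{0..t}. ennreal ((Gc s - ?s n s)\<^sup>2) \<partial>lborel) \<longlonglongrightarrow> 0"
  proof (rule tendsto_zero_ennreal)
    fix r :: real assume r: "0 < r"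
    define \<epsilon> where "\<epsilon> = sqrt (r / (2 * t))"
    have \<epsilon>: "0 < \<epsilon>" using r t by (simp add: \<epsilon>_def)
    have "uniformly_continuous_on {0..t} Gc" by (intro compact_uniformly_continuous Gc_cont) auto
    then obtain d where d: "0 < d" "\<And>x y. x \<in> {0..t} \<Longrightarrow> y \<in> {0..t} \<Longrightarrow> \<bar>y - x\<bar> < d \<Longrightarrow> \<bar>Gc y - Gc x\<bar> < \<epsilon>"
      using \<epsilon> unfolding uniformly_continuous_on_def dist_real_def by blast
    have "(\<lambda>n. t * (1 / real (Suc n))) \<longlonglongrightarrow> t * 0"
      by (intro tendsto_intros LIMSEQ_Suc[OF lim_1_over_n])
    then have "\<forall>\<^sub>F n in sequentially. t * (1 / real (Suc n)) < d"
      using d(1) by (intro order_tendstoD(2)) auto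
    then show "\<forall>\<^sub>F n in sequentially. (\<integral>\<^sup>+s\<in>{0..t}. ennreal ((Gc s - ?s n s)\<^sup>2) \<partial>lborel) < ennreal r"
    proof eventually_elim
      case (elim n)
      have bd: "\<bar>Gc s - ?s n s\<bar> \<le> \<epsilon>" if s: "0 < s" "s \<le> t" for s
      proof -
        have "Gc s - ?s n s = (\<Sum>i<Suc n. (Gc s - Gc (P n i)) * indicator {P n i<..P n (Suc i)} s)"
          using one[OF s, of n]
          by (simp only: left_diff_distrib sum_subtractf sum_distrib_left[symmetric] step_function_def mult_1_right)
        also have "\<bar>\<dots>\<bar> \<le> (\<Sum>i<Suc n. \<epsilon> * indicator {P n i<..P n (Suc i)} s)"
        proof (rule order.trans[OF sum_abs], rule sum_mono)
          fix i assume i: "i \<in> {..<Suc n}"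
          show "\<bar>(Gc s - Gc (P n i)) * indicator {P n i<..P n (Suc i)} s\<bar> \<le> \<epsilon> * indicator {P n i<..P n (Suc i)} s"
          proof (cases "s \<in> {P n i<..P n (Suc i)}")
            case True
            have "P n (Suc i) = P n i + t * (1 / real (Suc n))" by (simp add: P_def add_divide_distrib distrib_left)
            then have "\<bar>s - P n i\<bar> < d" using True elim by auto
            moreover have "P n i \<in> {0..t}" using partition_uptoD(2,3)[OF PP[of n], of i] i by auto
            ultimately have "\<bar>Gc s - Gc (P n i)\<bar> < \<epsilon>" using d(2)[of "P n i" s] s by auto
            then show ?thesis using True by simp
          qed simp
        qed
        also have "\<dots> = \<epsilon>" using one[OF s, of n] by (simp only: sum_distrib_left[symmetric] mult_1_right)
        finally show ?thesis .
      qed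
      have "(\<integral>\<^sup>+s\<in>{0..t}. ennreal ((Gc s - ?s n s)\<^sup>2) \<partial>lborel) \<le> (\<integral>\<^sup>+s. ennreal (\<epsilon>\<^sup>2) * indicator {0..t} s \<partial>lborel)"
      proof (rule nn_integral_mono_AE)
        show "AE s in lborel. ennreal ((Gc s - ?s n s)\<^sup>2) * indicator {0..t} s \<le> ennreal (\<epsilon>\<^sup>2) * indicator {0..t} s"
          using AE_lborel_singleton[of 0]
        proof eventually_elim
          case (elim s)
          show ?case
          proof (cases "s \<in> {0..t}")
            case True
            then have "(Gc s - ?s n s)\<^sup>2 \<le> \<epsilon>\<^sup>2" using bd[of s] elim \<epsilon> by (intro abs_le_square_iff[THEN iffD1]) auto
            then show ?thesis using True by (simp add: ennreal_leI)
          qed simp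
        qed
      qed
      also have "\<dots> = ennreal (\<epsilon>\<^sup>2 * t)"
        using t by (subst nn_integral_cmult_indicator) (auto simp: ennreal_mult)
      also have "\<epsilon>\<^sup>2 * t = r / 2" using r t by (simp add: \<epsilon>_def)
      also have "ennreal (r / 2) < ennreal r" using r by (simp add: ennreal_less_iff)
      finally show ?case .
    qed
  qed
  have conv: "AE \<omega> in M. (\<lambda>n. ?S n \<omega>) \<longlonglongrightarrow> (LBINT r:{0..t}. g r * w r \<omega>)"
    using w_continuous w_0
  proof eventually_elim
    case (elim \<omega>)
    \<comment> \<open>The index of the first grid point to the right of \<open>r\<close>, capped at the end point.\<close>
    define K where "K n r = min (Suc n) (Suc (nat \<lfloor>r * real (Suc n) / t\<rfloor>))" for n r
    let ?W = "\<lambda>n r. \<Sum>i<Suc n. indicator {P n i..} r * (w (P n (Suc i)) \<omega> - w (P n i) \<omega>)"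
    have tele: "?W n r = w (P n (K n r)) \<omega>"
      if r: "0 \<le> r" "r \<le> t" for n r
    proof -
      have iff: "P n i \<le> r \<longleftrightarrow> i < Suc (nat \<lfloor>r * real (Suc n) / t\<rfloor>)" for i
      proof -
        have "P n i \<le> r \<longleftrightarrow> real i \<le> r * real (Suc n) / t"
          using t by (simp add: P_def field_simps)
        also have "\<dots> \<longleftrightarrow> int i \<le> \<lfloor>r * real (Suc n) / t\<rfloor>" by (simp add: le_floor_iff)
        also have "\<dots> \<longleftrightarrow> i < Suc (nat \<lfloor>r * real (Suc n) / t\<rfloor>)"
          using r t by (simp add: less_Suc_eq_le nat_le_iff le_nat_iff)
        finally show ?thesis .
      qed
      have "?W n r =
          (\<Sum>i<K n r. w (P n (Suc i)) \<omega> - w (P n i) \<omega>)"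
        by (rule sum.mono_neutral_cong_right) (auto simp: K_def iff indicator_def)
      also have "\<dots> = w (P n (K n r)) \<omega> - w (P n 0) \<omega>" by (rule sum_lessThan_telescope)
      finally show ?thesis using elim by (simp add: P_def)
    qed
    have near: "r \<le> P n (K n r)" "P n (K n r) \<le> r + t * (1 / real (Suc n))" "P n (K n r) \<le> t"
      if r: "0 \<le> r" "r \<le> t" for n r
    proof -
      let ?x = "r * real (Suc n) / t"
      have x: "0 \<le> ?x" using r t by simp
      have rx: "r = t * ?x / real (Suc n)" using t by simp
      show "P n (K n r) \<le> t" using partition_uptoD(3)[OF PP[of n], of "K n r"] by (simp add: K_def)
      have "real (K n r) \<le> ?x + 1" using x by (simp add: K_def min_def) linarith
      then have "t * real (K n r) / real (Suc n) \<le> t * (?x + 1) / real (Suc n)"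
        using t by (intro divide_right_mono mult_left_mono) auto
      also have "\<dots> = r + t * (1 / real (Suc n))"
        using rx by (simp add: distrib_left add_divide_distrib)
      finally show "P n (K n r) \<le> r + t * (1 / real (Suc n))" by (simp add: P_def)
      show "r \<le> P n (K n r)"
      proof (cases "K n r = Suc n")
        case True then show ?thesis using r by (simp add: P_def)
      next
        case False
        then have "?x \<le> real (K n r)" using x by (simp add: K_def min_def split: if_splits) linarith
        then have "t * ?x / real (Suc n) \<le> t * real (K n r) / real (Suc n)"
          using t by (intro divide_right_mono mult_left_mono) auto
        then show ?thesis using rx by (simp add: P_def)
      qed
    qed
    have c: "continuous_on {0..t} (\<lambda>r. w r \<omega>)" using elim(1) by (rule continuous_on_subset) auto
    obtain B where B: "\<forall>r\<in>{0..t}. \<bar>w r \<omega>\<bar> \<le> B" using continuous_bounded[OF elim(1)] by blast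
    have Seq: "?S n \<omega> = (\<integral>r. indicator {0..t} r * g r * ?W n r \<partial>lborel)" for n
    proof -
      have ii: "integrable lborel (\<lambda>r. indicator {P n i..t} r * g r)" if "i < Suc n" for i
        using gsub[of "P n i"] partition_uptoD(2)[OF PP[of n], of i] that by (simp add: set_integrable_def)
      have "?S n \<omega> = (\<Sum>i<Suc n. (\<integral>r. indicator {P n i..t} r * g r \<partial>lborel) * (w (P n (Suc i)) \<omega> - w (P n i) \<omega>))"
        by (simp add: step_wiener_integral_def Gc_def set_lebesgue_integral_def)
      also have "\<dots> = (\<Sum>i<Suc n. (\<integral>r. indicator {P n i..t} r * g r * (w (P n (Suc i)) \<omega> - w (P n i) \<omega>) \<partial>lborel))"
        by (intro sum.cong refl integral_mult_left[symmetric] ii) auto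
      also have "\<dots> = (\<integral>r. (\<Sum>i<Suc n. indicator {P n i..t} r * g r * (w (P n (Suc i)) \<omega> - w (P n i) \<omega>)) \<partial>lborel)"
        by (intro Bochner_Integration.integral_sum[symmetric] integrable_mult_left ii) auto
      also have "\<dots> = (\<integral>r. indicator {0..t} r * g r * ?W n r \<partial>lborel)"
      proof (rule Bochner_Integration.integral_cong)
        fix r
        have "indicator {P n i..t} r = (indicator {0..t} r * indicator {P n i..} r :: real)" if "i < Suc n" for i
          using partition_uptoD(2)[OF PP[of n], of i] that by (auto simp: indicator_def)
        then show "(\<Sum>i<Suc n. indicator {P n i..t} r * g r * (w (P n (Suc i)) \<omega> - w (P n i) \<omega>)) =
            indicator {0..t} r * g r * ?W n r"
          unfolding sum_distrib_left by (intro sum.cong) (auto simp: mult_ac)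
      qed simp
      finally show ?thesis .
    qed
    have wm: "(\<lambda>r. indicator {0..t} r * w r \<omega>) \<in> borel_measurable borel"
      using borel_measurable_continuous_on_indicator[OF _ c] by simp
    have "(\<lambda>n. ?S n \<omega>) \<longlonglongrightarrow> (\<integral>r. indicator {0..t} r * g r * (indicator {0..t} r * w r \<omega>) \<partial>lborel)"
      unfolding Seq
    proof (rule integral_dominated_convergence[where w = "\<lambda>r. norm (indicator {0..t} r * g r) * B"])
      show "integrable lborel (\<lambda>r. norm (indicator {0..t} r * g r) * B)"
        by (intro integrable_mult_left integrable_norm gi)
      show "(\<lambda>r. indicator {0..t} r * g r * (indicator {0..t} r * w r \<omega>)) \<in> borel_measurable lborel"
        using gi wm by measurable
      show "(\<lambda>r. indicator {0..t} r * g r * ?W n r) \<in> borel_measurable lborel" for n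
        using gi by measurable
      show "AE r in lborel. norm (indicator {0..t} r * g r * ?W n r)
          \<le> norm (indicator {0..t} r * g r) * B" for n
      proof (rule AE_I2)
        fix r
        show "norm (indicator {0..t} r * g r * ?W n r)
          \<le> norm (indicator {0..t} r * g r) * B"
        proof (cases "r \<in> {0..t}")
          case True
          then have "\<bar>w (P n (K n r)) \<omega>\<bar> \<le> B" using near[of r n] B by auto
          then have B': "norm (w (P n (K n r)) \<omega>) \<le> B" by simp
          have eq: "?W n r = w (P n (K n r)) \<omega>"
            by (rule tele) (use True in auto)
          show ?thesis
            unfolding eq norm_mult[of "indicator {0..t} r * g r"] by (rule mult_left_mono[OF B' norm_ge_zero])
        qed simp
      qed
      show "AE r in lborel. (\<lambda>n. indicator {0..t} r * g r * ?W n r)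
          \<longlonglongrightarrow> indicator {0..t} r * g r * (indicator {0..t} r * w r \<omega>)"
      proof (rule AE_I2)
        fix r
        show "(\<lambda>n. indicator {0..t} r * g r * ?W n r)
          \<longlonglongrightarrow> indicator {0..t} r * g r * (indicator {0..t} r * w r \<omega>)"
        proof (cases "r \<in> {0..t}")
          case True
          have "(\<lambda>n. r + t * (1 / real (Suc n))) \<longlonglongrightarrow> r + t * 0"
            by (intro tendsto_intros LIMSEQ_Suc[OF lim_1_over_n])
          then have up: "(\<lambda>n. r + t * (1 / real (Suc n))) \<longlonglongrightarrow> r" by simp
          have Pl: "(\<lambda>n. P n (K n r)) \<longlonglongrightarrow> r"
          proof (rule tendsto_sandwich[OF _ _ tendsto_const up])
            show "\<forall>\<^sub>F n in sequentially. r \<le> P n (K n r)"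
              "\<forall>\<^sub>F n in sequentially. P n (K n r) \<le> r + t * (1 / real (Suc n))"
              using near(1,2)[of r] True by (auto intro!: always_eventually)
          qed
          have "(\<lambda>n. w (P n (K n r)) \<omega>) \<longlonglongrightarrow> w r \<omega>"
          proof (rule continuous_on_tendsto_compose[OF c Pl True])
            have "P n (K n r) \<in> {0..t}" for n using near(1,3)[of r n] True by auto
            then show "\<forall>\<^sub>F n in sequentially. P n (K n r) \<in> {0..t}" by simp
          qed
          then have "(\<lambda>n. indicator {0..t} r * g r * w (P n (K n r)) \<omega>) \<longlonglongrightarrow> indicator {0..t} r * g r * w r \<omega>"
            by (intro tendsto_mult tendsto_const)
          moreover have "?W n r = w (P n (K n r)) \<omega>" for n
            by (rule tele) (use True in auto)
          moreover have "indicator {0..t} r * w r \<omega> = w r \<omega>" using True by simp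
          ultimately show ?thesis by (simp only:)
        qed simp
      qed
    qed
    also have "(\<integral>r. indicator {0..t} r * g r * (indicator {0..t} r * w r \<omega>) \<partial>lborel) = (LBINT r:{0..t}. g r * w r \<omega>)"
      unfolding set_lebesgue_integral_def by (intro Bochner_Integration.integral_cong) (auto simp: indicator_def)
    finally show ?case .
  qed
  define I where "I \<omega> = lim (\<lambda>n. ?S n \<omega>)" for \<omega>
  have Im: "I \<in> borel_measurable M"
    unfolding I_def by (rule borel_measurable_lim_metric) (rule step_wiener_measurable[OF PP])
  have IE: "AE \<omega> in M. I \<omega> = (LBINT r:{0..t}. g r * w r \<omega>)"
    using conv by eventually_elim (simp add: I_def limI)
  have IL: "AE \<omega> in M. (\<lambda>n. ?S n \<omega>) \<longlonglongrightarrow> I \<omega>"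
    using conv IE by eventually_elim simp
  have "has_wiener_integral M w t Gc I"
  proof (rule has_wiener_integral_limit[OF has_wiener_integral_step[OF PP] Im IL _ L2])
    show "set_borel_measurable lborel {0..t} Gc"
      using borel_measurable_continuous_on_indicator[OF _ Gc_cont] by (simp add: set_borel_measurable_def)
  qed
  then show ?thesis using IE unfolding Gc_def[abs_def] by blast
qed

end

section \<open>Gaussian laws and characteristic functions\<close>

lemma real_distribution_gaussian_law:
  assumes "0 \<le> v" shows "real_distribution (gaussian_law m v)"
proof (cases "v = 0")
  case True
  then show ?thesis
    using prob_space_return[of m borel]
    by (simp add: gaussian_law_def real_distribution_def real_distribution_axioms_def)
next
  case False
  then have "prob_space (density lborel (normal_density m (sqrt v)))"
    using assms by (intro prob_space_normal_density) simp
  with False show ?thesis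
    by (simp add: gaussian_law_def real_distribution_def real_distribution_axioms_def)
qed

text \<open>An affine substitution reduces \<open>v > 0\<close> to the standard normal law, and the point mass at \<open>v = 0\<close> obeys the same
  formula.\<close>

lemma char_gaussian_law:
  assumes "0 \<le> v"
  shows "char (gaussian_law m v) \<theta> = iexp (\<theta> * m) * complex_of_real (exp (- (\<theta>\<^sup>2 * v) / 2))"
proof (cases "v = 0")
  case True
  then show ?thesis by (simp add: gaussian_law_def char_def integral_return)
next
  case False
  define \<sigma> where "\<sigma> = sqrt v"
  have \<sigma>: "0 < \<sigma>" "\<sigma>\<^sup>2 = v" using False assms by (auto simp: \<sigma>_def)
  have nd: "\<sigma> * normal_density m \<sigma> (m + \<sigma> * x) = std_normal_density x" for x
    using \<sigma>(1) by (simp add: normal_density_def real_sqrt_mult field_simps power2_eq_square)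
  have "char (gaussian_law m v) \<theta> = (\<integral>x. normal_density m \<sigma> x *\<^sub>R iexp (\<theta> * x) \<partial>lborel)"
    using False by (simp add: gaussian_law_def char_def integral_density \<sigma>_def)
  also have "\<dots> = \<bar>\<sigma>\<bar> *\<^sub>R (\<integral>x. normal_density m \<sigma> (m + \<sigma> * x) *\<^sub>R iexp (\<theta> * (m + \<sigma> * x)) \<partial>lborel)"
    using \<sigma> by (intro lborel_integral_real_affine) auto
  also have "\<dots> = (\<integral>x. iexp (\<theta> * m) * (std_normal_density x *\<^sub>R iexp (\<theta> * \<sigma> * x)) \<partial>lborel)"
  proof -
    have "\<bar>\<sigma>\<bar> *\<^sub>R (normal_density m \<sigma> (m + \<sigma> * x) *\<^sub>R iexp (\<theta> * (m + \<sigma> * x))) =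
       iexp (\<theta> * m) * (std_normal_density x *\<^sub>R iexp (\<theta> * \<sigma> * x))" for x
    proof -
      have "iexp (\<theta> * (m + \<sigma> * x)) = iexp (\<theta> * m) * iexp (\<theta> * \<sigma> * x)"
        by (simp add: exp_add[symmetric] algebra_simps)
      then show ?thesis using \<sigma> nd[of x] by (simp add: mult_ac)
    qed
    then show ?thesis by (simp only: integral_scaleR_right[symmetric])
  qed
  also have "\<dots> = iexp (\<theta> * m) * (\<integral>x. std_normal_density x *\<^sub>R iexp (\<theta> * \<sigma> * x) \<partial>lborel)"
    by (rule Bochner_Integration.integral_mult_right_zero)
  also have "(\<integral>x. std_normal_density x *\<^sub>R iexp (\<theta> * \<sigma> * x) \<partial>lborel) = char std_normal_distribution (\<theta> * \<sigma>)"
    by (simp add: char_def integral_density)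
  also have "\<dots> = complex_of_real (exp (- (\<theta>\<^sup>2 * v) / 2))"
    using \<sigma>(2) by (simp add: char_std_normal_distribution power_mult_distrib)
  finally show ?thesis .
qed

lemma (in prob_space) moments_of_gaussian_law:
  assumes X [measurable]: "X \<in> borel_measurable M" and law: "distr M borel X = gaussian_law m v" and v: "0 \<le> v"
  shows "expectation X = m" "variance X = v"
proof -
  have "expectation X = m \<and> variance X = v"
  proof (cases "v = 0")
    case True
    have law': "distr M borel X = return borel m" using law True by (simp add: gaussian_law_def)
    have E: "expectation (\<lambda>\<omega>. f (X \<omega>)) = f m" if [measurable]: "f \<in> borel_measurable borel" for f :: "real \<Rightarrow> real"
    proof -
      have "expectation (\<lambda>\<omega>. f (X \<omega>)) = (\<integral>x. f x \<partial>distr M borel X)" by (simp add: integral_distr)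
      then show ?thesis unfolding law' by (simp add: integral_return)
    qed
    have "expectation X = m" using E[of "\<lambda>x. x"] by simp
    then show ?thesis using E[of "\<lambda>x. (x - m)\<^sup>2"] True by simp
  next
    case False
    then have s: "0 < sqrt v" using v by simp
    have "distr M lborel X = distr M borel X" by (rule distr_cong) auto
    then have D: "distributed M lborel X (normal_density m (sqrt v))"
      using law False by (simp add: distributed_def gaussian_law_def)
    show ?thesis
      using normal_distributed_expectation[OF s D] normal_distributed_variance[OF s D] v by simp
  qed
  then show "expectation X = m" "variance X = v" by auto
qed

lemma (in prob_space) char_distr:
  assumes [measurable]: "X \<in> borel_measurable M"
  shows "char (distr M borel X) \<theta> = (CLINT \<omega>|M. iexp (\<theta> * X \<omega>))"
  by (simp add: char_def integral_distr)

lemma iexp_lipschitz: "cmod (iexp x - iexp y) \<le> \<bar>x - y\<bar>"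
proof -
  have "iexp x - iexp y = iexp y * (iexp (x - y) - 1)"
    by (simp add: right_diff_distrib exp_add[symmetric] algebra_simps)
  then have "cmod (iexp x - iexp y) = cmod (iexp (x - y) - 1)"
    by (simp add: norm_mult)
  also have "\<dots> \<le> \<bar>x - y\<bar>" using iexp_approx1[of "x - y" 0] by simp
  finally show ?thesis .
qed

text \<open>The functions \<open>iexp\<close> are Lipschitz, and \<open>\<bar>x\<bar> \<le> e + x\<^sup>2 / e\<close> reduces the \<open>L\<^sub>1\<close> distance to the \<open>L\<^sub>2\<close> distance.\<close>

lemma (in prob_space) char_continuous_L2:
  fixes S :: "nat \<Rightarrow> 'a \<Rightarrow> real"
  assumes [measurable]: "\<And>j. S j \<in> borel_measurable M" "I \<in> borel_measurable M"
    and lim: "(\<lambda>j. sqdist M I (S j)) \<longlonglongrightarrow> 0"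
  shows "(\<lambda>j. char (distr M borel (S j)) \<theta>) \<longlonglongrightarrow> char (distr M borel I) \<theta>"
proof -
  define d where "d j = expectation (\<lambda>\<omega>. (I \<omega> - S j \<omega>)\<^sup>2)" for j
  note sq = square_integrals_tendsto_0[OF _ lim]
  have d0: "0 \<le> d j" for j by (simp add: d_def)
  have dl: "d \<longlonglongrightarrow> 0" using sq(2) by (simp add: d_def[abs_def])
  obtain e where e0: "\<And>j. 0 < e j" and el: "e \<longlonglongrightarrow> 0" and de: "\<And>j. d j / e j \<le> sqrt (d j)"
    by (rule balancing_sequence[OF d0 dl]) (rule that)
  have ev: "\<forall>\<^sub>F j in sequentially. integrable M (\<lambda>\<omega>. (I \<omega> - S j \<omega>)\<^sup>2)" by (rule sq(1)) simp
  have bound: "\<forall>\<^sub>F j in sequentially. norm (char (distr M borel (S j)) \<theta> - char (distr M borel I) \<theta>) \<le> \<bar>\<theta>\<bar> * (e j + sqrt (d j))"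
    using ev
  proof eventually_elim
    case (elim j)
    have i1: "integrable M (\<lambda>\<omega>. iexp (\<theta> * S j \<omega>))" "integrable M (\<lambda>\<omega>. iexp (\<theta> * I \<omega>))"
      by (auto intro!: integrable_const_bound[where B = 1])
    have abs_le: "\<bar>x\<bar> \<le> e j + x\<^sup>2 / e j" for x
    proof (cases "\<bar>x\<bar> \<le> e j")
      case True then show ?thesis using e0[of j] by (simp add: add_increasing2)
    next
      case False
      then have "\<bar>x\<bar> * e j \<le> \<bar>x\<bar> * \<bar>x\<bar>" by (intro mult_left_mono) auto
      then have "\<bar>x\<bar> \<le> x\<^sup>2 / e j" using e0[of j] by (simp add: le_divide_eq power2_eq_square)
      then show ?thesis using e0[of j] by simp
    qed
    have "norm (char (distr M borel (S j)) \<theta> - char (distr M borel I) \<theta>) =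
        norm (CLINT \<omega>|M. iexp (\<theta> * S j \<omega>) - iexp (\<theta> * I \<omega>))"
      using i1 by (simp add: char_distr)
    also have "\<dots> \<le> (\<integral>\<omega>. norm (iexp (\<theta> * S j \<omega>) - iexp (\<theta> * I \<omega>)) \<partial>M)" by (rule integral_norm_bound)
    also have "\<dots> \<le> (\<integral>\<omega>. \<bar>\<theta>\<bar> * (e j + (I \<omega> - S j \<omega>)\<^sup>2 / e j) \<partial>M)"
    proof (rule integral_mono)
      show "integrable M (\<lambda>\<omega>. norm (iexp (\<theta> * S j \<omega>) - iexp (\<theta> * I \<omega>)))"
        using i1 by (intro integrable_norm Bochner_Integration.integrable_diff)
      show "integrable M (\<lambda>\<omega>. \<bar>\<theta>\<bar> * (e j + (I \<omega> - S j \<omega>)\<^sup>2 / e j))" using elim by simp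
      fix \<omega>
      have "norm (iexp (\<theta> * S j \<omega>) - iexp (\<theta> * I \<omega>)) \<le> \<bar>\<theta> * S j \<omega> - \<theta> * I \<omega>\<bar>" by (rule iexp_lipschitz)
      also have "\<dots> = \<bar>\<theta>\<bar> * \<bar>I \<omega> - S j \<omega>\<bar>" by (simp add: right_diff_distrib[symmetric] abs_mult abs_minus_commute)
      also have "\<dots> \<le> \<bar>\<theta>\<bar> * (e j + (I \<omega> - S j \<omega>)\<^sup>2 / e j)" by (intro mult_left_mono abs_le) auto
      finally show "norm (iexp (\<theta> * S j \<omega>) - iexp (\<theta> * I \<omega>)) \<le> \<bar>\<theta>\<bar> * (e j + (I \<omega> - S j \<omega>)\<^sup>2 / e j)" .
    qed
    also have "\<dots> = \<bar>\<theta>\<bar> * (e j + d j / e j)" using elim by (simp add: d_def prob_space)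
    also have "\<dots> \<le> \<bar>\<theta>\<bar> * (e j + sqrt (d j))" by (intro mult_left_mono add_left_mono de) auto
    finally show ?case .
  qed
  have "(\<lambda>j. \<bar>\<theta>\<bar> * (e j + sqrt (d j))) \<longlonglongrightarrow> \<bar>\<theta>\<bar> * (0 + sqrt 0)"
    by (intro tendsto_intros el dl)
  then have "(\<lambda>j. \<bar>\<theta>\<bar> * (e j + sqrt (d j))) \<longlonglongrightarrow> 0" by simp
  then have "(\<lambda>j. char (distr M borel (S j)) \<theta> - char (distr M borel I) \<theta>) \<longlonglongrightarrow> 0"
    by (rule Lim_null_comparison[OF bound])
  then show ?thesis by (simp add: LIM_zero_iff)
qed

context brownian_motion
begin

lemma char_increment:
  assumes "0 \<le> s" "s \<le> t"
  shows "char (distr M borel (\<lambda>\<omega>. c * (w t \<omega> - w s \<omega>))) \<theta> = complex_of_real (exp (- (\<theta>\<^sup>2 * (c\<^sup>2 * (t - s))) / 2))"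
proof (cases "s = t")
  case True
  then show ?thesis by (subst char_distr) (simp_all add: prob_space)
next
  case False
  then have st: "s < t" using assms by simp
  have [measurable]: "w s \<in> borel_measurable M" "w t \<in> borel_measurable M" using assms by auto
  have "distr M borel (\<lambda>\<omega>. w t \<omega> - w s \<omega>) = distr M lborel (\<lambda>\<omega>. w t \<omega> - w s \<omega>)" by (rule distr_cong) auto
  also have "\<dots> = gaussian_law 0 (t - s)"
    using distributed_distr_eq_density[OF increment_distributed[OF assms(1) st]] st by (simp add: gaussian_law_def)
  finally have law: "distr M borel (\<lambda>\<omega>. w t \<omega> - w s \<omega>) = gaussian_law 0 (t - s)" .
  have "char (distr M borel (\<lambda>\<omega>. c * (w t \<omega> - w s \<omega>))) \<theta> = char (distr M borel (\<lambda>\<omega>. w t \<omega> - w s \<omega>)) (\<theta> * c)"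
    by (simp add: char_distr mult.assoc)
  also have "\<dots> = complex_of_real (exp (- (\<theta>\<^sup>2 * (c\<^sup>2 * (t - s))) / 2))"
    unfolding law using st by (simp add: char_gaussian_law power_mult_distrib mult.assoc)
  finally show ?thesis .
qed

text \<open>Independence of increments turns the characteristic function into a product of Gaussian ones; as the cells
  are disjoint, the exponents add up to the integral of the squared step function.\<close>

lemma char_step_wiener_integral:
  assumes p: "partition_upto t n p"
  shows "char (distr M borel (step_wiener_integral w n c p)) \<theta> =
    complex_of_real (exp (- (\<theta>\<^sup>2 * (\<integral>s. (step_function n c p s)\<^sup>2 \<partial>lborel)) / 2))"
proof -
  have mono: "p i \<le> p (Suc i)" "0 \<le> p i" if "i < n" for i
    using p partition_uptoD(2)[OF p, of i] that by (auto simp: partition_upto_def)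
  define \<tau> where "\<tau> i = p (min i n)" for i
  have "indep_vars (\<lambda>_. borel) (\<lambda>i \<omega>. w (\<tau> (Suc i)) \<omega> - w (\<tau> i) \<omega>) {..<n}"
  proof (rule increments_indep)
    show "0 \<le> \<tau> 0" using p by (simp add: \<tau>_def partition_upto_def)
    show "mono \<tau>" unfolding \<tau>_def mono_def using partition_uptoD(1)[OF p] by auto
  qed
  then have "indep_vars (\<lambda>_. borel) (\<lambda>i \<omega>. c i * (w (\<tau> (Suc i)) \<omega> - w (\<tau> i) \<omega>)) {..<n}"
    by (rule indep_vars_compose2[where Y = "\<lambda>i x. c i * x"]) measurable
  also have "indep_vars (\<lambda>_. borel) (\<lambda>i \<omega>. c i * (w (\<tau> (Suc i)) \<omega> - w (\<tau> i) \<omega>)) {..<n} \<longleftrightarrow>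
      indep_vars (\<lambda>_. borel) (\<lambda>i \<omega>. c i * (w (p (Suc i)) \<omega> - w (p i) \<omega>)) {..<n}"
    by (rule indep_vars_cong) (auto simp: \<tau>_def min_def fun_eq_iff le_Suc_eq)
  finally have ind: "indep_vars (\<lambda>_. borel) (\<lambda>i \<omega>. c i * (w (p (Suc i)) \<omega> - w (p i) \<omega>)) {..<n}" .
  have "char (distr M borel (step_wiener_integral w n c p)) \<theta> =
      (\<Prod>i<n. char (distr M borel (\<lambda>\<omega>. c i * (w (p (Suc i)) \<omega> - w (p i) \<omega>))) \<theta>)"
    unfolding step_wiener_integral_def[abs_def] by (rule char_distr_sum[OF ind])
  also have "\<dots> = (\<Prod>i<n. complex_of_real (exp (- (\<theta>\<^sup>2 * ((c i)\<^sup>2 * (p (Suc i) - p i))) / 2)))"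
    using mono by (intro prod.cong refl char_increment) auto
  also have "\<dots> = complex_of_real (exp (\<Sum>i<n. - (\<theta>\<^sup>2 * ((c i)\<^sup>2 * (p (Suc i) - p i))) / 2))"
    by (simp only: exp_sum finite_lessThan of_real_prod)
  also have "(\<Sum>i<n. - (\<theta>\<^sup>2 * ((c i)\<^sup>2 * (p (Suc i) - p i))) / 2) = - (\<theta>\<^sup>2 * (\<Sum>i<n. (c i)\<^sup>2 * (p (Suc i) - p i))) / 2"
    by (simp only: sum_distrib_left sum_negf[symmetric] sum_divide_distrib)
  also have "(\<Sum>i<n. (c i)\<^sup>2 * (p (Suc i) - p i)) = (\<integral>s. (step_function n c p s)\<^sup>2 \<partial>lborel)"
  proof -
    have "(step_function n c p s)\<^sup>2 = (\<Sum>i<n. (c i)\<^sup>2 * indicator {p i<..p (Suc i)} s)" for s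
    proof -
      have disj: "indicator {p i<..p (Suc i)} s * indicator {p j<..p (Suc j)} s = (0::real)" if "i < n" "j < n" "i \<noteq> j" for i j
        using that partition_uptoD(1)[OF p, of "Suc i" j] partition_uptoD(1)[OF p, of "Suc j" i]
        by (cases "i < j") (auto simp: indicator_def)
      have "(step_function n c p s)\<^sup>2 = (\<Sum>i<n. \<Sum>j<n. (c i * c j) * (indicator {p i<..p (Suc i)} s * indicator {p j<..p (Suc j)} s))"
        by (simp only: step_function_def power2_eq_square sum_product mult_ac)
      also have "\<dots> = (\<Sum>i<n. \<Sum>j<n. if i = j then (c i)\<^sup>2 * indicator {p i<..p (Suc i)} s else 0)"
        using disj by (intro sum.cong refl) (auto simp: power2_eq_square indicator_def)
      also have "\<dots> = (\<Sum>i<n. (c i)\<^sup>2 * indicator {p i<..p (Suc i)} s)" by simp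
      finally show ?thesis .
    qed
    moreover have "has_bochner_integral lborel (\<lambda>s. \<Sum>i<n. (c i)\<^sup>2 * indicator {p i<..p (Suc i)} s) (\<Sum>i<n. (c i)\<^sup>2 * measure lborel {p i<..p (Suc i)})"
      using mono by (intro has_bochner_integral_sum has_bochner_integral_mult_right has_bochner_integral_real_indicator) auto
    moreover have "(\<Sum>i<n. (c i)\<^sup>2 * measure lborel {p i<..p (Suc i)}) = (\<Sum>i<n. (c i)\<^sup>2 * (p (Suc i) - p i))"
      using mono by (intro sum.cong) auto
    ultimately show ?thesis by (simp add: has_bochner_integral_iff)
  qed
  finally show ?thesis .
qed

text \<open>Both sides of the formula for step functions pass to the limit, and characteristic functions determine laws.\<close>

theorem wiener_integral_law:
  assumes W: "has_wiener_integral M w t f I"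
    and f: "integrable lborel (\<lambda>s. indicator {0..t} s * (f s)\<^sup>2)"
  shows "distr M borel (\<lambda>\<omega>. m + I \<omega>) = gaussian_law m (LBINT s:{0..t}. (f s)\<^sup>2)"
proof -
  define v where "v = (LBINT s:{0..t}. (f s)\<^sup>2)"
  have v0: "0 \<le> v" unfolding v_def set_lebesgue_integral_def by (intro integral_nonneg_AE) auto
  have Im [measurable]: "I \<in> borel_measurable M" and fm: "(\<lambda>s. indicator {0..t} s * f s) \<in> borel_measurable lborel"
    using W by (auto simp: has_wiener_integral_iff set_borel_measurable_def)
  obtain n c p where P: "\<And>j. partition_upto t (n j) (p j)"
      and l1: "(\<lambda>j. sqdist lborel (\<lambda>s. indicator {0..t} s * f s) (step_function (n j) (c j) (p j))) \<longlonglongrightarrow> 0"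
      and l2: "(\<lambda>j. sqdist M I (step_wiener_integral w (n j) (c j) (p j))) \<longlonglongrightarrow> 0"
    using W unfolding has_wiener_integral_iff by blast
  have sq: "(indicator {0..t} s * f s)\<^sup>2 = indicator {0..t} s * (f s)\<^sup>2" for s by (auto simp: indicator_def)
  have "(\<lambda>j. \<integral>s. (step_function (n j) (c j) (p j) s)\<^sup>2 \<partial>lborel) \<longlonglongrightarrow> (\<integral>s. (indicator {0..t} s * f s)\<^sup>2 \<partial>lborel)"
    by (rule square_integral_continuous[OF _ fm _ l1]) (simp_all add: sq f)
  also have "(\<integral>s. (indicator {0..t} s * f s)\<^sup>2 \<partial>lborel) = v"
    unfolding v_def set_lebesgue_integral_def by (simp add: sq)
  finally have vl: "(\<lambda>j. \<integral>s. (step_function (n j) (c j) (p j) s)\<^sup>2 \<partial>lborel) \<longlonglongrightarrow> v" .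
  have "char (distr M borel I) \<theta> = complex_of_real (exp (- (\<theta>\<^sup>2 * v) / 2))" for \<theta>
  proof (rule LIMSEQ_unique)
    show "(\<lambda>j. char (distr M borel (step_wiener_integral w (n j) (c j) (p j))) \<theta>) \<longlonglongrightarrow> char (distr M borel I) \<theta>"
      by (rule char_continuous_L2[OF step_wiener_measurable[OF P] Im l2])
    show "(\<lambda>j. char (distr M borel (step_wiener_integral w (n j) (c j) (p j))) \<theta>) \<longlonglongrightarrow> complex_of_real (exp (- (\<theta>\<^sup>2 * v) / 2))"
      unfolding char_step_wiener_integral[OF P] by (intro tendsto_intros vl) simp
  qed
  then have "char (distr M borel (\<lambda>\<omega>. m + I \<omega>)) \<theta> = char (gaussian_law m v) \<theta>" for \<theta>
  proof -
    assume c: "\<And>\<theta>. char (distr M borel I) \<theta> = complex_of_real (exp (- (\<theta>\<^sup>2 * v) / 2))"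
    have "char (distr M borel (\<lambda>\<omega>. m + I \<omega>)) \<theta> = (CLINT \<omega>|M. iexp (\<theta> * m) * iexp (\<theta> * I \<omega>))"
      by (simp add: char_distr exp_add[symmetric] algebra_simps)
    also have "\<dots> = iexp (\<theta> * m) * char (distr M borel I) \<theta>"
      by (simp add: char_distr)
    finally show ?thesis using c v0 by (simp add: char_gaussian_law)
  qed
  then have "char (distr M borel (\<lambda>\<omega>. m + I \<omega>)) = char (gaussian_law m v)" by (rule ext)
  moreover have "real_distribution (distr M borel (\<lambda>\<omega>. m + I \<omega>))" by (rule real_distribution_distr) simp
  ultimately show ?thesis
    unfolding v_def[symmetric] using real_distribution_gaussian_law[OF v0] by (intro Levy_uniqueness)
qed

end

section \<open>The solution as a Gaussian Volterra process\<close>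

text \<open>The tail integrals that \<open>riemann_integral_of_path\<close> asks for, with the kernel started at time \<open>t'\<close>.\<close>

lemma (in relaxation) G_tail_integral:
  assumes \<rho>: "0 < \<rho>" and t: "t' \<le> t"
  shows "has_bochner_integral lborel (\<lambda>r. indicator {s..t} r * G \<rho> (t' - r)) (G (\<rho> + 1) (t' - s))"
proof -
  have "has_bochner_integral lborel (\<lambda>r. riesz 1 (t' - s - r) * G \<rho> r) (G (\<rho> + 1) (t' - s))"
    using \<rho> \<beta>_pos by (intro has_bochner_integral_riesz_ml_kernel) auto
  then have "has_bochner_integral lborel (\<lambda>r. riesz 1 (t' - s - (t' + - 1 * r)) * G \<rho> (t' + - 1 * r)) (G (\<rho> + 1) (t' - s))"
    by (subst (asm) lborel_has_bochner_integral_real_affine_iff[of "- 1" _ _ t']) auto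
  moreover have "AE r in lborel. riesz 1 (t' - s - (t' + - 1 * r)) * G \<rho> (t' + - 1 * r) = indicator {s..t} r * G \<rho> (t' - r)"
    using AE_lborel_singleton[of s]
    by eventually_elim (use t G_nonpos_arg in \<open>auto simp: riesz_1 indicator_def\<close>)
  ultimately show ?thesis
    by (subst has_bochner_integral_cong_AE[symmetric]) auto
qed

lemma (in relaxation) solution_kernel_eq:
  "solution_kernel a \<beta> \<gamma> t s = G (\<beta> - \<gamma> + 1) (t - s)"
  by (simp add: solution_kernel_def ml_kernel_def)

text \<open>The regular case, in which the solution is a genuine process.\<close>

locale fractional_equation = relaxation a \<beta> + brownian_motion M w
  for a \<beta> :: real and M :: "'a measure" and w :: "real \<Rightarrow> 'a \<Rightarrow> real" +
  fixes \<gamma> X0 :: real and X :: "real \<Rightarrow> 'a \<Rightarrow> real"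
  assumes \<gamma>_pos: "0 < \<gamma>" and \<gamma>_le_1: "\<gamma> \<le> 1" and regular: "- 1 / 2 < \<beta> - \<gamma>"
    and solution: "is_solution M w a \<beta> \<gamma> X0 X"
begin

abbreviation \<rho> :: real where "\<rho> \<equiv> \<beta> - \<gamma> + 1"

lemma \<rho>_gt: "1 / 2 < \<rho>" "0 < \<rho>" using regular by auto

definition mean :: "real \<Rightarrow> real" where
  "mean t = X0 * mittag_leffler \<beta> 1 (- a * t powr \<beta>)"

lemma mean_eq: "0 < t \<Longrightarrow> mean t = X0 * G 1 t"
  by (simp add: mean_def ml_kernel_def)

lemma X_measurable [measurable]: "0 \<le> t \<Longrightarrow> X t \<in> borel_measurable M"
  using solution by (simp add: is_solution_def)

lemma X_continuous: "AE \<omega> in M. continuous_on {0..} (\<lambda>t. X t \<omega>)"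
  using solution by (simp add: is_solution_def)

lemma X_0: "AE \<omega> in M. X 0 \<omega> = X0"
  using solution by (simp add: is_solution_def)

lemma X_equation:
  assumes "0 < T"
  shows "AE \<omega> in M. \<forall>t\<in>{0..T}. frac_integral (1 - \<beta>) (\<lambda>s. X s \<omega>) t =
     - a * (LBINT s:{0..t}. X s \<omega>) + frac_integral (1 - \<gamma>) (\<lambda>s. w s \<omega>) t"
  using solution assms unfolding is_solution_def by blast

text \<open>One null set serves all times up to \<open>T\<close>, so that the identity can be differentiated in time.\<close>

lemma integrated_solution:
  assumes T: "0 < T"
  shows "AE \<omega> in M. \<forall>t\<in>{0..T}. (LBINT r:{0..t}. X r \<omega>) =
     X0 * G 2 t + conv (G \<rho>) (\<lambda>r. indicator {0..T} r * w r \<omega>) t"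
  using X_equation[OF T] X_continuous X_0 w_continuous w_0
proof eventually_elim
  case (elim \<omega>)
  show ?case
  proof
    fix t assume t: "t \<in> {0..T}"
    have "(LBINT r:{0..t}. X r \<omega>) = X 0 \<omega> * G 2 t + conv (G \<rho>) (\<lambda>r. indicator {0..t} r * w r \<omega>) t"
      by (rule pathwise_solution[OF elim(2,4,5) \<gamma>_pos \<gamma>_le_1]) (use t elim(1) in auto)
    also have "conv (G \<rho>) (\<lambda>r. indicator {0..t} r * w r \<omega>) t = conv (G \<rho>) (\<lambda>r. indicator {0..T} r * w r \<omega>) t"
      using t by (intro conv_cong_upto G_causal \<rho>_gt) (auto simp: indicator_def)
    finally show "(LBINT r:{0..t}. X r \<omega>) = X0 * G 2 t + conv (G \<rho>) (\<lambda>r. indicator {0..T} r * w r \<omega>) t"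
      using elim(3) by simp
  qed
qed

lemma kernel_measurable: "set_borel_measurable lborel {0..t} (solution_kernel a \<beta> \<gamma> t)"
  unfolding set_borel_measurable_def solution_kernel_eq by measurable

lemma solution_at_0:
  "has_wiener_integral M w 0 (solution_kernel a \<beta> \<gamma> 0) (\<lambda>\<omega>. X 0 \<omega> - mean 0)"
proof (rule has_wiener_integral_limit)
  have P: "partition_upto 0 0 (\<lambda>_. 0)" by (simp add: partition_upto_def)
  show "has_wiener_integral M w 0 (step_function 0 (\<lambda>_. 0) (\<lambda>_. 0)) (step_wiener_integral w 0 (\<lambda>_. 0) (\<lambda>_. 0))" for j :: nat
    by (rule has_wiener_integral_step[OF P])
  show "(\<lambda>\<omega>. X 0 \<omega> - mean 0) \<in> borel_measurable M" by simp
  show "AE \<omega> in M. (\<lambda>j. step_wiener_integral w 0 (\<lambda>_. 0) (\<lambda>_. 0) \<omega>) \<longlonglongrightarrow> X 0 \<omega> - mean 0"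
    using X_0 by eventually_elim (simp add: step_wiener_integral_def mean_def mittag_leffler_1_0)
  have "(\<integral>\<^sup>+s\<in>{0..0}. ennreal ((solution_kernel a \<beta> \<gamma> 0 s - step_function 0 (\<lambda>_. 0) (\<lambda>_. 0) s)\<^sup>2) \<partial>lborel) = (\<integral>\<^sup>+s. 0 \<partial>(lborel :: real measure))"
  proof (rule nn_integral_cong_AE)
    show "AE s in lborel. ennreal ((solution_kernel a \<beta> \<gamma> 0 s - step_function 0 (\<lambda>_. 0) (\<lambda>_. 0) s)\<^sup>2) * indicator {0..0} s = 0"
      using AE_lborel_singleton[of 0] by eventually_elim simp
  qed
  then show "(\<lambda>j. \<integral>\<^sup>+s\<in>{0..0}. ennreal ((solution_kernel a \<beta> \<gamma> 0 s - step_function 0 (\<lambda>_. 0) (\<lambda>_. 0) s)\<^sup>2) \<partial>lborel) \<longlonglongrightarrow> 0"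
    by simp
qed (rule kernel_measurable)

text \<open>Two evaluations of the backward difference quotients of the identity \<open>integrated_solution\<close>: along the path they tend to
  \<open>X t\<close> minus the mean, and as Wiener integrals of \<open>(G (\<rho> + 1) (t - s) - G (\<rho> + 1) (t - h - s)) / h\<close> they have the
  stated limit.\<close>

theorem solution_wiener_integral:
  assumes t0: "0 \<le> t"
  shows "has_wiener_integral M w t (solution_kernel a \<beta> \<gamma> t) (\<lambda>\<omega>. X t \<omega> - mean t)"
proof (cases "t = 0")
  case True then show ?thesis using solution_at_0 by simp
next
  case False
  then have t: "0 < t" using t0 by simp
  \<comment> \<open>Steps smaller than \<open>t\<close>, so that \<open>t - h j\<close> stays positive.\<close>
  define h where "h j = t / real (Suc (Suc j))" for j
  have h: "\<And>j. 0 < h j" "\<And>j. h j < t" using t by (auto simp: h_def divide_less_eq)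
  have hl: "h \<longlonglongrightarrow> 0"
    using tendsto_mult[OF tendsto_const LIMSEQ_Suc[OF LIMSEQ_Suc[OF lim_1_over_n]], of t] by (simp add: h_def[abs_def])
  define g where "g j r = (G \<rho> (t - r) - G \<rho> (t - h j - r)) / h j" for j r
  have B: "has_bochner_integral lborel (\<lambda>r. indicator {s..t} r * g j r)
      ((G (\<rho> + 1) (t - s) - G (\<rho> + 1) (t - h j - s)) / h j)" for j s
  proof -
    have "has_bochner_integral lborel (\<lambda>r. (indicator {s..t} r * G \<rho> (t - r) - indicator {s..t} r * G \<rho> (t - h j - r)) / h j)
      ((G (\<rho> + 1) (t - s) - G (\<rho> + 1) (t - h j - s)) / h j)"
      using h(1)[of j] by (intro has_bochner_integral_divide_zero has_bochner_integral_diff G_tail_integral \<rho>_gt) auto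
    then show ?thesis by (simp add: g_def right_diff_distrib)
  qed
  have gi: "set_integrable lborel {0..t} (g j)" for j
    using B[of 0 j] by (simp add: set_integrable_def has_bochner_integral_iff)
  have gval: "(LBINT r:{s..t}. g j r) = (G (\<rho> + 1) (t - s) - G (\<rho> + 1) (t - h j - s)) / h j" for j s
    using B[of s j] by (simp add: set_lebesgue_integral_def has_bochner_integral_iff)
  have "\<forall>j. \<exists>I. has_wiener_integral M w t (\<lambda>s. LBINT r:{s..t}. g j r) I \<and>
     (AE \<omega> in M. I \<omega> = (LBINT r:{0..t}. g j r * w r \<omega>))"
    using riemann_integral_of_path[OF t gi] by blast
  then obtain I where I: "\<And>j. has_wiener_integral M w t (\<lambda>s. LBINT r:{s..t}. g j r) (I j)"
     "\<And>j. AE \<omega> in M. I j \<omega> = (LBINT r:{0..t}. g j r * w r \<omega>)"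
    using choice[of "\<lambda>j I. has_wiener_integral M w t (\<lambda>s. LBINT r:{s..t}. g j r) I \<and>
     (AE \<omega> in M. I \<omega> = (LBINT r:{0..t}. g j r * w r \<omega>))"] by blast
  have IA: "AE \<omega> in M. \<forall>j. I j \<omega> = (LBINT r:{0..t}. g j r * w r \<omega>)"
    using I(2) by (subst AE_all_countable) simp
  show ?thesis
  proof (rule has_wiener_integral_limit[OF I(1)])
    show "(\<lambda>\<omega>. X t \<omega> - mean t) \<in> borel_measurable M" using t by simp
    show "AE \<omega> in M. (\<lambda>j. I j \<omega>) \<longlonglongrightarrow> X t \<omega> - mean t"
      using IA integrated_solution[OF t] X_continuous w_continuous
    proof eventually_elim
      case (elim \<omega>)
      let ?v = "\<lambda>r. indicator {0..t} r * w r \<omega>"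
      obtain Bd where Bd: "\<And>s. \<bar>?v s\<bar> \<le> Bd" using truncated_continuous(2)[OF elim(4), of t] by auto
      have Gi: "integrable lborel (\<lambda>r. G \<rho> (t' - r) * ?v r)" for t'
        by (rule G_integrable_bounded[OF \<rho>_gt(2) truncated_continuous(1)[OF elim(4)]]) (use Bd in auto)
      have eq: "I j \<omega> = ((LBINT r:{0..t}. X r \<omega>) - (LBINT r:{0..t - h j}. X r \<omega>)) / h j - X0 * ((G 2 t - G 2 (t - h j)) / h j)" for j
      proof -
        have "I j \<omega> = (\<integral>r. (G \<rho> (t - r) * ?v r - G \<rho> (t - h j - r) * ?v r) / h j \<partial>lborel)"
          using elim(1) unfolding set_lebesgue_integral_def
          by (simp only:) (intro Bochner_Integration.integral_cong, auto simp: g_def indicator_def left_diff_distrib)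
        also have "\<dots> = (conv (G \<rho>) ?v t - conv (G \<rho>) ?v (t - h j)) / h j"
          using Gi[of t] Gi[of "t - h j"] by (simp add: conv_def)
        also have "conv (G \<rho>) ?v t = (LBINT r:{0..t}. X r \<omega>) - X0 * G 2 t" using elim(2) t by simp
        also have "conv (G \<rho>) ?v (t - h j) = (LBINT r:{0..t - h j}. X r \<omega>) - X0 * G 2 (t - h j)"
          using elim(2)[rule_format, of "t - h j"] h(1,2)[of j] by simp
        finally show ?thesis by (simp add: diff_divide_distrib right_diff_distrib)
      qed
      have "(\<lambda>j. ((LBINT r:{0..t}. X r \<omega>) - (LBINT r:{0..t - h j}. X r \<omega>)) / h j - X0 * ((G 2 t - G 2 (t - h j)) / h j)) \<longlonglongrightarrow> X t \<omega> - X0 * G 1 t"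
        by (intro tendsto_diff tendsto_mult_left left_difference_quotients_tendsto[OF elim(3) t h hl]
            backward_quotients_tendsto[OF _ h(1) hl])
           (use ml_kernel_deriv[OF \<beta>_pos zero_less_one t, of a] in simp)
      then show ?case unfolding eq using mean_eq[OF t] by simp
    qed
    show "set_borel_measurable lborel {0..t} (solution_kernel a \<beta> \<gamma> t)" by (rule kernel_measurable)
    show "(\<lambda>j. \<integral>\<^sup>+s\<in>{0..t}. ennreal ((solution_kernel a \<beta> \<gamma> t s - (LBINT r:{s..t}. g j r))\<^sup>2) \<partial>lborel) \<longlonglongrightarrow> 0"
      unfolding gval solution_kernel_eq by (rule difference_quotient_L2[OF \<rho>_gt(1) t h(1) hl])
  qed
qed

text \<open>For each \<open>t\<close> the inner integral is at most the integral of \<open>(G \<rho>)\<^sup>2\<close> over \<open>(0, T]\<close>.\<close>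

lemma kernel_square_integrable:
  "square_integrable_on (lborel \<Otimes>\<^sub>M lborel) ({0<..<T} \<times> {0<..<T}) (\<lambda>(t, s). solution_kernel a \<beta> \<gamma> t s)"
proof -
  let ?A = "{0<..<T} \<times> {0<..<T}"
  let ?H = "\<lambda>(t, s). indicator {0<..<T} t * (indicator {0<..<T} s * (G \<rho> (t - s))\<^sup>2)"
  define V where "V = (\<integral>u. indicator {0<..T} u * (G \<rho> u)\<^sup>2 \<partial>lborel)"
  have inner: "integrable lborel (\<lambda>s. indicator {0<..<T} s * (G \<rho> (t - s))\<^sup>2) \<and>
      (\<integral>s. indicator {0<..<T} s * (G \<rho> (t - s))\<^sup>2 \<partial>lborel) \<le> V" if t: "t < T" for t
  proof -
    have m: "integrable lborel (\<lambda>s. indicator {0<..T} (t + - 1 * s) * (G \<rho> (t + - 1 * s))\<^sup>2)"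
      by (subst lborel_integrable_real_affine_iff) (auto intro: G_square_integrable \<rho>_gt)
    have le: "indicator {0<..<T} s * (G \<rho> (t - s))\<^sup>2 \<le> indicator {0<..T} (t + - 1 * s) * (G \<rho> (t + - 1 * s))\<^sup>2" for s
      using t G_nonpos_arg[of "t - s" \<rho>] by (auto simp: indicator_def)
    have i: "integrable lborel (\<lambda>s. indicator {0<..<T} s * (G \<rho> (t - s))\<^sup>2)"
      by (rule Bochner_Integration.integrable_bound[OF m]) (use le in \<open>auto intro: order.trans[OF _ abs_ge_self]\<close>)
    have "(\<integral>s. indicator {0<..<T} s * (G \<rho> (t - s))\<^sup>2 \<partial>lborel) \<le> (\<integral>s. indicator {0<..T} (t + - 1 * s) * (G \<rho> (t + - 1 * s))\<^sup>2 \<partial>lborel)"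
      by (rule integral_mono[OF i m le])
    also have "\<dots> = V" unfolding V_def by (subst (2) lborel_integral_real_affine[of "- 1" _ t]) auto
    finally show ?thesis using i by simp
  qed
  have "integrable (lborel \<Otimes>\<^sub>M lborel) ?H"
  proof (rule lborel_pair.Fubini_integrable)
    show "integrable lborel (\<lambda>t. \<integral>s. norm (?H (t, s)) \<partial>lborel)"
    proof (rule Bochner_Integration.integrable_bound)
      have "emeasure lborel {0<..<T} \<le> emeasure lborel {0..T}" by (intro emeasure_mono) auto
      also have "\<dots> < \<infinity>" by (simp add: emeasure_lborel_Icc_eq)
      finally show "integrable lborel (\<lambda>t. V * indicator {0<..<T} t)"
        by (intro integrable_mult_right integrable_real_indicator) auto
      have "norm (\<integral>s. norm (?H (t, s)) \<partial>lborel) \<le> norm (V * indicator {0<..<T} t)" for t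
      proof (cases "t \<in> {0<..<T}")
        case True
        then show ?thesis using inner[of t] by (simp add: abs_mult) (smt (verit) integral_nonneg_AE AE_I2 abs_ge_zero mult_nonneg_nonneg zero_le_power2 indicator_pos_le)
      qed simp
      then show "AE t in lborel. norm (\<integral>s. norm (?H (t, s)) \<partial>lborel) \<le> norm (V * indicator {0<..<T} t)" by simp
    qed measurable
    show "AE t in lborel. integrable lborel (\<lambda>s. ?H (t, s))"
    proof (rule AE_I2)
      fix t show "integrable lborel (\<lambda>s. ?H (t, s))"
        using inner[of t] by (cases "t \<in> {0<..<T}") auto
    qed
  qed measurable
  also have "?H = (\<lambda>x. indicator ?A x *\<^sub>R (case x of (t, s) \<Rightarrow> solution_kernel a \<beta> \<gamma> t s)\<^sup>2)"
    by (auto simp: fun_eq_iff indicator_def solution_kernel_eq)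
  finally have 1: "set_integrable (lborel \<Otimes>\<^sub>M lborel) ?A (\<lambda>x. (case x of (t, s) \<Rightarrow> solution_kernel a \<beta> \<gamma> t s)\<^sup>2)"
    by (simp add: set_integrable_def)
  have [measurable]: "?A \<in> sets (lborel \<Otimes>\<^sub>M lborel)" by (intro pair_measureI) auto
  have "set_borel_measurable (lborel \<Otimes>\<^sub>M lborel) ?A (\<lambda>(t, s). solution_kernel a \<beta> \<gamma> t s)"
    unfolding set_borel_measurable_def solution_kernel_eq by measurable
  with 1 show ?thesis by (simp add: square_integrable_on_def)
qed

theorem solution_gaussian_volterra:
  "gaussian_volterra_process M w T (solution_kernel a \<beta> \<gamma>) (\<lambda>t \<omega>. X t \<omega> - mean t)"
  unfolding gaussian_volterra_process_def
proof (intro conjI allI impI exI ballI)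
  show "solution_kernel a \<beta> \<gamma> t s = 0" if "t < s" for t s using that by (simp add: solution_kernel_def)
  show "square_integrable_on (lborel \<Otimes>\<^sub>M lborel) ({0<..<T} \<times> {0<..<T}) (\<lambda>(t, s). solution_kernel a \<beta> \<gamma> t s)"
    by (rule kernel_square_integrable)
  show "has_wiener_integral M w t (solution_kernel a \<beta> \<gamma> t) (\<lambda>\<omega>. X t \<omega> - mean t)" if "t \<in> {0..T}" for t
    using that by (intro solution_wiener_integral) auto
qed simp

text \<open>The variance of \<open>X t\<close>; time is reversed, so that it is visibly increasing in \<open>t\<close>.\<close>

definition V :: "real \<Rightarrow> real" where
  "V t = (\<integral>u. indicator {0<..t} u * (G \<rho> u)\<^sup>2 \<partial>lborel)"

lemma V_nonneg: "0 \<le> V t"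
  unfolding V_def by (intro integral_nonneg_AE) auto

lemma solution_law:
  assumes t: "0 < t"
  shows "distr M borel (X t) = gaussian_law (mean t) (V t)"
    and "expectation (X t) = mean t" and "variance (X t) = V t"
proof -
  have eq: "indicator {0<..t} (t + - 1 * s) * (G \<rho> (t + - 1 * s))\<^sup>2 = indicator {0..t} s * (solution_kernel a \<beta> \<gamma> t s)\<^sup>2" for s
    using G_nonpos_arg[of "t - s" \<rho>] by (auto simp: indicator_def solution_kernel_eq)
  have i: "integrable lborel (\<lambda>s. indicator {0..t} s * (solution_kernel a \<beta> \<gamma> t s)\<^sup>2)"
    unfolding eq[symmetric]
    by (subst lborel_integrable_real_affine_iff) (auto intro: G_square_integrable \<rho>_gt)
  have v: "(LBINT s:{0..t}. (solution_kernel a \<beta> \<gamma> t s)\<^sup>2) = V t"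
    unfolding V_def set_lebesgue_integral_def
    by (subst (2) lborel_integral_real_affine[of "- 1" _ t]) (simp_all only: eq, auto)
  show law: "distr M borel (X t) = gaussian_law (mean t) (V t)"
    using wiener_integral_law[OF solution_wiener_integral i, of "mean t"] t by (simp add: v)
  show "expectation (X t) = mean t" "variance (X t) = V t"
    using moments_of_gaussian_law[OF _ law V_nonneg] t by auto
qed

end

section \<open>Long-time behaviour\<close>

context fractional_equation
begin

lemma kernel_square_upper_bound:
  obtains C where "0 \<le> C" "\<And>t. 0 < t \<Longrightarrow> (G \<rho> t)\<^sup>2 \<le> C * t powr (- (2 * \<gamma>))"
proof -
  obtain C where C: "0 \<le> C" "\<And>t. 0 < t \<Longrightarrow> G \<rho> t \<le> C * t powr (- \<gamma>)"
    using G_upper_bound[OF \<gamma>_pos \<gamma>_le_1] by auto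
  show thesis
  proof (rule that[of "C\<^sup>2"])
    fix t :: real assume t: "0 < t"
    have "(G \<rho> t)\<^sup>2 \<le> (C * t powr (- \<gamma>))\<^sup>2"
      using C(2)[OF t] G_nonneg[of \<gamma> t] \<gamma>_pos \<gamma>_le_1 by (intro power_mono) auto
    also have "\<dots> = C\<^sup>2 * t powr (- (2 * \<gamma>))"
      by (simp add: power_mult_distrib power2_eq_square powr_add[symmetric])
    finally show "(G \<rho> t)\<^sup>2 \<le> C\<^sup>2 * t powr (- (2 * \<gamma>))" .
  qed simp
qed

lemma kernel_square_lower_bound:
  assumes "\<gamma> < 1"
  obtains c t0 where "0 < c" "0 < t0" "\<And>t. t0 \<le> t \<Longrightarrow> c * t powr (- (2 * \<gamma>)) \<le> (G \<rho> t)\<^sup>2"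
proof -
  obtain c t0 where c: "0 < c" "0 < t0" "\<And>t. t0 \<le> t \<Longrightarrow> c * t powr (- \<gamma>) \<le> G \<rho> t"
    using G_lower_bound[OF \<gamma>_pos assms] by auto
  show thesis
  proof (rule that[of "c\<^sup>2" t0])
    fix t assume t: "t0 \<le> t"
    have "c\<^sup>2 * t powr (- (2 * \<gamma>)) = (c * t powr (- \<gamma>))\<^sup>2"
      by (simp add: power_mult_distrib power2_eq_square powr_add[symmetric])
    also have "\<dots> \<le> (G \<rho> t)\<^sup>2" using c(1) c(3)[OF t] by (intro power_mono) auto
    finally show "c\<^sup>2 * t powr (- (2 * \<gamma>)) \<le> (G \<rho> t)\<^sup>2" .
  qed (use c in auto)
qed

lemma variance_increment:
  assumes "0 \<le> s" "s \<le> t"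
  shows "integrable lborel (\<lambda>u. indicator {s<..t} u * (G \<rho> u)\<^sup>2)"
    and "V t - V s = (\<integral>u. indicator {s<..t} u * (G \<rho> u)\<^sup>2 \<partial>lborel)"
proof -
  note i = G_square_integrable[OF \<rho>_gt(1)]
  have eq: "indicator {s<..t} u * (G \<rho> u)\<^sup>2 = indicator {0<..t} u * (G \<rho> u)\<^sup>2 - indicator {0<..s} u * (G \<rho> u)\<^sup>2" for u
    using assms by (auto simp: indicator_def)
  show "integrable lborel (\<lambda>u. indicator {s<..t} u * (G \<rho> u)\<^sup>2)"
    unfolding eq by (intro Bochner_Integration.integrable_diff i)
  show "V t - V s = (\<integral>u. indicator {s<..t} u * (G \<rho> u)\<^sup>2 \<partial>lborel)"
    unfolding eq V_def by (rule Bochner_Integration.integral_diff[OF i i, symmetric])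
qed

lemma has_integral_power_weight:
  assumes F: "\<And>u. 0 < u \<Longrightarrow> (F has_real_derivative u powr (- (2 * \<gamma>))) (at u)" and s: "0 < s" "s \<le> t"
  shows "has_bochner_integral lborel (\<lambda>u. indicator {s<..t} u * u powr (- (2 * \<gamma>))) (F t - F s)"
proof -
  have "has_bochner_integral lborel (\<lambda>u. u powr (- (2 * \<gamma>)) * indicator {s..t} u) (F t - F s)"
    using s by (intro has_bochner_integral_FTC_Icc_real F) (auto intro!: continuous_intros)
  moreover have "AE u in lborel. u powr (- (2 * \<gamma>)) * indicator {s..t} u = indicator {s<..t} u * u powr (- (2 * \<gamma>))"
    using AE_lborel_singleton[of s] by eventually_elim (auto simp: indicator_def)
  ultimately show ?thesis by (subst has_bochner_integral_cong_AE[symmetric]) auto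
qed

text \<open>The increments of \<open>V\<close> are bounded above and below by multiples of the increments of \<open>F\<close>, and the constants
  of integration are swallowed as \<open>F\<close> tends to infinity.\<close>

theorem variance_growth:
  assumes F: "\<And>u. 0 < u \<Longrightarrow> (F has_real_derivative u powr (- (2 * \<gamma>))) (at u)"
    and lim: "filterlim F at_top at_top" and \<gamma>: "\<gamma> < 1"
  shows "V \<in> \<Theta>[at_top](F)"
proof
  obtain C where C: "0 \<le> C" "\<And>t. 0 < t \<Longrightarrow> (G \<rho> t)\<^sup>2 \<le> C * t powr (- (2 * \<gamma>))" by (rule kernel_square_upper_bound) (rule that)
  obtain c t0 where c: "0 < c" "0 < t0" "\<And>t. t0 \<le> t \<Longrightarrow> c * t powr (- (2 * \<gamma>)) \<le> (G \<rho> t)\<^sup>2"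
    by (rule kernel_square_lower_bound[OF \<gamma>]) (rule that)
  have up: "V t \<le> V 1 + C * (F t - F 1)" if "1 \<le> t" for t
  proof -
    note inc = variance_increment[of 1 t]
    have "has_bochner_integral lborel (\<lambda>u. indicator {1<..t} u * (G \<rho> u)\<^sup>2) (V t - V 1)"
      using inc that by (simp add: has_bochner_integral_iff)
    moreover have "has_bochner_integral lborel (\<lambda>u. C * (indicator {1<..t} u * u powr (- (2 * \<gamma>)))) (C * (F t - F 1))"
      using that by (intro has_bochner_integral_mult_right has_integral_power_weight F) auto
    ultimately have "V t - V 1 \<le> C * (F t - F 1)"
      by (rule has_bochner_integral_le) (use C(2) in \<open>auto simp: indicator_def\<close>)
    then show ?thesis by simp
  qed
  have lo: "c * (F t - F t0) \<le> V t" if "t0 \<le> t" for t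
  proof -
    note inc = variance_increment[of t0 t]
    have 1: "has_bochner_integral lborel (\<lambda>u. indicator {t0<..t} u * (G \<rho> u)\<^sup>2) (V t - V t0)"
      using inc that c(2) by (simp add: has_bochner_integral_iff)
    have 2: "has_bochner_integral lborel (\<lambda>u. c * (indicator {t0<..t} u * u powr (- (2 * \<gamma>)))) (c * (F t - F t0))"
      using that c(2) by (intro has_bochner_integral_mult_right has_integral_power_weight F) auto
    have "c * (F t - F t0) \<le> V t - V t0"
      by (rule has_bochner_integral_le[OF 2 1]) (use c(3) in \<open>auto simp: indicator_def\<close>)
    then show ?thesis using V_nonneg[of t0] by simp
  qed
  have ev: "\<forall>\<^sub>F t in at_top. max (max 1 (\<bar>V 1\<bar> + C * \<bar>F 1\<bar>)) (2 * \<bar>F t0\<bar>) \<le> F t"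
    using lim unfolding filterlim_at_top by (rule spec)
  show "V \<in> O[at_top](F)"
  proof (rule bigoI[where c = "C + 1"])
    show "\<forall>\<^sub>F t in at_top. norm (V t) \<le> (C + 1) * norm (F t)"
      using ev eventually_ge_at_top[of 1]
    proof eventually_elim
      case (elim t)
      have "V t \<le> V 1 + C * (F t - F 1)" using up[OF elim(2)] .
      also have "\<dots> \<le> \<bar>V 1\<bar> + C * \<bar>F 1\<bar> + C * F t"
      proof -
        have "- (C * F 1) \<le> C * \<bar>F 1\<bar>" using C(1) by (simp add: abs_if mult_le_0_iff)
        then show ?thesis by (simp add: right_diff_distrib)
      qed
      also have "\<dots> \<le> F t + C * F t" using elim(1) by simp
      finally show ?case using V_nonneg[of t] elim(1) by (simp add: distrib_right)
    qed
  qed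
  show "V \<in> \<Omega>[at_top](F)"
  proof (rule landau_omega.bigI[where c = "c / 2"])
    show "\<forall>\<^sub>F t in at_top. c / 2 * norm (F t) \<le> norm (V t)"
      using ev eventually_ge_at_top[of t0]
    proof eventually_elim
      case (elim t)
      have "c / 2 * F t \<le> c * (F t - F t0)"
        using elim(1) mult_left_mono[of "F t / 2" "F t - F t0" c] c(1) by (simp add: max_def split: if_splits)
      also have "\<dots> \<le> V t" by (rule lo[OF elim(2)])
      finally show ?case using V_nonneg[of t] elim(1) by simp
    qed
  qed (use c in simp)
qed

lemma variance_bigtheta:
  shows "\<gamma> = 1 / 2 \<Longrightarrow> V \<in> \<Theta>[at_top](\<lambda>t. ln t)"
    and "\<gamma> < 1 / 2 \<Longrightarrow> V \<in> \<Theta>[at_top](\<lambda>t. t powr (1 - 2 * \<gamma>))"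
proof -
  assume g: "\<gamma> = 1 / 2"
  show "V \<in> \<Theta>[at_top](\<lambda>t. ln t)"
  proof (rule variance_growth)
    show "(ln has_real_derivative u powr (- (2 * \<gamma>))) (at u)" if "0 < u" for u :: real
    proof -
      have "2 * \<gamma> = 1" using g by simp
      then have "u powr (- (2 * \<gamma>)) = 1 / u" using that by (simp add: powr_minus_divide)
      then show ?thesis using DERIV_ln_divide[OF that] by simp
    qed
  qed (use g ln_at_top in auto)
next
  assume g: "\<gamma> < 1 / 2"
  have "V \<in> \<Theta>[at_top](\<lambda>t. t powr (1 - 2 * \<gamma>) / (1 - 2 * \<gamma>))"
  proof (rule variance_growth)
    show "((\<lambda>t. t powr (1 - 2 * \<gamma>) / (1 - 2 * \<gamma>)) has_real_derivative u powr (- (2 * \<gamma>))) (at u)" if "0 < u" for u :: real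
    proof -
      have "((\<lambda>t. t powr (1 - 2 * \<gamma>) / (1 - 2 * \<gamma>)) has_real_derivative
          (1 - 2 * \<gamma>) * u powr (1 - 2 * \<gamma> - 1) / (1 - 2 * \<gamma>)) (at u)"
        using that by (intro DERIV_cdivide has_real_derivative_powr)
      then show ?thesis using g by simp
    qed
    have "filterlim (\<lambda>t :: real. inverse (t powr (- (1 - 2 * \<gamma>)))) at_top at_top"
    proof (rule filterlim_inverse_at_top)
      show "((\<lambda>t :: real. t powr (- (1 - 2 * \<gamma>))) \<longlongrightarrow> 0) at_top"
        using g by (intro tendsto_neg_powr filterlim_ident) auto
      show "\<forall>\<^sub>F t :: real in at_top. 0 < t powr (- (1 - 2 * \<gamma>))"
        using eventually_gt_at_top[of 0] by eventually_elim simp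
    qed
    then have "filterlim (\<lambda>t :: real. 1 / (1 - 2 * \<gamma>) * inverse (t powr (- (1 - 2 * \<gamma>)))) at_top at_top"
      using g by (intro filterlim_tendsto_pos_mult_at_top[OF tendsto_const]) auto
    then show "filterlim (\<lambda>t. t powr (1 - 2 * \<gamma>) / (1 - 2 * \<gamma>)) at_top at_top"
      by (simp add: powr_minus[symmetric])
  qed (use g in auto)
  then have "V \<in> \<Theta>[at_top](\<lambda>t. 1 / (1 - 2 * \<gamma>) * t powr (1 - 2 * \<gamma>))" by simp
  then show "V \<in> \<Theta>[at_top](\<lambda>t. t powr (1 - 2 * \<gamma>))"
    using g by (subst (asm) landau_theta.cmult) auto
qed

lemma mean_bigo: "mean \<in> O[at_top](\<lambda>t. t powr (- \<beta>))"
proof -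
  obtain C where C: "0 \<le> C" "\<And>t. 0 < t \<Longrightarrow> G 1 t \<le> C * t powr (- \<beta>)"
    using G_upper_bound[OF \<beta>_pos \<beta>_le_1] by auto
  show ?thesis
  proof (rule bigoI[where c = "\<bar>X0\<bar> * C"])
    show "\<forall>\<^sub>F t in at_top. norm (mean t) \<le> \<bar>X0\<bar> * C * norm (t powr (- \<beta>))"
      using eventually_gt_at_top[of 0]
    proof eventually_elim
      case (elim t)
      then show ?case
        using mult_left_mono[OF C(2)[OF elim], of "\<bar>X0\<bar>"] G_1_nonneg[OF elim]
        by (simp add: mean_eq abs_mult mult.assoc)
    qed
  qed
qed

lemma mean_bigtheta:
  assumes "X0 \<noteq> 0" "\<beta> < 1" shows "mean \<in> \<Theta>[at_top](\<lambda>t. t powr (- \<beta>))"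
proof
  obtain c t0 where c: "0 < c" "0 < t0" "\<And>t. t0 \<le> t \<Longrightarrow> c * t powr (- \<beta>) \<le> G 1 t"
    using G_lower_bound[OF \<beta>_pos assms(2)] by auto
  show "mean \<in> \<Omega>[at_top](\<lambda>t. t powr (- \<beta>))"
  proof (rule landau_omega.bigI[where c = "\<bar>X0\<bar> * c"])
    show "\<forall>\<^sub>F t in at_top. \<bar>X0\<bar> * c * norm (t powr (- \<beta>)) \<le> norm (mean t)"
      using eventually_ge_at_top[of t0]
    proof eventually_elim
      case (elim t)
      have t: "0 < t" using elim c(2) by simp
      show ?case
        using mult_left_mono[OF c(3)[OF elim], of "\<bar>X0\<bar>"] G_1_nonneg[OF t] t
        by (simp add: mean_eq abs_mult mult.assoc)
    qed
  qed (use assms c in simp)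
qed (rule mean_bigo)

lemma mean_tendsto_0: "(mean \<longlongrightarrow> 0) at_top"
proof -
  from mean_bigo obtain C where "\<forall>\<^sub>F t in at_top. norm (mean t) \<le> C * norm (t powr (- \<beta>))"
    by (elim landau_o.bigE)
  then have "\<forall>\<^sub>F t in at_top. norm (mean t) \<le> C * t powr (- \<beta>)" by simp
  moreover have "((\<lambda>t. C * t powr (- \<beta>)) \<longlongrightarrow> C * 0) at_top"
    using \<beta>_pos by (intro tendsto_mult tendsto_const tendsto_neg_powr filterlim_ident) auto
  ultimately show ?thesis by (auto intro: Lim_null_comparison)
qed

text \<open>Integrability at the origin is \<open>\<rho> > 1/2\<close>; at infinity, \<open>(G \<rho>)\<^sup>2 = O(s\<^sup>-\<^sup>2\<^sup>\<gamma>)\<close> is integrable as \<open>2\<gamma> > 1\<close>.\<close>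

lemma limit_variance:
  assumes \<gamma>: "1 / 2 < \<gamma>"
  defines "k \<equiv> \<lambda>s. s powr (2 * (\<beta> - \<gamma>)) * (mittag_leffler \<beta> (\<beta> - \<gamma> + 1) (- a * s powr \<beta>))\<^sup>2"
  shows "set_integrable lborel {0..} k"
    and "(V \<longlongrightarrow> (LBINT s:{0..}. k s)) at_top"
proof -
  have k_eq: "indicator {0..} s *\<^sub>R k s = (G \<rho> s)\<^sup>2" for s
  proof (cases "0 < s")
    case True
    have "s powr (2 * (\<beta> - \<gamma>)) = (s powr (\<beta> - \<gamma>))\<^sup>2"
      by (simp add: power2_eq_square powr_add[symmetric])
    then show ?thesis using True by (simp add: k_def ml_kernel_def power_mult_distrib)
  next
    case False
    then show ?thesis by (cases "s = 0") (simp_all add: k_def ml_kernel_def)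
  qed
  obtain C where C: "0 \<le> C" "\<And>t. 0 < t \<Longrightarrow> (G \<rho> t)\<^sup>2 \<le> C * t powr (- (2 * \<gamma>))" by (rule kernel_square_upper_bound) (rule that)
  let ?F = "\<lambda>t. - (t powr (1 - 2 * \<gamma>)) / (2 * \<gamma> - 1)"
  have "(\<integral>\<^sup>+u. ennreal (u powr (- (2 * \<gamma>))) * indicator {1..} u \<partial>lborel) = ennreal (0 - ?F 1)"
  proof (rule nn_integral_FTC_atLeast[where F = ?F and T = 0])
    show "(?F has_real_derivative u powr (- (2 * \<gamma>))) (at u)" if "1 \<le> u" for u :: real
    proof -
      have "(?F has_real_derivative - ((1 - 2 * \<gamma>) * u powr (1 - 2 * \<gamma> - 1)) / (2 * \<gamma> - 1)) (at u)"
        using that by (intro DERIV_cdivide DERIV_minus has_real_derivative_powr) auto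
      moreover have "- ((1 - 2 * \<gamma>) * u powr (1 - 2 * \<gamma> - 1)) / (2 * \<gamma> - 1) = u powr (- (2 * \<gamma>))"
        using \<gamma> by (simp add: divide_eq_eq left_diff_distrib mult.commute)
      ultimately show ?thesis by simp
    qed
    have "((\<lambda>t :: real. t powr (1 - 2 * \<gamma>)) \<longlongrightarrow> 0) at_top"
      using \<gamma> by (intro tendsto_neg_powr filterlim_ident) auto
    then have "(?F \<longlongrightarrow> - 0 / (2 * \<gamma> - 1)) at_top"
      using \<gamma> by (intro tendsto_intros) auto
    then show "(?F \<longlongrightarrow> 0) at_top" by simp
  qed auto
  then have fin: "(\<integral>\<^sup>+u. ennreal (indicator {1..} u * u powr (- (2 * \<gamma>))) \<partial>lborel) < \<infinity>"
    by (simp add: indicator_mult_ennreal mult.commute)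
  have tail: "integrable lborel (\<lambda>u. indicator {1..} u * u powr (- (2 * \<gamma>)))"
    by (rule integrableI_nonneg) (use fin in auto)
  have int: "integrable lborel (\<lambda>s. (G \<rho> s)\<^sup>2)"
  proof (rule Bochner_Integration.integrable_bound)
    show "integrable lborel (\<lambda>u. indicator {0<..1} u * (G \<rho> u)\<^sup>2 + C * (indicator {1..} u * u powr (- (2 * \<gamma>))))"
      by (intro Bochner_Integration.integrable_add integrable_mult_right tail G_square_integrable \<rho>_gt)
    have "norm ((G \<rho> u)\<^sup>2) \<le> norm (indicator {0<..1} u * (G \<rho> u)\<^sup>2 + C * (indicator {1..} u * u powr (- (2 * \<gamma>))))" for u
      using C(2)[of u] C(1) G_nonpos_arg[of u \<rho>] by (auto simp: indicator_def)
    then show "AE u in lborel. norm ((G \<rho> u)\<^sup>2) \<le> norm (indicator {0<..1} u * (G \<rho> u)\<^sup>2 + C * (indicator {1..} u * u powr (- (2 * \<gamma>))))" by simp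
  qed measurable
  then show "set_integrable lborel {0..} k" unfolding set_integrable_def k_eq .
  have "V = (\<lambda>t. \<integral>u. indicator {..t} u *\<^sub>R (G \<rho> u)\<^sup>2 \<partial>lborel)"
    unfolding V_def fun_eq_iff using G_nonpos_arg
    by (intro allI Bochner_Integration.integral_cong) (auto simp: indicator_def)
  then show "(V \<longlongrightarrow> (LBINT s:{0..}. k s)) at_top"
    using tendsto_integral_at_top[OF _ int] unfolding set_lebesgue_integral_def k_eq by simp
qed

text \<open>At each time the law is Gaussian, so convergence of mean and variance gives convergence of characteristic functions.
  An arbitrary sequence of times may start with negative ones, where nothing is known about \<open>X\<close>; such terms
  are skipped by an index shift.\<close>

theorem stationary_limit:
  assumes \<gamma>: "1 / 2 < \<gamma>"
  defines "k \<equiv> \<lambda>s. s powr (2 * (\<beta> - \<gamma>)) * (mittag_leffler \<beta> (\<beta> - \<gamma> + 1) (- a * s powr \<beta>))\<^sup>2"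
  shows "converges_in_distribution_at_top M X (gaussian_law 0 (LBINT s:{0..}. k s))"
  unfolding converges_in_distribution_at_top_def
proof (intro allI impI)
  fix \<tau> :: "nat \<Rightarrow> real" assume \<tau>: "filterlim \<tau> at_top sequentially"
  define v where "v = (LBINT s:{0..}. k s)"
  have v0: "0 \<le> v" unfolding v_def set_lebesgue_integral_def by (intro integral_nonneg_AE) (auto simp: k_def)
  have Vl: "(V \<longlongrightarrow> v) at_top" unfolding v_def k_def by (rule limit_variance(2)[OF \<gamma>])
  obtain N where N: "\<And>n. N \<le> n \<Longrightarrow> 0 < \<tau> n"
    using \<tau> filterlim_at_top_dense by (auto simp: filterlim_at_top_dense eventually_sequentially)
  have \<tau>N: "filterlim (\<lambda>n. \<tau> (n + N)) at_top sequentially"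
    using \<tau> by (rule filterlim_compose) (rule filterlim_add_const_nat_at_top)
  have law: "distr M borel (X (\<tau> (n + N))) = gaussian_law (mean (\<tau> (n + N))) (V (\<tau> (n + N)))" for n
    by (rule solution_law(1)) (rule N, simp)
  have "weak_conv_m (\<lambda>n. distr M borel (X (\<tau> (n + N)))) (gaussian_law 0 v)"
    unfolding law
  proof (rule levy_continuity)
    show "real_distribution (gaussian_law (mean (\<tau> (n + N))) (V (\<tau> (n + N))))" for n
      by (rule real_distribution_gaussian_law[OF V_nonneg])
    show "real_distribution (gaussian_law 0 v)" by (rule real_distribution_gaussian_law[OF v0])
    have l: "(\<lambda>n. mean (\<tau> (n + N))) \<longlonglongrightarrow> 0" "(\<lambda>n. V (\<tau> (n + N))) \<longlonglongrightarrow> v"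
      using filterlim_compose[OF mean_tendsto_0 \<tau>N] filterlim_compose[OF Vl \<tau>N] by auto
    show "(\<lambda>n. char (gaussian_law (mean (\<tau> (n + N))) (V (\<tau> (n + N)))) \<theta>) \<longlonglongrightarrow> char (gaussian_law 0 v) \<theta>" for \<theta>
      unfolding char_gaussian_law[OF V_nonneg] char_gaussian_law[OF v0]
      by (intro tendsto_intros l) simp
  qed
  then show "weak_conv_m (\<lambda>n. distr M borel (X (\<tau> n))) (gaussian_law 0 (LBINT s:{0..}. k s))"
    unfolding weak_conv_m_def weak_conv_def v_def by (blast intro: LIMSEQ_offset)
qed

end

section \<open>The chaos expansion in the singular case\<close>

lemma has_bochner_integral_power_at_0:
  fixes \<rho> d :: real
  assumes "0 < \<rho>" "0 < d"
  shows "has_bochner_integral lborel (\<lambda>u. indicator {0<..<d} u * u powr (\<rho> - 1)) (d powr \<rho> / \<rho>)"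
proof -
  have G: "Gamma (\<rho> + 1) = \<rho> * Gamma \<rho>"
    using assms Gamma_plus1[of \<rho>] nonpos_Ints_nonpos[of \<rho>] by auto
  have Gp: "Gamma \<rho> \<noteq> 0" using assms less_imp_neq[OF Gamma_real_pos, of \<rho>] by auto
  have "has_bochner_integral lborel (\<lambda>u. Gamma \<rho> * (riesz 1 (d - u) * riesz \<rho> u)) (Gamma \<rho> * riesz (1 + \<rho>) d)"
    using assms by (intro has_bochner_integral_mult_right has_bochner_integral_riesz_riesz) auto
  also have "(\<lambda>u. Gamma \<rho> * (riesz 1 (d - u) * riesz \<rho> u)) = (\<lambda>u. indicator {0<..<d} u * u powr (\<rho> - 1))"
    using Gp by (auto simp: fun_eq_iff riesz_1 riesz_def[of \<rho>] indicator_def)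
  also have "Gamma \<rho> * riesz (1 + \<rho>) d = d powr \<rho> / \<rho>"
    using G Gp assms by (simp add: riesz_def add.commute)
  finally show ?thesis .
qed

lemma cos_basis_measurable [measurable]: "cos_basis T k \<in> borel_measurable borel"
  unfolding cos_basis_def by measurable

lemma square_integrable_bounded:
  fixes f :: "real \<Rightarrow> real"
  assumes T: "0 < T" and f: "f \<in> borel_measurable borel" and B: "0 \<le> B" "\<And>t. 0 < t \<Longrightarrow> t < T \<Longrightarrow> \<bar>f t\<bar> \<le> B"
  shows "square_integrable_on lborel {0<..<T} f" and "(LBINT t:{0<..<T}. (f t)\<^sup>2) \<le> T * B\<^sup>2"
proof -
  have m: "has_bochner_integral lborel (\<lambda>t. B\<^sup>2 * indicator {0<..<T} t) (B\<^sup>2 * T)"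
    using T has_bochner_integral_mult_right[OF has_bochner_integral_real_indicator[of "{0<..<T}" lborel], of "B\<^sup>2"] by simp
  note mI = m[unfolded has_bochner_integral_iff, THEN conjunct1]
  have le: "indicator {0<..<T} t *\<^sub>R (f t)\<^sup>2 \<le> B\<^sup>2 * indicator {0<..<T} t" for t
    using B(2)[of t] B(1) by (auto simp: indicator_def power2_le_iff_abs_le)
  have i: "integrable lborel (\<lambda>t. indicator {0<..<T} t *\<^sub>R (f t)\<^sup>2)"
    by (rule Bochner_Integration.integrable_bound[OF mI])
       (use f le in \<open>auto intro: order.trans[OF _ abs_ge_self]\<close>)
  then show "square_integrable_on lborel {0<..<T} f"
    using f by (simp add: square_integrable_on_def set_integrable_def set_borel_measurable_def)
  show "(LBINT t:{0<..<T}. (f t)\<^sup>2) \<le> T * B\<^sup>2"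
    unfolding set_lebesgue_integral_def
    using integral_mono[OF i mI le] unfolding has_bochner_integral_integral_eq[OF m]
    by (simp only: mult.commute)
qed

lemma unit_index_inject: "unit_index j = unit_index k \<longleftrightarrow> j = k"
proof
  assume "unit_index j = unit_index k"
  then have "unit_index j j = unit_index k j" by simp
  then show "j = k" by (simp add: unit_index_def split: if_splits)
qed simp

context relaxation
begin

text \<open>Integration by parts against the oscillation, whose antiderivative is of size \<open>1 / n\<close>. The boundary terms and
  the integral of \<open>\<bar>D\<bar>\<close> are dominated by the end \<open>d\<close> near the singularity.\<close>

lemma oscillatory_bound_away:
  assumes \<rho>: "0 < \<rho>" "\<rho> < 1" and C: "0 \<le> C" "\<And>u. u \<le> T \<Longrightarrow> \<bar>G \<rho> u\<bar> \<le> C * u powr (\<rho> - 1)"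
    and D: "\<And>u. 0 < u \<Longrightarrow> (G \<rho> has_real_derivative D u) (at u)" "continuous_on {0<..} D"
      "\<And>u. 0 < u \<Longrightarrow> u \<le> T \<Longrightarrow> \<bar>D u\<bar> \<le> C * u powr (\<rho> - 2)"
    and n: "0 < n" and d: "0 < d" "d \<le> t" "t \<le> T"
  shows "integrable lborel (\<lambda>u. G \<rho> u * cos (n * (t - u)) * indicator {d..t} u)"
    and "\<bar>\<integral>u. G \<rho> u * cos (n * (t - u)) * indicator {d..t} u \<partial>lborel\<bar>
      \<le> (C + C / (1 - \<rho>)) * d powr (\<rho> - 1) / n"
proof -
  have Gc: "isCont (G \<rho>) u" if "0 < u" for u using D(1)[OF that] by (rule DERIV_isCont)
  have Dc: "isCont D u" if "0 < u" for u
    using D(2) that by (simp add: continuous_on_eq_continuous_at)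
  let ?P = "\<lambda>u. - (G \<rho> u * sin (n * (t - u)) / n)"
  let ?f = "\<lambda>u. G \<rho> u * cos (n * (t - u))"
  let ?g = "\<lambda>u. D u * sin (n * (t - u)) / n"
  have I: "has_bochner_integral lborel (\<lambda>u. (?f u - ?g u) * indicator {d..t} u) (?P t - ?P d)"
  proof (rule has_bochner_integral_FTC_Icc_real)
    fix u assume u: "d \<le> u" "u \<le> t"
    then have "0 < u" using d by simp
    show "(?P has_real_derivative ?f u - ?g u) (at u)"
      using D(1)[OF \<open>0 < u\<close>] n by (auto intro!: derivative_eq_intros simp: field_simps)
    show "isCont (\<lambda>u. ?f u - ?g u) u"
      using n by (intro continuous_intros Gc Dc \<open>0 < u\<close>) auto
  qed (use d in auto)
  have gi: "integrable lborel (\<lambda>u. ?g u * indicator {d..t} u)"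
    using d n by (intro borel_integrable_atLeastAtMost continuous_intros Dc) auto
  show fi: "integrable lborel (\<lambda>u. ?f u * indicator {d..t} u)"
    using d by (intro borel_integrable_atLeastAtMost continuous_intros Gc) auto
  have eq: "(\<integral>u. ?f u * indicator {d..t} u \<partial>lborel) = (?P t - ?P d) + (\<integral>u. ?g u * indicator {d..t} u \<partial>lborel)"
    using has_bochner_integral_integral_eq[OF I] fi gi by (simp add: left_diff_distrib)
  have J: "has_bochner_integral lborel (\<lambda>u. u powr (\<rho> - 2) * indicator {d..t} u)
      (t powr (\<rho> - 1) / (\<rho> - 1) - d powr (\<rho> - 1) / (\<rho> - 1))"
  proof (rule has_bochner_integral_FTC_Icc_real)
    fix u assume u: "d \<le> u" "u \<le> t"
    then have u0: "0 < u" using d by simp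
    have "((\<lambda>u. u powr (\<rho> - 1) / (\<rho> - 1)) has_real_derivative (\<rho> - 1) * u powr (\<rho> - 1 - 1) / (\<rho> - 1)) (at u)"
      using u0 by (intro DERIV_cdivide has_real_derivative_powr)
    then show "((\<lambda>u. u powr (\<rho> - 1) / (\<rho> - 1)) has_real_derivative u powr (\<rho> - 2)) (at u)"
      using \<rho> by simp
    show "isCont (\<lambda>u. u powr (\<rho> - 2)) u" using u0 by (intro continuous_intros) auto
  qed (use d in auto)
  have "\<bar>\<integral>u. ?g u * indicator {d..t} u \<partial>lborel\<bar> \<le> (\<integral>u. norm (?g u * indicator {d..t} u) \<partial>lborel)"
    unfolding real_norm_def[symmetric] by (rule integral_norm_bound)
  also have "\<dots> \<le> C / n * (t powr (\<rho> - 1) / (\<rho> - 1) - d powr (\<rho> - 1) / (\<rho> - 1))"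
  proof (subst has_bochner_integral_integral_eq[OF has_bochner_integral_mult_right[OF J], symmetric], rule integral_mono)
    show "integrable lborel (\<lambda>u. norm (?g u * indicator {d..t} u))" by (intro integrable_norm gi)
    show "integrable lborel (\<lambda>u. C / n * (u powr (\<rho> - 2) * indicator {d..t} u))"
      using J by (intro integrable_mult_right) (simp add: has_bochner_integral_iff)
    fix u
    show "norm (?g u * indicator {d..t} u) \<le> C / n * (u powr (\<rho> - 2) * indicator {d..t} u)"
    proof (cases "u \<in> {d..t}")
      case True
      then have "\<bar>D u\<bar> * \<bar>sin (n * (t - u))\<bar> \<le> C * u powr (\<rho> - 2) * 1"
        using D(3)[of u] d by (intro mult_mono) auto
      then show ?thesis using True n by (simp add: abs_mult divide_right_mono)
    qed simp
  qed
  also have "\<dots> \<le> C / n * (d powr (\<rho> - 1) / (1 - \<rho>))"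
  proof (rule mult_left_mono)
    have "t powr (\<rho> - 1) / (\<rho> - 1) \<le> 0" using \<rho> by (simp add: divide_nonneg_neg)
    moreover have "- (d powr (\<rho> - 1) / (\<rho> - 1)) = d powr (\<rho> - 1) / (1 - \<rho>)"
      by (metis minus_diff_eq minus_divide_right)
    ultimately show "t powr (\<rho> - 1) / (\<rho> - 1) - d powr (\<rho> - 1) / (\<rho> - 1) \<le> d powr (\<rho> - 1) / (1 - \<rho>)" by linarith
  qed (use C n in auto)
  finally have 1: "\<bar>\<integral>u. ?g u * indicator {d..t} u \<partial>lborel\<bar> \<le> C / (1 - \<rho>) * d powr (\<rho> - 1) / n"
    by (simp add: mult_ac)
  have "\<bar>G \<rho> d\<bar> * \<bar>sin (n * (t - d))\<bar> \<le> C * d powr (\<rho> - 1) * 1"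
    using C d by (intro mult_mono) auto
  then have 2: "\<bar>?P t - ?P d\<bar> \<le> C * d powr (\<rho> - 1) / n"
    using n by (simp add: abs_mult divide_right_mono)
  show "\<bar>\<integral>u. ?f u * indicator {d..t} u \<partial>lborel\<bar> \<le> (C + C / (1 - \<rho>)) * d powr (\<rho> - 1) / n"
  proof -
    have "(C + C / (1 - \<rho>)) * d powr (\<rho> - 1) / n = C * d powr (\<rho> - 1) / n + C / (1 - \<rho>) * d powr (\<rho> - 1) / n"
      by (simp only: distrib_right add_divide_distrib)
    then show ?thesis unfolding eq
      using abs_triangle_ineq[of "?P t - ?P d" "\<integral>u. ?g u * indicator {d..t} u \<partial>lborel"] 1 2 by linarith
  qed
qed

text \<open>The split at \<open>d = 1 / n\<close> balances the two parts: the mass of \<open>u\<^sup>\<rho>\<^sup>-\<^sup>1\<close> up to \<open>d\<close> is \<open>d\<^sup>\<rho> / \<rho>\<close>, and beyond it the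
  previous lemma gives \<open>O(d\<^sup>\<rho>\<^sup>-\<^sup>1 / n)\<close>; both are \<open>O(n\<^sup>-\<^sup>\<rho>)\<close>. If \<open>t < 1 / n\<close>, the first part is everything.\<close>

lemma oscillatory_bound:
  assumes \<rho>: "0 < \<rho>" "\<rho> < 1" and T: "0 < T"
  shows "\<exists>K\<ge>0. \<forall>n>0. \<forall>t. 0 < t \<longrightarrow> t \<le> T \<longrightarrow>
     \<bar>\<integral>u. indicator {0<..t} u * (G \<rho> u * cos (n * (t - u))) \<partial>lborel\<bar> \<le> K * n powr (- \<rho>)"
proof -
  obtain C D where C: "0 \<le> C" "\<And>u. u \<le> T \<Longrightarrow> \<bar>G \<rho> u\<bar> \<le> C * u powr (\<rho> - 1)"
    and D: "\<And>u. 0 < u \<Longrightarrow> (G \<rho> has_real_derivative D u) (at u)" "continuous_on {0<..} D"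
      "\<And>u. 0 < u \<Longrightarrow> u \<le> T \<Longrightarrow> \<bar>D u\<bar> \<le> C * u powr (\<rho> - 2)"
    by (rule ml_kernel_bounds[OF \<beta>_pos less_imp_le[OF T], of a \<rho>]) (rule that)
  define K where "K = C / \<rho> + (C + C / (1 - \<rho>))"
  have K: "0 \<le> C + C / (1 - \<rho>)" "0 \<le> C / \<rho>" using C \<rho> by auto
  have "\<bar>\<integral>u. indicator {0<..t} u * (G \<rho> u * cos (n * (t - u))) \<partial>lborel\<bar> \<le> K * n powr (- \<rho>)"
    if n: "0 < n" and t: "0 < t" "t \<le> T" for n t
  proof -
    define d where "d = min (1 / n) t"
    have d: "0 < d" "d \<le> t" "d \<le> 1 / n" using n t by (auto simp: d_def)
    let ?f = "\<lambda>u. G \<rho> u * cos (n * (t - u))"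
    note P = has_bochner_integral_mult_right[OF has_bochner_integral_power_at_0[OF \<rho>(1) d(1)], of C]
    note PI = P[unfolded has_bochner_integral_iff, THEN conjunct1]
    have near: "norm (indicator {0<..<d} u * ?f u) \<le> C * (indicator {0<..<d} u * u powr (\<rho> - 1))" for u
    proof (cases "u \<in> {0<..<d}")
      case True
      have "\<bar>G \<rho> u\<bar> * \<bar>cos (n * (t - u))\<bar> \<le> C * u powr (\<rho> - 1) * 1"
        using C True d t by (intro mult_mono) auto
      then show ?thesis using True by (simp add: abs_mult)
    qed simp
    have ni: "integrable lborel (\<lambda>u. indicator {0<..<d} u * ?f u)"
    proof (rule Bochner_Integration.integrable_bound[OF PI])
      have "norm (indicator {0<..<d} u * ?f u) \<le> norm (C * (indicator {0<..<d} u * u powr (\<rho> - 1)))" for u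
        unfolding real_norm_def[of "C * _"] by (rule order.trans[OF near abs_ge_self])
      then show "AE u in lborel. norm (indicator {0<..<d} u * ?f u) \<le> norm (C * (indicator {0<..<d} u * u powr (\<rho> - 1)))"
        by (rule AE_I2)
    qed measurable
    have "\<bar>\<integral>u. indicator {0<..<d} u * ?f u \<partial>lborel\<bar> \<le> (\<integral>u. norm (indicator {0<..<d} u * ?f u) \<partial>lborel)"
      unfolding real_norm_def[symmetric] by (rule integral_norm_bound)
    also have "\<dots> \<le> C * (d powr \<rho> / \<rho>)"
      unfolding has_bochner_integral_integral_eq[OF P, symmetric]
      by (rule integral_mono[OF integrable_norm[OF ni] PI near])
    also have "\<dots> \<le> C * ((1 / n) powr \<rho> / \<rho>)"
      using d n \<rho> C by (intro mult_left_mono divide_right_mono powr_mono2) auto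
    also have "(1 / n) powr \<rho> = n powr (- \<rho>)" using n by (simp add: powr_divide powr_minus_divide)
    finally have 1: "\<bar>\<integral>u. indicator {0<..<d} u * ?f u \<partial>lborel\<bar> \<le> C / \<rho> * n powr (- \<rho>)" by simp
    note far = oscillatory_bound_away[OF \<rho> C D n d(1,2) t(2)]
    have 2: "\<bar>\<integral>u. ?f u * indicator {d..t} u \<partial>lborel\<bar> \<le> (C + C / (1 - \<rho>)) * n powr (- \<rho>)"
    proof (cases "d = t")
      case True
      have "(\<integral>u. ?f u * indicator {d..t} u \<partial>lborel) = (\<integral>u. 0 \<partial>(lborel :: real measure))"
        using AE_lborel_singleton[of t] G_meas by (intro integral_cong_AE) (auto simp: True)
      then show ?thesis using K by simp
    next
      case False
      then have "d = 1 / n" by (auto simp: d_def min_def split: if_splits)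
      moreover have "(1 / n) powr (\<rho> - 1) / n = n powr (- \<rho>)"
      proof -
        have "(1 / n) powr (\<rho> - 1) = n powr (1 - \<rho>)"
          using n by (simp add: powr_divide powr_minus_divide[symmetric])
        also have "\<dots> = n * n powr (- \<rho>)" using n by (simp add: powr_diff powr_minus_divide)
        finally show ?thesis using n by simp
      qed
      ultimately show ?thesis using far(2) by (metis times_divide_eq_right)
    qed
    have "(\<integral>u. indicator {0<..t} u * ?f u \<partial>lborel) = (\<integral>u. indicator {0<..<d} u * ?f u + ?f u * indicator {d..t} u \<partial>lborel)"
      using d by (intro Bochner_Integration.integral_cong) (auto simp: indicator_def)
    also have "\<dots> = (\<integral>u. indicator {0<..<d} u * ?f u \<partial>lborel) + (\<integral>u. ?f u * indicator {d..t} u \<partial>lborel)"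
      by (rule Bochner_Integration.integral_add[OF ni far(1)])
    finally show ?thesis using 1 2 by (simp add: K_def distrib_right)
  qed
  then show ?thesis using K by (intro exI[of _ K]) (auto simp: K_def)
qed

text \<open>The coefficient of \<open>\<xi>\<^sub>k\<close> in the formal solution.\<close>

definition fourier_coefficient :: "real \<Rightarrow> real \<Rightarrow> nat \<Rightarrow> real \<Rightarrow> real" where
  "fourier_coefficient \<rho> T k t = (LBINT s:{0..t}. G \<rho> (t - s) * cos_basis T k s)"

lemma fourier_coefficient_eq_conv:
  "fourier_coefficient \<rho> T k = conv (G \<rho>) (\<lambda>s. indicator {0..} s * cos_basis T k s)"
proof
  fix t
  show "fourier_coefficient \<rho> T k t = conv (G \<rho>) (\<lambda>s. indicator {0..} s * cos_basis T k s) t"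
    unfolding fourier_coefficient_def conv_def set_lebesgue_integral_def
    using G_nonpos_arg by (intro Bochner_Integration.integral_cong) (auto simp: indicator_def)
qed

lemma fourier_coefficient_measurable [measurable]: "fourier_coefficient \<rho> T k \<in> borel_measurable borel"
  unfolding fourier_coefficient_eq_conv by measurable

text \<open>For \<open>k \<ge> 2\<close> the frequency is \<open>n = \<pi>(k - 1) / T\<close>, and \<open>k - 1 \<ge> k / 2\<close> trades it for \<open>k\<close>. The constant mode \<open>k = 1\<close> does not
  oscillate, but only needs a bounded coefficient.\<close>

lemma fourier_coefficient_bound:
  assumes \<rho>: "0 < \<rho>" "\<rho> < 1" and T: "0 < T"
  shows "\<exists>B\<ge>0. \<forall>k\<ge>1. \<forall>t. 0 < t \<longrightarrow> t \<le> T \<longrightarrow> \<bar>fourier_coefficient \<rho> T k t\<bar> \<le> B * real k powr (- \<rho>)"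
proof -
  obtain K where K: "0 \<le> K" "\<And>n t. 0 < n \<Longrightarrow> 0 < t \<Longrightarrow> t \<le> T \<Longrightarrow>
     \<bar>\<integral>u. indicator {0<..t} u * (G \<rho> u * cos (n * (t - u))) \<partial>lborel\<bar> \<le> K * n powr (- \<rho>)"
    using oscillatory_bound[OF assms] by blast
  define B1 where "B1 = 1 / sqrt T * (\<integral>r. indicator {..T} r * \<bar>G \<rho> r\<bar> \<partial>lborel)"
  define B2 where "B2 = sqrt (2 / T) * K * (pi / (2 * T)) powr (- \<rho>)"
  have B1: "0 \<le> B1" unfolding B1_def using T by (intro mult_nonneg_nonneg integral_nonneg_AE) auto
  have B2: "0 \<le> B2" unfolding B2_def using K T by auto
  have "\<bar>fourier_coefficient \<rho> T k t\<bar> \<le> (B1 + B2) * real k powr (- \<rho>)"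
    if k: "1 \<le> k" and t: "0 < t" "t \<le> T" for k t
  proof (cases "k = 1")
    case True
    have "\<bar>fourier_coefficient \<rho> T k t\<bar> \<le> B1"
      unfolding fourier_coefficient_eq_conv B1_def
      by (rule conv_bounded[OF G_causal[OF \<rho>(1)]]) (use t T True in \<open>auto simp: cos_basis_def\<close>)
    then show ?thesis using True B2 by simp
  next
    case False
    then have k2: "2 \<le> k" using k by simp
    define n where "n = pi * (real k - 1) / T"
    have n: "0 < n" using k2 T by (simp add: n_def)
    have "fourier_coefficient \<rho> T k t = (\<integral>s. indicator {0..t} s * (G \<rho> (t - s) * (sqrt (2 / T) * cos (n * s))) \<partial>lborel)"
      unfolding fourier_coefficient_def set_lebesgue_integral_def
      using False by (intro Bochner_Integration.integral_cong) (auto simp: cos_basis_def n_def mult_ac)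
    also have "\<dots> = (\<integral>s. sqrt (2 / T) * (indicator {0<..t} (t + - 1 * s) * (G \<rho> (t + - 1 * s) * cos (n * (t - (t + - 1 * s))))) \<partial>lborel)"
      using G_nonpos_arg by (intro Bochner_Integration.integral_cong) (auto simp: indicator_def)
    also have "\<dots> = sqrt (2 / T) * (\<integral>u. indicator {0<..t} u * (G \<rho> u * cos (n * (t - u))) \<partial>lborel)"
      by (subst (2) lborel_integral_real_affine[of "- 1" _ t]) auto
    finally have eq: "fourier_coefficient \<rho> T k t = sqrt (2 / T) * (\<integral>u. indicator {0<..t} u * (G \<rho> u * cos (n * (t - u))) \<partial>lborel)" .
    have "\<bar>fourier_coefficient \<rho> T k t\<bar> \<le> sqrt (2 / T) * (K * n powr (- \<rho>))"
      unfolding eq abs_mult using K(2)[OF n t] T by (simp add: mult_left_mono)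
    also have "\<dots> \<le> sqrt (2 / T) * (K * (pi / (2 * T) * real k) powr (- \<rho>))"
    proof (intro mult_left_mono powr_mono2')
      have "pi * real k \<le> pi * (2 * (real k - 1))" using k2 by (intro mult_left_mono) auto
      then show "pi / (2 * T) * real k \<le> n" using T by (simp add: n_def field_simps)
    qed (use T K \<rho> k2 in auto)
    also have "(pi / (2 * T) * real k) powr (- \<rho>) = (pi / (2 * T)) powr (- \<rho>) * real k powr (- \<rho>)"
      by (rule powr_mult)
    finally have "\<bar>fourier_coefficient \<rho> T k t\<bar> \<le> B2 * real k powr (- \<rho>)" by (simp add: B2_def mult_ac)
    also have "\<dots> \<le> (B1 + B2) * real k powr (- \<rho>)" using B1 by (intro mult_right_mono) auto
    finally show ?thesis .
  qed
  then show ?thesis using B1 B2 by (intro exI[of _ "B1 + B2"]) auto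
qed

lemma chaos_solution_cases:
  "chaos_solution a \<beta> \<gamma> X0 T (\<lambda>_. 0) = (\<lambda>t. X0 * mittag_leffler \<beta> 1 (- a * t powr \<beta>))"
  "1 \<le> k \<Longrightarrow> chaos_solution a \<beta> \<gamma> X0 T (unit_index k) = fourier_coefficient (\<beta> - \<gamma> + 1) T k"
  "\<alpha> \<noteq> (\<lambda>_. 0) \<Longrightarrow> \<alpha> \<notin> unit_index ` {1..} \<Longrightarrow> chaos_solution a \<beta> \<gamma> X0 T \<alpha> = (\<lambda>_. 0)"
proof -
  have nz: "unit_index k \<noteq> (\<lambda>_. 0)" for k
  proof
    assume "unit_index k = (\<lambda>_. 0)"
    then have "unit_index k k = 0" by simp
    then show False by (simp add: unit_index_def)
  qed
  have none: "{k. 1 \<le> k \<and> (\<lambda>_. 0) = unit_index k} = {}" using nz[symmetric] by simp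
  show "chaos_solution a \<beta> \<gamma> X0 T (\<lambda>_. 0) = (\<lambda>t. X0 * mittag_leffler \<beta> 1 (- a * t powr \<beta>))"
    by (rule ext) (simp only: chaos_solution_def none sum.empty simp_thms if_True add_0_right)
  show "chaos_solution a \<beta> \<gamma> X0 T (unit_index k) = fourier_coefficient (\<beta> - \<gamma> + 1) T k" if "1 \<le> k"
  proof -
    have one: "{j. 1 \<le> j \<and> unit_index k = unit_index j} = {k}" using that by (auto simp: unit_index_inject)
    show ?thesis
      by (rule ext)
         (simp only: chaos_solution_def one nz if_False, simp add: fourier_coefficient_def solution_kernel_eq)
  qed
  show "chaos_solution a \<beta> \<gamma> X0 T \<alpha> = (\<lambda>_. 0)" if "\<alpha> \<noteq> (\<lambda>_. 0)" "\<alpha> \<notin> unit_index ` {1..}"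
  proof -
    have none': "{j. 1 \<le> j \<and> \<alpha> = unit_index j} = {}" using that(2) by auto
    show ?thesis
      by (rule ext) (simp only: chaos_solution_def none' sum.empty that(1) if_False add_0_right)
  qed
qed

text \<open>By \<open>chaos_solution_cases\<close> the sum over multi-indices is a single term plus a sum over \<open>k \<ge> 1\<close>, which
  \<open>fourier_coefficient_bound\<close> compares with \<open>\<Sum>k. k\<^sup>-\<^sup>2\<^sup>\<rho> q\<^sub>k\<close>.\<close>

theorem chaos_solution_q_generalized:
  assumes \<gamma>: "0 < \<gamma>" "\<gamma> \<le> 1" and rough: "\<beta> - \<gamma> \<le> - 1 / 2" and T: "0 < T"
    and q: "\<And>k. 1 \<le> k \<Longrightarrow> 0 < q k"
    and sum: "(\<lambda>k. real k powr (2 * (\<gamma> - \<beta> - 1)) * q k) summable_on {1..}"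
  shows "q_generalized_process q T (chaos_solution a \<beta> \<gamma> X0 T)"
proof -
  let ?\<rho> = "\<beta> - \<gamma> + 1" and ?x = "chaos_solution a \<beta> \<gamma> X0 T"
  have \<rho>: "0 < ?\<rho>" "?\<rho> < 1" using \<gamma> rough \<beta>_pos by auto
  obtain B where B: "0 \<le> B" "\<And>k t. 1 \<le> k \<Longrightarrow> 0 < t \<Longrightarrow> t \<le> T \<Longrightarrow> \<bar>fourier_coefficient ?\<rho> T k t\<bar> \<le> B * real k powr (- ?\<rho>)"
    using fourier_coefficient_bound[OF \<rho> T] by blast
  have fc: "square_integrable_on lborel {0<..<T} (?x (unit_index k))"
    "(LBINT t:{0<..<T}. (?x (unit_index k) t)\<^sup>2) \<le> T * (B * real k powr (- ?\<rho>))\<^sup>2" if k: "1 \<le> k" for k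
    unfolding chaos_solution_cases(2)[OF k]
    by (rule square_integrable_bounded[OF T fourier_coefficient_measurable,
          where B = "B * real k powr (- ?\<rho>)"]; use B(1) B(2)[OF k] in simp)+
  have zero: "square_integrable_on lborel {0<..<T} (?x (\<lambda>_. 0))"
  proof -
    have c: "continuous_on {0..} (\<lambda>t. X0 * mittag_leffler \<beta> 1 (- a * t powr \<beta>))"
      by (intro continuous_on_mult continuous_on_const G_1_continuous)
    have m: "(\<lambda>t. X0 * mittag_leffler \<beta> 1 (- a * t powr \<beta>)) \<in> borel_measurable borel"
    proof -
      have "continuous_on UNIV (mittag_leffler \<beta> 1)"
        using continuous_on_mittag_leffler[OF \<beta>_pos continuous_on_id] by simp
      then have [measurable]: "mittag_leffler \<beta> 1 \<in> borel_measurable borel"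
        by (rule borel_measurable_continuous_onI)
      show ?thesis by measurable
    qed
    obtain B0 where B0: "0 \<le> B0" "\<And>s. \<bar>indicator {0..T} s * (X0 * mittag_leffler \<beta> 1 (- a * s powr \<beta>))\<bar> \<le> B0"
      using truncated_continuous(2)[OF c, of T] by blast
    show ?thesis unfolding chaos_solution_cases(1)
    proof (rule square_integrable_bounded(1)[OF T m B0(1)])
      fix t assume "0 < t" "t < T"
      then show "\<bar>X0 * mittag_leffler \<beta> 1 (- a * t powr \<beta>)\<bar> \<le> B0" using B0(2)[of t] by simp
    qed
  qed
  have null: "square_integrable_on lborel {0<..<T} (\<lambda>_. 0)"
    by (simp add: square_integrable_on_def set_integrable_def set_borel_measurable_def)
  let ?a = "\<lambda>\<alpha>. (\<Prod>k | \<alpha> k \<noteq> 0. q k ^ \<alpha> k) * (LBINT t:{0<..<T}. (?x \<alpha> t)\<^sup>2)"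
  have au: "?a (unit_index k) = q k * (LBINT t:{0<..<T}. (?x (unit_index k) t)\<^sup>2)" for k
  proof -
    have "{j. unit_index k j \<noteq> 0} = {k}" by (auto simp: unit_index_def)
    then show ?thesis by (simp add: unit_index_def)
  qed
  have "(\<lambda>k. T * B\<^sup>2 * (real k powr (2 * (\<gamma> - \<beta> - 1)) * q k)) summable_on {1..}"
    by (rule summable_on_cmult_right[OF sum])
  then have "(\<lambda>k. ?a (unit_index k)) summable_on {1..}"
  proof (rule summable_on_comparison_test)
    fix k :: nat assume "k \<in> {1..}"
    then have k: "1 \<le> k" by simp
    have "(real k powr (- ?\<rho>))\<^sup>2 = real k powr (2 * (\<gamma> - \<beta> - 1))"
      by (simp add: power2_eq_square powr_add[symmetric] algebra_simps)
    then have "?a (unit_index k) \<le> q k * (T * (B\<^sup>2 * real k powr (2 * (\<gamma> - \<beta> - 1))))"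
      unfolding au using fc(2)[OF k] q[OF k] by (intro mult_left_mono) (auto simp: power_mult_distrib)
    then show "?a (unit_index k) \<le> T * B\<^sup>2 * (real k powr (2 * (\<gamma> - \<beta> - 1)) * q k)" by (simp add: mult_ac)
    have "0 \<le> (LBINT t:{0<..<T}. (?x (unit_index k) t)\<^sup>2)"
      unfolding set_lebesgue_integral_def by (intro integral_nonneg_AE) auto
    then show "0 \<le> ?a (unit_index k)" unfolding au using q[OF k] by (intro mult_nonneg_nonneg) auto
  qed
  then have "(?a \<circ> unit_index) summable_on {1..}" by (simp only: comp_def)
  then have "?a summable_on (unit_index ` {1..})"
    by (subst summable_on_reindex) (auto simp: inj_on_def unit_index_inject)
  then have "?a summable_on (insert (\<lambda>_. 0) (unit_index ` {1..}))"
    by (simp only: summable_on_insert_iff)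
  moreover have "?a summable_on (insert (\<lambda>_. 0) (unit_index ` {1..})) \<longleftrightarrow> ?a summable_on multi_indices"
  proof (rule summable_on_cong_neutral)
    fix \<alpha> assume "\<alpha> \<in> multi_indices - insert (\<lambda>_. 0) (unit_index ` {1..})"
    then show "?a \<alpha> = 0" by (simp add: chaos_solution_cases(3))
  next
    fix \<alpha> :: "nat \<Rightarrow> nat" assume "\<alpha> \<in> insert (\<lambda>_. 0) (unit_index ` {1..}) - multi_indices"
    moreover have "finite {j. unit_index k j \<noteq> 0}" for k
      by (rule finite_subset[of _ "{k}"]) (auto simp: unit_index_def)
    moreover have "unit_index k 0 = 0" if "1 \<le> k" for k using that by (simp add: unit_index_def)
    ultimately show "?a \<alpha> = 0" by (auto simp: multi_indices_def)
  qed simp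
  ultimately have "?a summable_on multi_indices" by simp
  moreover have "square_integrable_on lborel {0<..<T} (?x \<alpha>)" for \<alpha>
    using zero fc(1) null chaos_solution_cases(3)[of \<alpha>]
    by (cases "\<alpha> = (\<lambda>_. 0)"; cases "\<alpha> \<in> unit_index ` {1..}") auto
  ultimately show ?thesis unfolding q_generalized_process_def by blast
qed

end

theorem theorem4p2:
  fixes M :: "'a measure" and w :: "real \<Rightarrow> 'a \<Rightarrow> real" and a X0 \<beta> \<gamma> :: real
  assumes "standard_brownian_motion M w"
    and "a > 0"
    and "0 < \<beta>" "\<beta> \<le> 1"
    and "0 < \<gamma>" "\<gamma> \<le> 1"
  shows
    "(\<beta> - \<gamma> \<le> - 1 / 2 \<longrightarrow>
        (\<forall>T>0. \<forall>q :: nat \<Rightarrow> real.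
           (\<forall>k\<ge>1. 0 < q k \<and> q k < 1) \<longrightarrow>
           (\<lambda>k. real k powr (2 * (\<gamma> - \<beta> - 1)) * q k) summable_on {1..} \<longrightarrow>
           q_generalized_process q T (chaos_solution a \<beta> \<gamma> X0 T)))
     \<and>
     (\<beta> - \<gamma> > - 1 / 2 \<longrightarrow>
        (\<forall>X :: real \<Rightarrow> 'a \<Rightarrow> real. is_solution M w a \<beta> \<gamma> X0 X \<longrightarrow>
           (\<forall>T>0. gaussian_volterra_process M w T (solution_kernel a \<beta> \<gamma>)
                    (\<lambda>t \<omega>. X t \<omega> - X0 * mittag_leffler \<beta> 1 (- a * t powr \<beta>)))
           \<and>
           (\<gamma> > 1 / 2 \<longrightarrow>
              set_integrable lborel {0..}
                (\<lambda>s. s powr (2 * (\<beta> - \<gamma>)) * (mittag_leffler \<beta> (\<beta> - \<gamma> + 1) (- a * s powr \<beta>))\<^sup>2) \<and>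
              converges_in_distribution_at_top M X
                (gaussian_law 0
                   (LBINT s:{0..}. s powr (2 * (\<beta> - \<gamma>)) *
                      (mittag_leffler \<beta> (\<beta> - \<gamma> + 1) (- a * s powr \<beta>))\<^sup>2)))
           \<and>
           (\<gamma> = 1 / 2 \<longrightarrow>
              (\<forall>t>0. distr M borel (X t) =
                 gaussian_law (prob_space.expectation M (X t)) (prob_space.variance M (X t))) \<and>
              (\<lambda>t. prob_space.expectation M (X t)) \<in> O[at_top](\<lambda>t. t powr (- \<beta>)) \<and>
              (X0 \<noteq> 0 \<and> \<beta> < 1 \<longrightarrow>
                 (\<lambda>t. prob_space.expectation M (X t)) \<in> \<Theta>[at_top](\<lambda>t. t powr (- \<beta>))) \<and>
              (\<lambda>t. prob_space.variance M (X t)) \<in> \<Theta>[at_top](\<lambda>t. ln t))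
           \<and>
           (\<gamma> < 1 / 2 \<longrightarrow>
              (\<forall>t>0. distr M borel (X t) =
                 gaussian_law (prob_space.expectation M (X t)) (prob_space.variance M (X t))) \<and>
              (\<lambda>t. prob_space.expectation M (X t)) \<in> O[at_top](\<lambda>t. t powr (- \<beta>)) \<and>
              (X0 \<noteq> 0 \<and> \<beta> < 1 \<longrightarrow>
                 (\<lambda>t. prob_space.expectation M (X t)) \<in> \<Theta>[at_top](\<lambda>t. t powr (- \<beta>))) \<and>
              (\<lambda>t. prob_space.variance M (X t)) \<in> \<Theta>[at_top](\<lambda>t. t powr (1 - 2 * \<gamma>)))))"
proof ((rule conjI; intro impI allI), goal_cases)
  case (1 T q)
  interpret relaxation a \<beta> using assms by unfold_locales
  show ?case
    using assms 1 by (intro chaos_solution_q_generalized) auto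
next
  case (2 X)
  interpret prob_space M using assms(1) by (simp add: standard_brownian_motion_def)
  interpret fractional_equation a \<beta> M w \<gamma> X0 X
    using assms 2 by unfold_locales
  have law: "\<forall>t>0. distr M borel (X t) = gaussian_law (expectation (X t)) (variance (X t))"
    using solution_law by simp
  have "\<forall>\<^sub>F t in at_top. expectation (X t) = mean t" "\<forall>\<^sub>F t in at_top. variance (X t) = V t"
    using solution_law(2,3) by (auto intro: eventually_mono[OF eventually_gt_at_top[of 0]])
  note ev = this
  have m1: "(\<lambda>t. expectation (X t)) \<in> O[at_top](\<lambda>t. t powr (- \<beta>))"
    using mean_bigo by (subst landau_o.big.in_cong[OF ev(1)])
  have m2: "X0 \<noteq> 0 \<and> \<beta> < 1 \<longrightarrow> (\<lambda>t. expectation (X t)) \<in> \<Theta>[at_top](\<lambda>t. t powr (- \<beta>))"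
    using mean_bigtheta by (subst landau_theta.in_cong[OF ev(1)]) auto
  have v1: "\<gamma> = 1 / 2 \<Longrightarrow> (\<lambda>t. variance (X t)) \<in> \<Theta>[at_top](\<lambda>t. ln t)"
    and v2: "\<gamma> < 1 / 2 \<Longrightarrow> (\<lambda>t. variance (X t)) \<in> \<Theta>[at_top](\<lambda>t. t powr (1 - 2 * \<gamma>))"
    using variance_bigtheta by (subst landau_theta.in_cong[OF ev(2)]; simp)+
  show ?case
    using solution_gaussian_volterra limit_variance(1) stationary_limit law m1 m2 v1 v2
    unfolding mean_def by blast
qed

end
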